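(* For $-\frac{\pi}{6}\le\varphi_1<\varphi_2<\frac{\pi}{6}$, $$\lim_{x\to\infty}\frac{\#\{\mathfrak{p}: N(\mathfrak{p})\le x,\ \varphi_1\le\theta_\mathfrak{p}\le\varphi_2\}}{\#\{\mathfrak{p}: N(\mathfrak{p})\le x\}}=\frac{3}{\pi}(\varphi_2-\varphi_1),$$ where $\mathfrak{p}$ ranges over the nonzero prime ideals of $\mathfrak{O}$. In other words, the sequence $(\theta_\mathfrak{p})$, with prime ideals ordered by increasing norm, is equidistributed in $[-\frac\pi6,\frac\pi6)$.
   Context: $\omega=e^{i\pi/3}$, $\mathfrak{O}=\mathbb{Z}[\omega]$ is the ring of integers of $\mathbb{Q}(\sqrt{-3})$; it is a principal ideal domain with unit group $\{\omega^k:0\le k\le5\}$. For a nonzero ideal $\mathfrak{a}$, $N(\mathfrak{a})=|\mathfrak{O}/\mathfrak{a}|$, and $N((\mu))=|\mu|^2$. For a nonzero prime ideal $\mathfrak{p}=(\alpha)$, $\theta_\mathfrak{p}$ denotes $\arg\alpha'$ where $\alpha'$ is the unique associate of $\alpha$ with $-\frac\pi6\le\arg\alpha'<\frac\pi6$. *)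

theory Defs
  imports "HOL-Analysis.Analysis"
begin

definition omega :: complex where
  "omega = cis (pi / 3)"

definition Eis :: "complex set" where
  "Eis = {of_int a + of_int b * omega | a b. True}"

definition eis_ideal :: "complex set \<Rightarrow> bool" where
  "eis_ideal I \<longleftrightarrow> I \<subseteq> Eis \<and> 0 \<in> I \<and> (\<forall>x\<in>I. \<forall>y\<in>I. x + y \<in> I)
      \<and> (\<forall>r\<in>Eis. \<forall>x\<in>I. r * x \<in> I)"

definition eis_nonzero_prime_ideal :: "complex set \<Rightarrow> bool" where
  "eis_nonzero_prime_ideal P \<longleftrightarrow> eis_ideal P \<and> P \<noteq> {0} \<and> P \<noteq> Eis
      \<and> (\<forall>a\<in>Eis. \<forall>b\<in>Eis. a * b \<in> P \<longrightarrow> a \<in> P \<or> b \<in> P)"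

definition ideal_norm :: "complex set \<Rightarrow> nat" where
  "ideal_norm I = card ((\<lambda>z. {w \<in> Eis. z - w \<in> I}) ` Eis)"

definition principal_ideal :: "complex \<Rightarrow> complex set" where
  "principal_ideal \<alpha> = {\<alpha> * \<beta> | \<beta>. \<beta> \<in> Eis}"

definition theta :: "complex set \<Rightarrow> real" where
  "theta P = Arg (THE \<alpha>. \<alpha> \<in> Eis \<and> principal_ideal \<alpha> = P \<and> - pi / 6 \<le> Arg \<alpha> \<and> Arg \<alpha> < pi / 6)"

end

theory Submission
  imports Defs "HOL-Complex_Analysis.Complex_Analysis" "HOL-Real_Asymp.Real_Asymp"
    "HOL-Computational_Algebra.Primes"
begin

text \<open>
  By Weyl's criterion the claim amounts to cancellation, for $k \neq 0$, in the sums of the Hecke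
  characters $\chi_k(\alpha) = (\alpha/|\alpha|)^{6k}$ over primes, and this follows from a
  Tauberian theorem once the series $Z_k(s) = \sum_{\alpha \neq 0} \chi_k(\alpha) N(\alpha)^{-s}$
  are continued to a neighbourhood of $\mathrm{Re}\,s \ge 1$ and shown not to vanish there.

  The continuation uses no theta functions. With $f(\alpha) = \chi_k(\alpha) N(\alpha)^{-s}$ and a
  system $R$ of representatives modulo $\gamma$, complete multiplicativity gives
  $(1 - N(\gamma) f(\gamma)) Z_k(s) = \sum_\beta \sum_{r \in R} (f(\gamma\beta + r) - f(\gamma\beta))$,
  and the right-hand side converges for $\mathrm{Re}\,s > 1/2$. Varying $\gamma$ over $2$, $3$ and
  $2 + \omega$ removes all zeros of the factor with $\mathrm{Re}\,s \ge 1$, except the one at $s = 1$ for $k = 0$.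

  Non-vanishing is the $3$-$4$-$1$ argument, where no quadratic character can occur. For the
  Tauberian theorem the coefficients have to be non-negative, which is why the characters are used
  in the combinations $1 + \mathrm{Re}(c \chi_k)$ with $|c| \le 1$.
\<close>

section \<open>Tauberian theorems\<close>

subsection \<open>Newman's contour argument\<close>

text \<open>The map z -> (z/|z|)^6 wraps the sector of width pi/3 once around the unit circle, so
  the integer powers of its values are all the characters that Weyl's criterion needs; the exponent
  6 also makes them trivial on units. The continuation works because f(gamma beta + r) - f(gamma
  beta) is smaller than f(gamma beta) by a factor of order |beta|^(-1) = N(beta)^(-1/2). For a
  rational integer gamma = n the factor is 1 - n^(-2(s-1)), whatever k is; for n = 2 and n = 3 these
  vanish together only at s = 1, because ln 4 / ln 9 is irrational. At s = 1 and k \<noteq> 0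
  rational integers are useless, hence 2 + omega. A quadratic character would bring in the pole of
  its square at s = 1 and spoil the 3-4-1 inequality; here 2k \<noteq> 0 whenever k \<noteq> 0. The
  point k = 0, s = 1 is left over and is settled by the divergence of sum 1/N(alpha). The Tauberian
  input is a contour argument for bounded coefficients, and their boundedness is Chebyshev's
  estimate, obtained from primorials. The outcome is weighted by ln N; the same estimate shows that
  small primes are negligible when the weight is removed.\<close>

lemma powr_diff_mvt:
  fixes n y :: real
  assumes "n > 0"
  obtains \<xi> where "n < \<xi>" "\<xi> < n + 1" "(n + 1) powr y - n powr y = y * \<xi> powr (y - 1)"
proof -
  have "\<exists>z>n. z < n + 1 \<and> (n + 1) powr y - n powr y = (n + 1 - n) * (y * z powr (y - 1))"
    using assms by (intro MVT2) (auto intro!: derivative_eq_intros)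
  with that show thesis by auto
qed

text \<open>Comparison with the primitive - u powr (-x) / x, whose differences dominate the terms
  and telescope. It controls the tail of the series to the right of the imaginary axis.\<close>

lemma powr_tail_sum_le:
  fixes x :: real
  assumes "x > 0" "N \<ge> 1"
  shows "(\<Sum>n=N..<K. real (Suc n) powr (-1-x)) \<le> real N powr (-x) / x"
proof -
  have step: "real (Suc n) powr (-1-x) \<le> real n powr (-x) / x - real (Suc n) powr (-x) / x"
    if "n \<ge> 1" for n
  proof -
    obtain \<xi> where xi: "real n < \<xi>" "\<xi> < real n + 1"
      "(real n + 1) powr (-x) - real n powr (-x) = (-x) * \<xi> powr (-x - 1)"
      using powr_diff_mvt[of "real n" "-x"] \<open>n \<ge> 1\<close> by auto
    have "(real n + 1) powr (-x-1) \<le> \<xi> powr (-x-1)"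
      using xi assms by (intro powr_mono2') auto
    hence "x * (real n + 1) powr (-x-1) \<le> real n powr (-x) - (real n + 1) powr (-x)"
      using xi(3) mult_left_mono[of "(real n + 1) powr (-x-1)" "\<xi> powr (-x-1)" x] assms by linarith
    hence "(real n + 1) powr (-x-1) \<le> (real n powr (-x) - (real n + 1) powr (-x)) / x"
      using assms by (simp add: field_simps)
    moreover have "-x-1 = -1-x" by simp
    ultimately show ?thesis by (simp only: diff_divide_distrib of_nat_Suc add.commute[of 1 "real n"])
  qed
  have "(\<Sum>n=N..<K. real (Suc n) powr (-1-x)) \<le> real N powr (-x) / x - real (max N K) powr (-x) / x"
  proof (induction K)
    case (Suc K)
    show ?case
    proof (cases "N \<le> K")
      case True
      have "real (Suc K) powr (-1-x) \<le> real K powr (-x) / x - real (Suc K) powr (-x) / x"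
        using step True assms by auto
      thus ?thesis using Suc True by (simp add: max_def)
    next
      case False
      hence "max N (Suc K) = N" "{N..<Suc K} = {}" by auto
      thus ?thesis by simp
    qed
  qed (use assms in auto)
  also have "\<dots> \<le> real N powr (-x) / x" using assms by simp
  finally show ?thesis .
qed

text \<open>For y >= 1 the summand increases, so the comparison with the primitive u powr y / y
  misses the last term; this is the extra \<open>real N powr (y - 1)\<close>. The \<open>min\<close>
  in \<open>step\<close> covers both kinds of monotonicity. It controls partial sums to the left of
  the imaginary axis.\<close>

lemma powr_head_sum_le:
  fixes y :: real
  assumes "y > 0" "N \<ge> 1"
  shows "(\<Sum>n<N. real (Suc n) powr (y-1)) \<le> real N powr y / y + real N powr (y - 1)"
proof -
  have step: "min (real n powr (y-1)) (real (Suc n) powr (y-1)) \<le> real (Suc n) powr y / y - real n powr y / y"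
    if n: "n \<ge> 1" for n
  proof -
    obtain \<xi> where xi: "real n < \<xi>" "\<xi> < real n + 1"
      "(real n + 1) powr y - real n powr y = y * \<xi> powr (y - 1)"
      using powr_diff_mvt[of "real n" "y"] n by auto
    have "min (real n powr (y-1)) (real (Suc n) powr (y-1)) \<le> \<xi> powr (y-1)"
    proof (cases "y \<ge> 1")
      case True
      have "real n powr (y-1) \<le> \<xi> powr (y-1)" using xi True by (intro powr_mono2) auto
      thus ?thesis by simp
    next
      case False
      have "(real n + 1) powr (y-1) \<le> \<xi> powr (y-1)" using xi False n by (intro powr_mono2') auto
      thus ?thesis by (simp add: add.commute)
    qed
    hence "min (real n powr (y-1)) (real (Suc n) powr (y-1)) \<le> (real (Suc n) powr y - real n powr y) / y"
      using xi(3) assms(1) by (simp add: field_simps)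
    thus ?thesis by (simp add: diff_divide_distrib)
  qed
  show ?thesis
  proof (cases "y \<ge> 1")
    case True
    show ?thesis using assms(2)
    proof (induction N rule: nat_induct_at_least)
      case (Suc n)
      have "real n powr (y-1) \<le> real (Suc n) powr (y-1)" using True by (intro powr_mono2) auto
      thus ?case using step[OF Suc.hyps] Suc.IH by auto
    qed (use assms in simp)
  next
    case False
    have "(\<Sum>n<N. real (Suc n) powr (y-1)) \<le> real N powr y / y" using assms(2)
    proof (induction N rule: nat_induct_at_least)
      case base
      thus ?case using assms False by (simp add: field_simps)
    next
      case (Suc n)
      have "real (Suc n) powr (y-1) \<le> real n powr (y-1)" using False Suc.hyps by (intro powr_mono2') auto
      thus ?case using step[OF Suc.hyps] Suc.IH by auto
    qed
    thus ?thesis using powr_ge_zero[of "real N" "y-1"] by linarith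
  qed
qed

lemma has_field_derivative_Ln':
  assumes "z \<notin> \<real>\<^sub>\<le>\<^sub>0"
  shows "(Ln has_field_derivative 1 / z) (at z)"
  using has_field_derivative_Ln[OF assms] by (simp add: inverse_eq_divide)

lemma has_field_derivative_Ln_minus:
  assumes "- z \<notin> \<real>\<^sub>\<le>\<^sub>0"
  shows "((\<lambda>w. Ln (- w)) has_field_derivative 1 / z) (at z)"
proof -
  have "((\<lambda>w. - w) has_field_derivative -1) (at z)" by (auto intro!: derivative_eq_intros)
  from DERIV_chain2[OF has_field_derivative_Ln'[OF assms] this] show ?thesis by simp
qed

text \<open>The return path \<open>p\<close> is left open because it is used once as a polygon and
  once as a semicircle. The winding number is 1: 1/w has the primitive \<open>Ln w\<close> along the
  right arc and \<open>Ln (- w)\<close> along \<open>p\<close>, which avoids the nonnegative real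
  axis, and each piece contributes pi * \<i>.\<close>

lemma semicircle_cauchy:
  fixes R :: real and p :: "real \<Rightarrow> complex"
  assumes R: "R > 0" and p: "valid_path p" "pathstart p = \<i> * R" "pathfinish p = - (\<i> * R)"
    and im: "path_image p \<subseteq> S" "path_image p \<subseteq> {w. Re w < 0 \<or> Im w \<noteq> 0}"
    and S: "convex S" "0 \<in> interior S" "cball 0 R \<inter> {z. Re z \<ge> 0} \<subseteq> S"
    and h: "h holomorphic_on S"
  shows "contour_integral (part_circlepath 0 R (-(pi/2)) (pi/2)) (\<lambda>w. h w / w)
         + contour_integral p (\<lambda>w. h w / w) = 2 * pi * \<i> * h 0"
    and "(\<lambda>w. h w / w) contour_integrable_on part_circlepath 0 R (-(pi/2)) (pi/2)"
    and "(\<lambda>w. h w / w) contour_integrable_on p"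
proof -
  define A where "A = part_circlepath 0 R (-(pi/2)) (pi/2)"
  have A: "valid_path A" "pathstart A = - (\<i> * R)" "pathfinish A = \<i> * R"
    unfolding A_def pathstart_part_circlepath pathfinish_part_circlepath cis_conv_exp[symmetric]
    by (simp_all add: mult.commute complex_eq_iff)
  have Aim: "norm w = R \<and> Re w \<ge> 0" if w: "w \<in> path_image A" for w
  proof -
    obtain x where x: "x \<in> {-(pi/2)..pi/2}" "w = R * cis x"
      using w unfolding A_def path_image_part_circlepath' by (auto simp: closed_segment_eq_real_ivl)
    thus ?thesis using R cos_ge_zero[of x] by (simp add: norm_mult)
  qed
  have AS: "path_image A \<subseteq> S - {0}"
  proof
    fix w assume "w \<in> path_image A"
    from Aim[OF this] have "w \<in> cball 0 R \<inter> {z. Re z \<ge> 0}" "w \<noteq> 0" using R by auto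
    thus "w \<in> S - {0}" using S(3) by blast
  qed
  have pS: "path_image p \<subseteq> S - {0}" using im by (auto simp: subset_iff)
  define q where "q = A +++ p"
  have q: "valid_path q" "pathfinish q = pathstart q" "path_image q \<subseteq> S - {0}"
    unfolding q_def using A p AS pS by (auto simp: path_image_join)
  have vA: "((\<lambda>w. 1/w) has_contour_integral (Ln (pathfinish A) - Ln (pathstart A))) A"
  proof (rule contour_integral_primitive[of "{w. Re w \<ge> 0 \<and> w \<noteq> 0}" Ln])
    fix z :: complex assume "z \<in> {w. Re w \<ge> 0 \<and> w \<noteq> 0}"
    hence "z \<notin> \<real>\<^sub>\<le>\<^sub>0" by (auto simp: complex_nonpos_Reals_iff complex_eq_iff)
    thus "(Ln has_field_derivative 1 / z) (at z within {w. Re w \<ge> 0 \<and> w \<noteq> 0})"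
      by (intro has_field_derivative_at_within[OF has_field_derivative_Ln'])
  next
    show "path_image A \<subseteq> {w. Re w \<ge> 0 \<and> w \<noteq> 0}" using Aim R by force
  qed (fact A)
  have vp: "((\<lambda>w. 1/w) has_contour_integral (Ln (-pathfinish p) - Ln (-pathstart p))) p"
  proof (rule contour_integral_primitive[of "{w. Re w < 0 \<or> Im w \<noteq> 0}" "\<lambda>w. Ln (-w)"])
    fix z :: complex assume "z \<in> {w. Re w < 0 \<or> Im w \<noteq> 0}"
    hence "-z \<notin> \<real>\<^sub>\<le>\<^sub>0" by (auto simp: complex_nonpos_Reals_iff)
    thus "((\<lambda>w. Ln (-w)) has_field_derivative 1 / z) (at z within {w. Re w < 0 \<or> Im w \<noteq> 0})"
      by (intro has_field_derivative_at_within[OF has_field_derivative_Ln_minus])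
  qed (fact p im)+
  have "((\<lambda>w. 1/w) has_contour_integral (2 * (Ln (\<i> * R) - Ln (-(\<i>*R))))) q"
    unfolding q_def using has_contour_integral_join[OF vA vp] A p by simp
  moreover have "Ln (\<i> * R) = Ln R + \<i> * pi/2" 
    using Ln_times_of_real[of R \<i>] R by (simp add: Ln_of_real mult.commute)
  moreover have "Ln (-(\<i> * R)) = Ln R - \<i> * pi/2"
    using Ln_times_of_real[of R "-\<i>"] R by (simp add: Ln_of_real mult.commute)
  ultimately have "((\<lambda>w. 1/w) has_contour_integral (2*pi*\<i>)) q"
    by (simp add: algebra_simps)
  hence wn: "winding_number q 0 = 1"
    using winding_number_valid_path[of q 0] q contour_integral_unique by (simp add: subset_Diff_insert)
  have hint: "((\<lambda>w. h w / (w - 0)) has_contour_integral (2 * pi * \<i> * winding_number q 0 * h 0)) q"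
    using Cauchy_integral_formula_convex_simple[OF S(1) h S(2), of q] q by auto
  hence "(\<lambda>w. h w / w) contour_integrable_on q" by (auto simp: contour_integrable_on_def)
  hence ci: "(\<lambda>w. h w / w) contour_integrable_on A" "(\<lambda>w. h w / w) contour_integrable_on p"
    unfolding q_def using A(1) p(1) by simp_all
  have "contour_integral q (\<lambda>w. h w / w) = contour_integral A (\<lambda>w. h w / w) + contour_integral p (\<lambda>w. h w / w)"
    unfolding q_def using A(1) p(1) ci by simp
  moreover have "contour_integral q (\<lambda>w. h w / w) = 2 * pi * \<i> * h 0"
    using contour_integral_unique[OF hint] wn by simp
  ultimately show "contour_integral (part_circlepath 0 R (-(pi/2)) (pi/2)) (\<lambda>w. h w / w)
         + contour_integral p (\<lambda>w. h w / w) = 2 * pi * \<i> * h 0"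
    "(\<lambda>w. h w / w) contour_integrable_on part_circlepath 0 R (-(pi/2)) (pi/2)"
    "(\<lambda>w. h w / w) contour_integrable_on p"
    using ci unfolding A_def by simp_all
qed

lemma exp_neg_integral_le:
  fixes c :: real assumes "c > 0"
  shows "((\<lambda>t. exp (-(c*t))) has_integral (1 - exp (-c)) / c) {0..1}"
    and "((\<lambda>t. exp (-(c*(1-t)))) has_integral (1 - exp (-c)) / c) {0..1}"
proof -
  have "((\<lambda>t. exp (-(c*t))) has_integral (- exp (-(c*1)) / c - (- exp (-(c*0)) / c))) {0..1}"
    using assms by (intro fundamental_theorem_of_calculus)
      (auto intro!: derivative_eq_intros simp flip: has_real_derivative_iff_has_vector_derivative)
  thus "((\<lambda>t. exp (-(c*t))) has_integral (1 - exp (-c)) / c) {0..1}"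
    by (simp add: diff_divide_distrib)
  have "((\<lambda>t. exp (-(c*(1-t)))) has_integral (exp (-(c*(1-1))) / c - (exp (-(c*(1-0))) / c))) {0..1}"
    using assms by (intro fundamental_theorem_of_calculus)
      (auto intro!: derivative_eq_intros simp flip: has_real_derivative_iff_has_vector_derivative)
  thus "((\<lambda>t. exp (-(c*(1-t)))) has_integral (1 - exp (-c)) / c) {0..1}"
    by (simp add: diff_divide_distrib)
qed

text \<open>The modulus of \<open>exp (z * L)\<close> falls exponentially in the parameter, from 1
  at the endpoint on the imaginary axis, and its integral is at most 1 / (\<delta> * L). With L = ln
  N this makes the contribution of the left path vanish as N grows.\<close>

lemma damped_segment_bound:
  fixes h :: "complex \<Rightarrow> complex" and L \<delta> :: real
  assumes h: "continuous_on (closed_segment a b) h" "\<And>z. z \<in> closed_segment a b \<Longrightarrow> norm (h z) \<le> C"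
    and re: "Re a = 0 \<and> Re b = -\<delta> \<or> Re a = -\<delta> \<and> Re b = 0" and pos: "\<delta> > 0" "L > 0"
  shows "norm (contour_integral (linepath a b) (\<lambda>z. exp (z * L) * h z)) \<le> C * norm (b - a) / (\<delta> * L)"
proof -
  have C: "C \<ge> 0" using order_trans[OF norm_ge_zero h(2)[of a]] by simp
  have ci: "(\<lambda>z. exp (z * L) * h z) contour_integrable_on (linepath a b)"
    by (intro contour_integrable_continuous_linepath continuous_intros h)
  have I: "((\<lambda>x. exp (linepath a b x * L) * h (linepath a b x) * (b - a)) has_integral
     contour_integral (linepath a b) (\<lambda>z. exp (z * L) * h z)) {0..1}"
    using has_contour_integral_integral[OF ci] unfolding has_contour_integral_linepath .
  define e where "e = (\<lambda>x::real. exp (-(\<delta> * L * (if Re a = 0 then x else 1 - x))))"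
  have e: "(e has_integral (1 - exp (-(\<delta>*L))) / (\<delta>*L)) {0..1}"
    using exp_neg_integral_le[of "\<delta>*L"] pos unfolding e_def by (cases "Re a = 0") auto
  have "norm (integral {0..1} (\<lambda>x. exp (linepath a b x * L) * h (linepath a b x) * (b - a)))
        \<le> integral {0..1} (\<lambda>x. C * norm (b - a) * e x)"
  proof (rule integral_norm_bound_integral)
    show "(\<lambda>x. exp (linepath a b x * L) * h (linepath a b x) * (b - a)) integrable_on {0..1}"
      using I by blast
    show "(\<lambda>x. C * norm (b - a) * e x) integrable_on {0..1}"
      using has_integral_mult_right[OF e, of "C * norm (b - a)"] by blast
    fix x :: real assume x: "x \<in> {0..1}"
    have "norm (h (linepath a b x)) \<le> C" using x h(2) by (metis linepath_in_path)
    moreover have "Re (linepath a b x) * L = -(\<delta> * L * (if Re a = 0 then x else 1 - x))"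
      using re pos by (auto simp: linepath_def algebra_simps)
    hence "norm (exp (linepath a b x * L)) = e x" by (simp add: e_def)
    moreover have "e x \<ge> 0" by (simp add: e_def)
    ultimately have "e x * norm (b - a) * norm (h (linepath a b x)) \<le> e x * norm (b - a) * C"
      "norm (exp (linepath a b x * L)) = e x"
      by (auto intro!: mult_left_mono)
    thus "norm (exp (linepath a b x * L) * h (linepath a b x) * (b - a)) \<le> C * norm (b - a) * e x"
      by (simp add: norm_mult mult_ac)
  qed
  also have "\<dots> = C * norm (b - a) * ((1 - exp (-(\<delta>*L))) / (\<delta>*L))"
    using has_integral_mult_right[OF e, of "C * norm (b - a)"] by blast
  also have "\<dots> \<le> C * norm (b - a) * (1 / (\<delta>*L))"
    using pos C by (intro mult_left_mono divide_right_mono) auto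
  finally show ?thesis using integral_unique[OF I] by simp
qed

text \<open>On |z| = R the product z * cnj z is R^2, which turns the kernel into a multiple of Re z.
  This cancels the factor 1 / |Re z| in the bounds for tails and partial sums, which would otherwise
  blow up near the points of the circle on the imaginary axis.\<close>

lemma kernel_on_circle:
  fixes z :: complex
  assumes "norm z = R" "R > 0"
  shows "(1 + z^2 / R^2) / z = of_real (2 * Re z / R^2)"
proof -
  have "z \<noteq> 0" using assms by auto
  have "z * cnj z = of_real (R^2)" using assms complex_norm_square[of z] by (simp only: of_real_power)
  hence "of_real (R^2) + z^2 = z * (z + cnj z)"
    by (simp add: power2_eq_square algebra_simps)
  also have "\<dots> = z * of_real (2 * Re z)" by (simp only: complex_add_cnj)
  finally have *: "of_real (R^2) + z^2 = z * of_real (2 * Re z)" .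
  have "(1 + z^2 / R^2) / z = (of_real (R^2) + z^2) / (z * of_real (R^2))"
    using \<open>z \<noteq> 0\<close> assms(2) by (simp add: field_simps)
  also have "\<dots> = of_real (2 * Re z) / of_real (R^2)" unfolding * using \<open>z \<noteq> 0\<close> by simp
  finally show ?thesis by simp
qed

text \<open>Cauchy's formula with the kernel N^z (1 + z^2 / R^2) / z expresses g 0 - G N 0. On the
  right arc g - G N is a small tail. On the left the two functions are separated: G N is entire and
  is integrated over the left semicircle, whereas g is integrated along a polygon inside D, where
  N^z tends to 0. The two arcs contribute O(B / R) for large N, and R is arbitrary.\<close>

theorem newman_tauberian:
  fixes a :: "nat \<Rightarrow> complex"
  assumes bd0: "\<And>n. norm (a n) \<le> B0"
    and D: "open D" "{z. Re z \<ge> 0} \<subseteq> D" "g holomorphic_on D"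
    and sums: "\<And>z. Re z > 0 \<Longrightarrow> (\<lambda>n. a n * exp (-(1+z) * of_real (ln (real (Suc n))))) sums g z"
  shows "(\<lambda>n. a n / of_nat (Suc n)) sums g 0"
proof -
  define q where "q = (\<lambda>n z. exp (-(1+z) * of_real (ln (real (Suc n)))) :: complex)"
  define G where "G = (\<lambda>N z. \<Sum>n<N. a n * q n z)"
  \<comment> \<open>Strictly positive, so that 8 * B / e is a legitimate radius at the end.\<close>
  define B where "B = max B0 1"
  have bd: "norm (a n) \<le> B" for n using bd0[of n] by (simp add: B_def)
  have B: "B \<ge> 0" "B > 0" by (simp_all add: B_def)
  have Gh: "G N holomorphic_on S" for N S
    unfolding G_def q_def by (intro holomorphic_intros)
  have normq: "norm (q n z) = real (Suc n) powr (-1 - Re z)" for n z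
    unfolding q_def by (simp add: powr_def algebra_simps)
  have tail: "norm (g z - G N z) \<le> B * real N powr (- Re z) / Re z" if "Re z > 0" "N \<ge> 1" for z N
  proof -
    have "(\<lambda>K. G K z - G N z) \<longlonglongrightarrow> g z - G N z"
      using sums[OF that(1)] unfolding sums_def G_def q_def by (intro tendsto_intros)
    moreover have "eventually (\<lambda>K. norm (G K z - G N z) \<le> B * real N powr (- Re z) / Re z) sequentially"
    proof (rule eventually_mono[OF eventually_ge_at_top[of N]])
      fix K assume "N \<le> K"
      hence "G K z - G N z = (\<Sum>n=N..<K. a n * q n z)"
        unfolding G_def by (simp add: sum_diff_nat_ivl lessThan_atLeast0)
      also have "norm \<dots> \<le> (\<Sum>n=N..<K. B * real (Suc n) powr (-1 - Re z))"
        by (rule sum_norm_le) (use bd in \<open>auto simp: norm_mult normq intro!: mult_right_mono\<close>)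
      also have "\<dots> \<le> B * (real N powr (- Re z) / Re z)"
        unfolding sum_distrib_left[symmetric] by (intro mult_left_mono powr_tail_sum_le that B(1))
      finally show "norm (G K z - G N z) \<le> B * real N powr (- Re z) / Re z" by simp
    qed
    ultimately show ?thesis
      by (intro tendsto_upperbound[OF tendsto_norm]) auto
  qed
  have head: "norm (G N z) \<le> B * (real N powr (- Re z) / (- Re z) + real N powr (- Re z - 1))"
    if "Re z < 0" "N \<ge> 1" for z N
  proof -
    have "norm (G N z) \<le> (\<Sum>n<N. B * real (Suc n) powr (- Re z - 1))"
      unfolding G_def
      by (rule sum_norm_le) (use bd in \<open>auto simp: norm_mult normq diff_conv_add_uminus[of _ 1] add.commute[of "-1"] simp del: add_uminus_conv_diff intro!: mult_right_mono\<close>)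
    also have "\<dots> \<le> B * (real N powr (- Re z) / (- Re z) + real N powr (- Re z - 1))"
      unfolding sum_distrib_left[symmetric] using that by (intro mult_left_mono powr_head_sum_le B(1)) auto
    finally show ?thesis .
  qed
  have main: "eventually (\<lambda>N. norm (g 0 - G N 0) \<le> 4 * B / R) sequentially" if R: "R > 0" for R
  proof -
    define K0 where "K0 = (\<lambda>z::complex. 1 + z^2 / R^2)"
    define A where "A = part_circlepath 0 R (-(pi/2)) (pi/2)"
    define A' where "A' = part_circlepath 0 R (pi/2) (3*pi/2)"
    \<comment> \<open>Compactness gives one \<epsilon> by which the closed right half disc can be
      thickened inside D. This is what allows a convex set S and a path slightly to the left of the
      imaginary axis.\<close>
    have "compact (cball 0 R \<inter> {z::complex. Re z \<ge> 0})"
      by (intro compact_Int_closed compact_cball closed_halfspace_Re_ge)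
    then obtain \<epsilon> where eps: "\<epsilon> > 0" "(\<Union>x\<in>cball 0 R \<inter> {z::complex. Re z \<ge> 0}. cball x \<epsilon>) \<subseteq> D"
      using compact_subset_open_imp_cball_epsilon_subset[of "cball 0 R \<inter> {z. Re z \<ge> 0}" D] D(1,2) by blast
    define \<delta> where "\<delta> = min \<epsilon> R"
    have \<delta>: "\<delta> > 0" "\<delta> \<le> \<epsilon>" "\<delta> \<le> R" using eps R by (auto simp: \<delta>_def)
    define S where "S = cball 0 R \<inter> {z::complex. Re z \<ge> - \<delta>}"
    have SD: "S \<subseteq> D"
    proof
      fix z assume z: "z \<in> S"
      show "z \<in> D"
      proof (cases "Re z \<ge> 0")
        case False
        have "dist (\<i> * Im z) z = \<bar>Re z\<bar>" 
          by (simp add: dist_norm norm_complex_def)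
        hence "z \<in> cball (\<i> * Im z) \<epsilon>" using z \<delta> False by (auto simp: S_def)
        moreover have "\<i> * Im z \<in> cball 0 R \<inter> {z. Re z \<ge> 0}"
          using z abs_Im_le_cmod[of z] by (auto simp: S_def norm_mult)
        ultimately show ?thesis using eps(2) by blast
      qed (use D in auto)
    qed
    have Sc: "convex S" unfolding S_def by (intro convex_Int convex_cball convex_halfspace_Re_ge)
    have S0: "0 \<in> interior S"
    proof (rule interiorI[of "ball 0 \<delta>"])
      show "ball 0 \<delta> \<subseteq> S"
        using \<delta> abs_Re_le_cmod by (auto simp: S_def) (smt (verit) abs_Re_le_cmod)
    qed (use \<delta> in auto)
    have SA: "cball 0 R \<inter> {z. Re z \<ge> 0} \<subseteq> S" using \<delta> by (auto simp: S_def)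
    define p where "p = linepath (\<i> * R) (of_real (-\<delta>)) +++ linepath (of_real (-\<delta>)) (-(\<i> * R))"
    have seg: "closed_segment (\<i> * R) (of_real (-\<delta>)) \<union> closed_segment (of_real (-\<delta>)) (-(\<i> * R)) \<subseteq> S"
      using \<delta> R by (intro Un_least closed_segment_subset Sc) (auto simp: S_def norm_mult)
    have seg': "closed_segment (\<i> * R) (of_real (-\<delta>)) \<union> closed_segment (of_real (-\<delta>)) (-(\<i> * R))
         \<subseteq> {w. Re w < 0 \<or> Im w \<noteq> 0}"
    proof (intro Un_least subsetI)
      fix w assume "w \<in> closed_segment (\<i> * R) (of_real (-\<delta>))"
      then obtain u where u: "0 \<le> u" "w = (1 - u) *\<^sub>R (\<i> * R) + u *\<^sub>R of_real (-\<delta>)"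
        by (auto simp: in_segment)
      have "Re w = - (u * \<delta>)" "Im w = (1 - u) * R" unfolding u by simp_all
      thus "w \<in> {w. Re w < 0 \<or> Im w \<noteq> 0}" using u(1) \<delta> R by (cases "u = 0") auto
    next
      fix w assume "w \<in> closed_segment (of_real (-\<delta>)) (-(\<i> * R))"
      then obtain u where u: "u \<le> 1" "w = (1 - u) *\<^sub>R of_real (-\<delta>) + u *\<^sub>R (-(\<i> * R))"
        by (auto simp: in_segment)
      have "Re w = - ((1 - u) * \<delta>)" "Im w = - (u * R)" unfolding u by simp_all
      thus "w \<in> {w. Re w < 0 \<or> Im w \<noteq> 0}" using u(1) \<delta> R by (cases "u = 1") auto
    qed
    have p: "valid_path p" "pathstart p = \<i> * R" "pathfinish p = -(\<i> * R)"
      "path_image p \<subseteq> S" "path_image p \<subseteq> {w. Re w < 0 \<or> Im w \<noteq> 0}"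
      using seg seg' by (auto simp: p_def path_image_join)
    have ends: "cis (pi/2) = \<i>" "cis (3*pi/2) = -\<i>"
      using cos_3over2_pi sin_3over2_pi by (simp_all add: complex_eq_iff mult.commute)
    have A'0: "w \<in> path_image A' \<Longrightarrow> norm w = R \<and> (Re w < 0 \<or> Re w = 0 \<and> Im w \<noteq> 0)" for w
    proof -
      assume "w \<in> path_image A'"
      then obtain x where x: "x \<in> {pi/2..3*pi/2}" "w = R * cis x"
        unfolding A'_def path_image_part_circlepath' by (auto simp: closed_segment_eq_real_ivl)
      have "cos x \<le> 0"
        using cos_ge_zero[of "x - pi"] x(1) by (auto simp: cos_diff)
      moreover have "sin x \<noteq> 0" if "cos x = 0" using sin_cos_squared_add[of x] that by auto
      ultimately show ?thesis using x R by (auto simp: norm_mult mult_less_0_iff)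
    qed
    have A': "valid_path A'" "pathstart A' = \<i> * R" "pathfinish A' = -(\<i> * R)"
      "path_image A' \<subseteq> cball 0 R" "path_image A' \<subseteq> {w. Re w < 0 \<or> Im w \<noteq> 0}"
      using A'0 ends unfolding A'_def pathstart_part_circlepath pathfinish_part_circlepath cis_conv_exp[symmetric]
      by (auto simp: mult.commute)
    \<comment> \<open>Equal to 1 at 0, so the residue is unaffected; the factor N^z compensates the
      N^(-Re z) in both \<open>tail\<close> and \<open>head\<close>.\<close>
    define P where "P = (\<lambda>N z. exp (z * of_real (ln (real N))) * K0 z)"
    have Ph: "P N holomorphic_on X" for N X
      unfolding P_def K0_def by (intro holomorphic_intros) (use R in auto)
    have P0: "P N 0 = 1" for N by (simp add: P_def K0_def)
    note c1 = semicircle_cauchy[OF R p(1-3) p(4,5) Sc S0 SA, of "\<lambda>z. g z * P N z" for N, folded A_def]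
    note c2 = semicircle_cauchy[OF R A'(1-3) A'(4,5) convex_cball, of "\<lambda>z. G N z * P N z" for N, folded A_def]
    have gP: "(\<lambda>z. g z * P N z) holomorphic_on S" for N
      by (intro holomorphic_intros Ph holomorphic_on_subset[OF D(3) SD])
    have GP: "(\<lambda>z. G N z * P N z) holomorphic_on X" for N X
      by (intro holomorphic_intros Ph Gh)
    have z0: "0 \<in> interior (cball (0::complex) R)" using R by simp
    define I1 where "I1 = (\<lambda>N. contour_integral A (\<lambda>z. (g z - G N z) * P N z / z))"
    define I2 where "I2 = (\<lambda>N. contour_integral p (\<lambda>z. g z * P N z / z))"
    define I3 where "I3 = (\<lambda>N. contour_integral A' (\<lambda>z. G N z * P N z / z))"
    \<comment> \<open>The two Cauchy formulas share the right arc, so the integrands may be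
      subtracted there and only there.\<close>
    have eq: "2 * pi * \<i> * (g 0 - G N 0) = I1 N + I2 N - I3 N"
      and int1: "(\<lambda>z. (g z - G N z) * P N z / z) contour_integrable_on A" for N
    proof -
      note a = c1[OF gP, of N] and b = c2[OF z0 Int_lower1 GP, of N]
      have "(\<lambda>z. (g z - G N z) * P N z / z) = (\<lambda>z. g z * P N z / z - G N z * P N z / z)"
        by (simp add: algebra_simps diff_divide_distrib)
      moreover from this show "(\<lambda>z. (g z - G N z) * P N z / z) contour_integrable_on A"
        using contour_integrable_diff[OF a(2) b(2)] by simp
      ultimately have "I1 N = contour_integral A (\<lambda>z. g z * P N z / z) - contour_integral A (\<lambda>z. G N z * P N z / z)"
        unfolding I1_def using contour_integral_diff[OF a(2) b(2)] by simp
      thus "2 * pi * \<i> * (g 0 - G N 0) = I1 N + I2 N - I3 N"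
        unfolding right_diff_distrib a(1)[unfolded P0 mult_1_right, symmetric]
          b(1)[unfolded P0 mult_1_right, symmetric] I2_def I3_def by simp
    qed
    have normP: "norm (P N z / z) = real N powr (Re z) * (2 * \<bar>Re z\<bar> / R^2)" if "norm z = R" "N \<ge> 1" for N z
      using kernel_on_circle[OF that(1) R] that(2) R
      by (simp add: P_def K0_def norm_mult norm_divide norm_power powr_def flip: times_divide_eq_right)
    have b1: "norm (I1 N) \<le> 2 * B / R^2 * R * pi" if N: "N \<ge> 1" for N
    proof -
      have "norm (I1 N) \<le> 2 * B / R^2 * R * \<bar>pi/2 - (-(pi/2))\<bar>"
        unfolding I1_def A_def
      proof (rule contour_integral_bound_part_circlepath)
        show "(\<lambda>z. (g z - G N z) * P N z / z) contour_integrable_on part_circlepath 0 R (- (pi / 2)) (pi / 2)"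
          using int1 by (simp add: A_def)
        fix z assume "z \<in> path_image (part_circlepath 0 R (- (pi / 2)) (pi / 2))"
        then obtain x where x: "x \<in> {-(pi/2)..pi/2}" "z = R * cis x"
          unfolding path_image_part_circlepath' by (auto simp: closed_segment_eq_real_ivl)
        have z: "norm z = R" "Re z \<ge> 0" using x R cos_ge_zero[of x] by (auto simp: norm_mult)
        show "norm ((g z - G N z) * P N z / z) \<le> 2 * B / R^2"
        proof (cases "Re z = 0")
          case True
          thus ?thesis using normP[OF z(1) N] B by (auto simp: norm_mult norm_divide)
        next
          case False
          have "norm ((g z - G N z) * P N z / z) = norm (g z - G N z) * (real N powr (Re z) * (2 * \<bar>Re z\<bar> / R^2))"
            unfolding normP[OF z(1) N, symmetric] by (simp add: norm_mult norm_divide)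
          also have "\<dots> \<le> (B * real N powr (- Re z) / Re z) * (real N powr (Re z) * (2 * \<bar>Re z\<bar> / R^2))"
            by (rule mult_right_mono[OF tail]) (use False z N in auto)
          also have "\<dots> = 2 * B / R^2" using False z N R by (simp add: field_simps powr_minus)
          finally show ?thesis .
        qed
      qed (use B R in auto)
      thus ?thesis by simp
    qed
    have b3: "norm (I3 N) \<le> 2 * B / R^2 * (1 + R / N) * R * pi" if N: "N \<ge> 1" for N
    proof -
      have "norm (I3 N) \<le> 2 * B / R^2 * (1 + R / N) * R * \<bar>3*pi/2 - pi/2\<bar>"
        unfolding I3_def A'_def
      proof (rule contour_integral_bound_part_circlepath)
        show "(\<lambda>z. G N z * P N z / z) contour_integrable_on part_circlepath 0 R (pi / 2) (3*pi / 2)"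
          using c2(3)[OF z0 Int_lower1 GP, of N] by (simp add: A'_def)
        fix z assume "z \<in> path_image (part_circlepath 0 R (pi / 2) (3*pi / 2))"
        hence z: "norm z = R" "Re z \<le> 0" using A'0[of z] by (auto simp: A'_def)
        show "norm (G N z * P N z / z) \<le> 2 * B / R^2 * (1 + R / N)"
        proof (cases "Re z = 0")
          case True
          thus ?thesis using normP[OF z(1) N] B R by (auto simp: norm_mult norm_divide)
        next
          case False
          have nn: "0 \<le> real N powr (Re z) * (2 * \<bar>Re z\<bar> / R^2)"
            by (intro mult_nonneg_nonneg divide_nonneg_nonneg) auto
          have "norm (G N z * P N z / z) = norm (G N z) * (real N powr (Re z) * (2 * \<bar>Re z\<bar> / R^2))"
            unfolding normP[OF z(1) N, symmetric] by (simp add: norm_mult norm_divide)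
          also have "\<dots> \<le> (B * (real N powr (- Re z) / (- Re z) + real N powr (- Re z - 1))) * (real N powr (Re z) * (2 * \<bar>Re z\<bar> / R^2))"
            by (rule mult_right_mono[OF head nn]) (use False z N in auto)
          also have "\<dots> = 2 * B / R^2 * (1 + \<bar>Re z\<bar> / N)" using False z N R
            by (simp add: field_simps powr_minus powr_diff)
          also have "\<dots> \<le> 2 * B / R^2 * (1 + R / N)"
            using abs_Re_le_cmod[of z] z N B by (intro mult_left_mono add_left_mono divide_right_mono) auto
          finally show ?thesis .
        qed
      qed (use B R in auto)
      thus ?thesis by simp
    qed
    have cont: "continuous_on S (\<lambda>z. g z * K0 z)"
      unfolding K0_def by (intro holomorphic_on_imp_continuous_on holomorphic_intros holomorphic_on_subset[OF D(3) SD]) (use R in auto)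
    have segz: "closed_segment (\<i> * R) (of_real (-\<delta>)) \<subseteq> S - {0}" "closed_segment (of_real (-\<delta>)) (-(\<i> * R)) \<subseteq> S - {0}"
      using seg seg' by force+
    define h where "h = (\<lambda>z. g z * K0 z / z)"
    have hc: "continuous_on (S - {0}) h"
      unfolding h_def by (intro continuous_intros continuous_on_subset[OF cont]) auto
    define X where "X = closed_segment (\<i> * R) (of_real (-\<delta>)) \<union> closed_segment (of_real (-\<delta>)) (-(\<i> * R))"
    have "compact X" unfolding X_def by (intro compact_Un compact_segment)
    moreover have "continuous_on X h" using segz unfolding X_def by (intro continuous_on_subset[OF hc]) auto
    ultimately have "bounded (h ` X)" by (intro compact_imp_bounded compact_continuous_image)
    then obtain C where "\<forall>w\<in>h ` X. norm w \<le> C" unfolding bounded_iff by blast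
    hence C: "\<And>z. z \<in> X \<Longrightarrow> norm (h z) \<le> C" by blast
    define l1 where "l1 = norm (of_real (-\<delta>) - \<i> * R)"
    define l2 where "l2 = norm (-(\<i> * R) - of_real (-\<delta>))"
    have b2: "norm (I2 N) \<le> C * l1 / (\<delta> * ln N) + C * l2 / (\<delta> * ln N)" if N: "N \<ge> 2" for N
    proof -
      have L: "ln (real N) > 0" using N by simp
      have "(\<lambda>z. g z * P N z / z) = (\<lambda>z. exp (z * of_real (ln (real N))) * h z)"
        by (simp add: P_def h_def fun_eq_iff)
      hence I2: "I2 N = contour_integral p (\<lambda>z. exp (z * of_real (ln (real N))) * h z)"
        unfolding I2_def by simp
      have hcs: "continuous_on (closed_segment (\<i> * R) (of_real (-\<delta>))) h"
        "continuous_on (closed_segment (of_real (-\<delta>)) (-(\<i> * R))) h"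
        using segz by (auto intro: continuous_on_subset[OF hc])
      have "I2 N = contour_integral (linepath (\<i> * R) (of_real (-\<delta>))) (\<lambda>z. exp (z * of_real (ln (real N))) * h z)
        + contour_integral (linepath (of_real (-\<delta>)) (-(\<i> * R))) (\<lambda>z. exp (z * of_real (ln (real N))) * h z)"
        unfolding I2 p_def
        by (intro contour_integral_join contour_integrable_continuous_linepath continuous_intros hcs valid_path_linepath)
      also have "norm \<dots> \<le> C * l1 / (\<delta> * ln N) + C * l2 / (\<delta> * ln N)"
        unfolding l1_def l2_def
        by (intro norm_triangle_le add_mono damped_segment_bound hcs L \<delta>) (use C in \<open>auto simp: X_def\<close>)
      finally show ?thesis .
    qed
    have bound: "norm (g 0 - G N 0) \<le> B / R + (C * (l1 + l2) / \<delta>) / (2 * pi) * (1 / ln N) + B / R * (1 + R / N)"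
      if N: "N \<ge> 2" for N
    proof -
      have "ln (real N) > 0" using N by simp
      have "2 * pi * norm (g 0 - G N 0) = norm (I1 N + I2 N - I3 N)"
        unfolding eq[symmetric] by (simp add: norm_mult)
      also have "\<dots> \<le> norm (I1 N) + norm (I2 N) + norm (I3 N)"
        using norm_triangle_ineq4[of "I1 N + I2 N" "I3 N"] norm_triangle_ineq[of "I1 N" "I2 N"] by linarith
      also have "\<dots> \<le> 2 * B / R^2 * R * pi + (C * l1 / (\<delta> * ln N) + C * l2 / (\<delta> * ln N)) + 2 * B / R^2 * (1 + R / N) * R * pi"
        by (intro add_mono b1 b2 b3) (use N in auto)
      also have "\<dots> = 2 * pi * (B / R + (C * (l1 + l2) / \<delta>) / (2 * pi) * (1 / ln N) + B / R * (1 + R / N))"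
        using R \<delta> \<open>ln (real N) > 0\<close> by (simp add: field_simps power2_eq_square)
      finally show ?thesis by simp
    qed
    have "(\<lambda>N. B / R + (C * (l1 + l2) / \<delta>) / (2 * pi) * (1 / ln (real N)) + B / R * (1 + R / real N))
       \<longlonglongrightarrow> B / R + (C * (l1 + l2) / \<delta>) / (2 * pi) * 0 + B / R * (1 + 0)"
      by (intro tendsto_intros; real_asymp)
    hence "eventually (\<lambda>N. B / R + (C * (l1 + l2) / \<delta>) / (2 * pi) * (1 / ln (real N)) + B / R * (1 + R / real N) < 4 * B / R) sequentially"
      using R B(2) by (intro order_tendstoD(2)) (auto simp: field_simps)
    thus ?thesis
      using eventually_ge_at_top[of 2] by eventually_elim (use bound in force)
  qed
  have lim: "(\<lambda>N. G N 0) \<longlonglongrightarrow> g 0"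
  proof (rule tendstoI)
    fix e :: real assume e: "e > 0"
    \<comment> \<open>The radius 8 * B / e turns the bound 4 * B / R into e / 2.\<close>
    have "eventually (\<lambda>N. norm (g 0 - G N 0) < e) sequentially"
      using main[of "8 * B / e"] B e by (auto elim!: eventually_mono)
    thus "eventually (\<lambda>N. dist (G N 0) (g 0) < e) sequentially"
      by (simp add: dist_norm norm_minus_commute)
  qed
  have "a n * q n 0 = a n / of_nat (Suc n)" for n
    by (simp add: q_def exp_minus exp_of_real divide_inverse del: of_nat_Suc)
  with lim show ?thesis unfolding sums_def G_def by simp
qed

subsection \<open>The Wiener--Ikehara theorem\<close>

text \<open>Weierstrass's theorem for unordered sums: locally uniform convergence along the filter
  of finite subsets passes to derivatives. The majorant may depend on the point, since Dirichlet
  series and coset series have no uniform majorant on a whole half plane.\<close>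

lemma holomorphic_infsum_and_deriv:
  fixes f :: "'i \<Rightarrow> complex \<Rightarrow> complex"
  assumes U: "open U" and f: "\<And>i. i \<in> I \<Longrightarrow> f i holomorphic_on U"
    and M: "\<And>z. z \<in> U \<Longrightarrow> \<exists>V M. open V \<and> z \<in> V \<and> M summable_on I \<and> (\<forall>i\<in>I. \<forall>w\<in>V \<inter> U. norm (f i w) \<le> M i)"
  shows "(\<lambda>z. \<Sum>\<^sub>\<infinity>i\<in>I. f i z) holomorphic_on U"
    and "z \<in> U \<Longrightarrow> ((\<lambda>i. deriv (f i) z) has_sum deriv (\<lambda>z. \<Sum>\<^sub>\<infinity>i\<in>I. f i z) z) I"
proof -
  have *: "((\<lambda>z. \<Sum>\<^sub>\<infinity>i\<in>I. f i z) has_field_derivative deriv (\<lambda>z. \<Sum>\<^sub>\<infinity>i\<in>I. f i z) z) (at z) \<and>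
     ((\<lambda>i. deriv (f i) z) has_sum deriv (\<lambda>z. \<Sum>\<^sub>\<infinity>i\<in>I. f i z) z) I" if z: "z \<in> U" for z
  proof -
    obtain V M where V: "open V" "z \<in> V" "M summable_on I" "\<And>i w. i \<in> I \<Longrightarrow> w \<in> V \<inter> U \<Longrightarrow> norm (f i w) \<le> M i"
      using M[OF z] by metis
    obtain r where r: "r > 0" "cball z r \<subseteq> V \<inter> U"
      using open_contains_cball[of "V \<inter> U"] V(1,2) U z by (metis IntI open_Int)
    have ul: "uniform_limit (cball z r) (\<lambda>X y. \<Sum>i\<in>X. f i y) (\<lambda>y. \<Sum>\<^sub>\<infinity>i\<in>I. f i y) (finite_subsets_at_top I)"
      by (rule Weierstrass_m_test_general[of _ _ _ M, OF V(4) V(3)]) (use r(2) in blast)+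
    have ev: "eventually (\<lambda>X. continuous_on (cball z r) (\<lambda>y. \<Sum>i\<in>X. f i y) \<and>
       (\<forall>w\<in>ball z r. ((\<lambda>y. \<Sum>i\<in>X. f i y) has_field_derivative (\<Sum>i\<in>X. deriv (f i) w)) (at w))) (finite_subsets_at_top I)"
    proof (rule eventually_mono[OF eventually_finite_subsets_at_top_weakI])
      fix X assume X: "finite X" "X \<subseteq> I"
      have h: "f i holomorphic_on cball z r" if "i \<in> X" for i
        by (rule holomorphic_on_subset[OF f[of i]]) (use X that r in auto)
      show "continuous_on (cball z r) (\<lambda>y. \<Sum>i\<in>X. f i y) \<and>
       (\<forall>w\<in>ball z r. ((\<lambda>y. \<Sum>i\<in>X. f i y) has_field_derivative (\<Sum>i\<in>X. deriv (f i) w)) (at w))"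
      proof (intro conjI ballI)
        show "continuous_on (cball z r) (\<lambda>y. \<Sum>i\<in>X. f i y)"
          by (intro continuous_intros holomorphic_on_imp_continuous_on h)
        fix w assume w: "w \<in> ball z r"
        hence "w \<in> U" using r by auto
        thus "((\<lambda>y. \<Sum>i\<in>X. f i y) has_field_derivative (\<Sum>i\<in>X. deriv (f i) w)) (at w)"
          using X by (intro DERIV_sum holomorphic_derivI[OF f U]) auto
      qed
    qed auto
    obtain g' where g': "\<And>w. w \<in> ball z r \<Longrightarrow> ((\<lambda>y. \<Sum>\<^sub>\<infinity>i\<in>I. f i y) has_field_derivative g' w) (at w) \<and>
        ((\<lambda>X. \<Sum>i\<in>X. deriv (f i) w) \<longlongrightarrow> g' w) (finite_subsets_at_top I)"
      using has_complex_derivative_uniform_limit[OF ev ul finite_subsets_at_top_neq_bot r(1)] by metis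
    have "((\<lambda>y. \<Sum>\<^sub>\<infinity>i\<in>I. f i y) has_field_derivative g' z) (at z)"
      "((\<lambda>X. \<Sum>i\<in>X. deriv (f i) z) \<longlongrightarrow> g' z) (finite_subsets_at_top I)"
      using g'[of z] r by auto
    moreover from this(1) have "deriv (\<lambda>y. \<Sum>\<^sub>\<infinity>i\<in>I. f i y) z = g' z" by (rule DERIV_imp_deriv)
    ultimately show ?thesis by (simp add: has_sum_def)
  qed
  show "(\<lambda>z. \<Sum>\<^sub>\<infinity>i\<in>I. f i z) holomorphic_on U"
    using * unfolding holomorphic_on_def field_differentiable_def by (meson has_field_derivative_at_within)
  show "z \<in> U \<Longrightarrow> ((\<lambda>i. deriv (f i) z) has_sum deriv (\<lambda>z. \<Sum>\<^sub>\<infinity>i\<in>I. f i z) z) I"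
    using * by blast
qed

text \<open>This is n^(-s), with the minus sign built in. Written through \<open>exp\<close>, it is
  entire in s without any side condition.\<close>

definition npow :: "nat \<Rightarrow> complex \<Rightarrow> complex" where
  "npow n s = exp (- s * of_real (ln (real n)))"

lemma norm_npow: "n > 0 \<Longrightarrow> norm (npow n s) = real n powr (- Re s)"
  by (simp add: npow_def powr_def)

lemma npow_1 [simp]: "npow 1 s = 1" "npow (Suc 0) s = 1"
  by (simp_all add: npow_def)

lemma npow_add: "npow n (s + t) = npow n s * npow n t"
  by (simp add: npow_def exp_add[symmetric] algebra_simps)

lemma npow_one_right: "n > 0 \<Longrightarrow> npow n 1 = 1 / of_nat n"
  by (simp add: npow_def exp_minus exp_of_real divide_inverse)

lemma npow_holomorphic [holomorphic_intros]: "npow n holomorphic_on A"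
  unfolding npow_def by (intro holomorphic_intros)

text \<open>The error made in comparing $n^{-1-s}$ with $\int_n^{n+1} u^{-1-s}\,du$.\<close>
definition ediff :: "nat \<Rightarrow> complex \<Rightarrow> complex" where
  "ediff n s = npow n (1 + s) - (npow n s - npow (Suc n) s) / s"

lemma ediff_holomorphic: "0 \<notin> A \<Longrightarrow> ediff n holomorphic_on A"
  unfolding ediff_def by (intro holomorphic_intros) (auto simp: npow_def intro!: holomorphic_intros)

text \<open>The mean value inequality is used twice: for u^(-1-s) on [n, n+1], and then for a
  function whose derivative is the deviation just bounded and whose increment is
  \<open>ediff\<close>. Each power of n gained is one derivative.\<close>

lemma norm_ediff_le:
  assumes n: "n \<ge> 1" and s: "s \<noteq> 0" "Re s \<ge> 0"
  shows "norm (ediff n s) \<le> norm (1 + s) * real n powr (- 2 - Re s)"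
proof -
  define E where "E = (\<lambda>t u::complex. exp (- t * Ln u))"
  have E: "E t (of_nat m) = npow m t" if "m \<ge> 1" for t m
    using that by (simp add: E_def npow_def Ln_of_nat)
  define L where "L = closed_segment (of_nat n :: complex) (of_nat n + 1)"
  have L: "\<exists>x. u = of_real x \<and> real n \<le> x \<and> x \<le> real n + 1" if "u \<in> L" for u
    using that closed_segment_of_real[of "real n" "real n + 1", where 'a=complex] unfolding L_def
    by (auto simp: closed_segment_eq_real_ivl)
  have Lnp: "u \<notin> \<real>\<^sub>\<le>\<^sub>0 \<and> u \<noteq> 0" if "u \<in> L" for u using L[OF that] n by auto
  have nE: "norm (E t u) = norm u powr (- Re t)" if "u \<in> L" for t u
    using L[OF that] n by (auto simp: E_def powr_def Ln_of_real)
  have nL: "real n \<le> norm u" if "u \<in> L" for u using L[OF that] n by auto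
  have dE: "(E t has_field_derivative (- t * E (1 + t) u)) (at u within L)" if "u \<in> L" for u t
    unfolding E_def using Lnp[OF that]
    by (auto intro!: derivative_eq_intros simp: ring_distribs exp_add exp_diff exp_minus divide_inverse)
  have step: "norm (E (1+s) u - E (1+s) (of_nat n)) \<le> norm (1+s) * real n powr (- 2 - Re s)"
    if u: "u \<in> L" for u
  proof -
    have "norm (E (1+s) u - E (1+s) (of_nat n)) \<le> norm (1+s) * real n powr (- 2 - Re s) * norm (u - of_nat n)"
    proof (rule field_differentiable_bound[of L])
      show "convex L" by (simp add: L_def)
      fix z assume z: "z \<in> L"
      show "(E (1 + s) has_field_derivative - (1 + s) * E (1 + (1 + s)) z) (at z within L)" by (rule dE[OF z])
      have "norm z powr (- 2 - Re s) \<le> real n powr (- 2 - Re s)"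
        using nL[OF z] n s by (intro powr_mono2') auto
      thus "norm (- (1 + s) * E (1 + (1 + s)) z) \<le> norm (1 + s) * real n powr (- 2 - Re s)"
        unfolding norm_mult norm_minus_cancel nE[OF z] by (intro mult_left_mono) auto
    qed (use u in \<open>auto simp: L_def\<close>)
    moreover have "norm (u - of_nat n) \<le> 1"
    proof -
      obtain x where x: "u = of_real x" "real n \<le> x" "x \<le> real n + 1" using L[OF u] by blast
      have "u - of_nat n = of_real (x - real n)" using x by simp
      thus ?thesis using x(2,3) norm_of_real[of "x - real n"] by (metis abs_of_nonneg diff_ge_0_iff_ge diff_le_eq add.commute)
    qed
    moreover have "norm (1+s) * real n powr (- 2 - Re s) \<ge> 0" by simp
    ultimately show ?thesis by (meson mult_left_le order_trans)
  qed
  \<comment> \<open>Its derivative is n^(-1-s) - u^(-1-s), and its increment from n to n + 1 is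
    \<open>ediff n s\<close>.\<close>
  define \<phi> where "\<phi> = (\<lambda>u. E (1+s) (of_nat n) * u + E s u / s)"
  have "norm (\<phi> (of_nat n + 1) - \<phi> (of_nat n)) \<le> norm (1+s) * real n powr (- 2 - Re s) * norm (of_nat n + 1 - of_nat n :: complex)"
  proof (rule field_differentiable_bound[of L])
    show "convex L" by (simp add: L_def)
    fix z assume z: "z \<in> L"
    show "(\<phi> has_field_derivative (E (1+s) (of_nat n) - E (1+s) z)) (at z within L)"
      unfolding \<phi>_def using s by (auto intro!: derivative_eq_intros dE z)
    show "norm (E (1+s) (of_nat n) - E (1+s) z) \<le> norm (1+s) * real n powr (- 2 - Re s)"
      using step[OF z] by (simp add: norm_minus_commute)
  qed (auto simp: L_def)
  moreover have "\<phi> (of_nat n + 1) - \<phi> (of_nat n) = ediff n s"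
    using E[of n] E[of "Suc n"] n by (simp add: \<phi>_def ediff_def algebra_simps diff_divide_distrib)
  ultimately show ?thesis by simp
qed

definition esum :: "(nat \<Rightarrow> real) \<Rightarrow> complex \<Rightarrow> complex" where
  "esum X s = (\<Sum>\<^sub>\<infinity>n. of_real (X (Suc n)) * ediff (Suc n) s)"

lemma summable_powr_nat: "p < -1 \<Longrightarrow> summable (\<lambda>n. real (Suc n) powr p)"
  using summable_real_powr_iff[of p] by (subst summable_Suc_iff) auto

lemma summable_on_powr_nat: "p < -1 \<Longrightarrow> (\<lambda>n. real (Suc n) powr p) summable_on UNIV"
  using summable_powr_nat[of p] by (subst summable_on_UNIV_nonneg_real_iff) auto

text \<open>X n = O(n) against \<open>ediff n s\<close> = O(n^(-2 - Re s)) leaves terms of order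
  n^(-1 - Re s), so the error series converges one unit further to the left than the Dirichlet
  series it comes from.\<close>

lemma
  assumes X: "\<And>n. \<bar>X n\<bar> \<le> C * real n"
  shows esum_holomorphic: "esum X holomorphic_on {s. Re s > 0}"
    and esum_sums: "Re s > 0 \<Longrightarrow> (\<lambda>n. of_real (X (Suc n)) * ediff (Suc n) s) sums esum X s"
proof -
  have C: "C \<ge> 0" using order_trans[OF abs_ge_zero X[of 1]] by simp
  have bd: "norm (of_real (X (Suc n)) * ediff (Suc n) s) \<le> C * T * real (Suc n) powr (-1 - \<sigma>)"
    if s: "Re s > \<sigma>" "norm (1+s) \<le> T" "\<sigma> \<ge> 0" for n s \<sigma> T
  proof -
    have "norm (of_real (X (Suc n)) * ediff (Suc n) s) \<le> (C * real (Suc n)) * (norm (1+s) * real (Suc n) powr (- 2 - Re s))"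
      unfolding norm_mult norm_of_real by (rule mult_mono[OF X norm_ediff_le]) (use s C in auto)
    also have "\<dots> \<le> (C * real (Suc n)) * (T * real (Suc n) powr (- 2 - \<sigma>))"
      using s C by (intro mult_left_mono mult_mono powr_mono) (auto intro: order_trans[OF norm_ge_zero])
    also have "real (Suc n) powr (- 2 - \<sigma>) = real (Suc n) powr (-1 - \<sigma>) / real (Suc n)"
      using powr_diff[of "real (Suc n)" "-1-\<sigma>" 1] by (simp del: of_nat_Suc)
    finally show ?thesis by (simp del: of_nat_Suc add: field_simps)
  qed
  have ex: "\<exists>V M. open V \<and> z \<in> V \<and> M summable_on UNIV \<and> (\<forall>i\<in>UNIV. \<forall>w\<in>V \<inter> {s. Re s > 0}. norm (of_real (X (Suc i)) * ediff (Suc i) w) \<le> M i)"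
    if z: "z \<in> {s. Re s > 0}" for z
  proof -
    define \<sigma> where "\<sigma> = Re z / 2"
    define T where "T = norm (1 + z) + 1"
    have "open {w. Re w > \<sigma> \<and> norm (1 + w) < T}"
      by (intro open_Collect_conj open_Collect_less continuous_intros)
    moreover have "(\<lambda>n. C * T * real (Suc n) powr (-1 - \<sigma>)) summable_on UNIV"
      using z by (intro summable_on_cmult_right summable_on_powr_nat) (auto simp: \<sigma>_def)
    ultimately show ?thesis using z bd[of \<sigma> _ T]
      by (intro exI[of _ "{w. Re w > \<sigma> \<and> norm (1 + w) < T}"] exI[of _ "\<lambda>n. C * T * real (Suc n) powr (-1 - \<sigma>)"])
         (auto simp: \<sigma>_def T_def simp del: of_nat_Suc)
  qed
  show "esum X holomorphic_on {s. Re s > 0}"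
    unfolding esum_def
    by (rule holomorphic_infsum_and_deriv(1)[OF open_halfspace_Re_gt _ ex])
       (auto intro!: holomorphic_intros ediff_holomorphic)
  show "(\<lambda>n. of_real (X (Suc n)) * ediff (Suc n) s) sums esum X s" if s: "Re s > 0"
  proof -
    obtain M where M: "M summable_on UNIV" "\<And>i. norm (of_real (X (Suc i)) * ediff (Suc i) s) \<le> M i"
      using ex[of s] s by (metis (no_types, lifting) IntI UNIV_I mem_Collect_eq)
    have "(\<lambda>n. norm (of_real (X (Suc n)) * ediff (Suc n) s)) summable_on UNIV"
      by (rule Infinite_Sum.abs_summable_on_comparison_test'[OF M(1)]) (rule M(2))
    hence "(\<lambda>n. of_real (X (Suc n)) * ediff (Suc n) s) summable_on UNIV"
      by (rule abs_summable_summable)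
    thus ?thesis unfolding esum_def by (intro has_sum_imp_sums) auto
  qed
qed

text \<open>Summation by parts produces the differences n^(-s) - (n+1)^(-s), which are s n^(-1-s) up
  to the error collected in \<open>esum\<close>. The coefficients become X n / n, which are bounded
  and hence admissible in \<open>newman_tauberian\<close>.\<close>

lemma abel_sums:
  fixes x :: "nat \<Rightarrow> real"
  defines "X \<equiv> (\<lambda>n. \<Sum>m<n. x m)"
  assumes X: "\<And>n. \<bar>X n\<bar> \<le> C * real n" and s: "Re s > 1"
    and S: "(\<lambda>n. of_real (x n) * npow (Suc n) s) sums S"
  shows "(\<lambda>n. of_real (X (Suc n)) * npow (Suc n) (1 + s)) sums (esum X s + S / s)"
proof -
  have C: "C \<ge> 0" using order_trans[OF abs_ge_zero X[of 1]] by simp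
  have part: "(\<Sum>n<K. of_real (X (Suc n)) * (npow (Suc n) s - npow (Suc (Suc n)) s)) =
      (\<Sum>n<K. of_real (x n) * npow (Suc n) s) - of_real (X K) * npow (Suc K) s" for K
    by (induction K) (auto simp: X_def algebra_simps)
  have "(\<lambda>K. of_real (X K) * npow (Suc K) s) \<longlonglongrightarrow> 0"
  proof (rule Lim_null_comparison)
    show "eventually (\<lambda>K. norm (of_real (X K) * npow (Suc K) s) \<le> C * real (Suc K) powr (1 - Re s)) sequentially"
    proof (rule always_eventually, rule allI)
      fix K
      have "norm (of_real (X K) * npow (Suc K) s) \<le> (C * real (Suc K)) * real (Suc K) powr (- Re s)"
        unfolding norm_mult norm_of_real norm_npow[OF zero_less_Suc]
        using order_trans[OF X[of K], of "C * real (Suc K)"] C by (intro mult_right_mono) (auto simp: mult_left_mono)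
      also have "\<dots> = C * real (Suc K) powr (1 - Re s)"
        using powr_add[of "real (Suc K)" 1 "- Re s"] by (simp del: of_nat_Suc)
      finally show "norm (of_real (X K) * npow (Suc K) s) \<le> C * real (Suc K) powr (1 - Re s)" .
    qed
    have "(\<lambda>K. real (Suc K) powr (1 - Re s)) \<longlonglongrightarrow> 0"
      using s by (intro tendsto_neg_powr filterlim_compose[OF filterlim_real_sequentially filterlim_Suc]) auto
    from tendsto_mult_left[OF this, of C] show "(\<lambda>K. C * real (Suc K) powr (1 - Re s)) \<longlonglongrightarrow> 0" by simp
  qed
  hence "(\<lambda>n. of_real (X (Suc n)) * (npow (Suc n) s - npow (Suc (Suc n)) s)) sums (S - 0)"
    unfolding sums_def part using S unfolding sums_def by (intro tendsto_diff)
  from sums_add[OF esum_sums[OF X] sums_divide[OF this, of s]] s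
  have "(\<lambda>n. of_real (X (Suc n)) * ediff (Suc n) s + of_real (X (Suc n)) * (npow (Suc n) s - npow (Suc (Suc n)) s) / s)
     sums (esum X s + S / s)" by simp
  thus ?thesis by (simp add: ediff_def algebra_simps)
qed

text \<open>If M n exceeded A n by 2 \<epsilon> n, monotonicity would keep M m - A m above
  \<epsilon> n for all m up to (1 + \<delta>) n, and this block of the series would stay bounded
  away from 0, against Cauchy's criterion. If M n is too small, the same happens on a block to the
  left of n.\<close>

lemma mono_tauberian:
  fixes M :: "nat \<Rightarrow> real"
  assumes M: "mono M" and A: "A \<ge> 0"
    and S: "summable (\<lambda>n. (M (Suc n) - A * real (Suc n)) / real (Suc n) ^ 2)"
  shows "(\<lambda>n. M n / real n) \<longlonglongrightarrow> A"
proof (rule tendstoI)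
  fix e :: real assume e: "e > 0"
  define \<epsilon> where "\<epsilon> = e / 2"
  have \<epsilon>: "\<epsilon> > 0" "e = 2 * \<epsilon>" using e by (auto simp: \<epsilon>_def)
  \<comment> \<open>The two bounds give A * \<delta> \<le> \<epsilon>, so the drift of A m over the
    block costs at most \<epsilon> n, and keep the block between n / 2 and 2 n.\<close>
  define \<delta> where "\<delta> = min (1/2) (\<epsilon> / (A + 1))"
  have \<delta>: "\<delta> > 0" "\<delta> \<le> 1/2" unfolding \<delta>_def using \<epsilon> A by (simp, intro min.cobounded1)
  have "A * \<delta> \<le> A * (\<epsilon> / (A + 1))" using A by (intro mult_left_mono) (auto simp: \<delta>_def)
  also have "\<dots> \<le> \<epsilon>" using A \<epsilon> by (simp add: field_simps)
  finally have A\<delta>: "A * \<delta> \<le> \<epsilon>" .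
  define u where "u = (\<lambda>n. (M (Suc n) - A * real (Suc n)) / real (Suc n) ^ 2)"
  \<comment> \<open>The threshold \<delta> * \<epsilon> / 8 is what at least \<delta> n / 2 terms of
    size \<epsilon> / (4 n) add up to.\<close>
  obtain N0 where N0: "\<And>m n. m \<ge> N0 \<Longrightarrow> \<bar>sum u {m..<n}\<bar> < \<delta> * \<epsilon> / 8"
    using S[folded u_def] unfolding summable_Cauchy real_norm_def
    by (metis \<delta>(1) \<epsilon>(1) mult_pos_pos zero_less_divide_iff zero_less_numeral)
  \<comment> \<open>Since k \<le> n / 2, the condition n \<ge> 2 * N0 keeps the left block within
    the Cauchy range; n \<ge> 2 / \<delta> ensures that the floor in k loses at most half of
    \<delta> n.\<close>
  have main: "\<bar>M n / real n - A\<bar> < e" if n: "n \<ge> 2 * N0" "real n \<ge> 2 / \<delta>" "n \<ge> 1" for n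
  proof -
    define k where "k = nat \<lfloor>\<delta> * real n\<rfloor>"
    have k: "real k \<le> \<delta> * real n" "real k \<ge> \<delta> * real n - 1" using \<delta> by (auto simp: k_def)
    have k2: "real k \<ge> \<delta> * real n / 2" using k n(2) \<delta> by (simp add: field_simps)
    have up: "M n < (A + e) * real n"
    proof (rule ccontr)
      assume "\<not> M n < (A + e) * real n"
      hence Mn: "M n \<ge> (A + 2 * \<epsilon>) * real n" using \<epsilon> by simp
      have "\<epsilon> / (4 * real n) \<le> u m" if m: "m \<in> {n..<n+k}" for m
      proof -
        have m1: "real (Suc m) \<le> (1 + \<delta>) * real n" using m k(1) by (auto simp: algebra_simps)
        have "\<epsilon> * real n \<le> (A + 2 * \<epsilon>) * real n - A * ((1 + \<delta>) * real n)"
          using mult_right_mono[OF A\<delta>, of "real n"] by (simp add: algebra_simps)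
        also have "\<dots> \<le> M (Suc m) - A * real (Suc m)"
          using Mn monoD[OF M, of n "Suc m"] m mult_left_mono[OF m1 A] by auto
        finally have num: "\<epsilon> * real n \<le> M (Suc m) - A * real (Suc m)" .
        have "real (Suc m) \<le> 2 * real n" using m1 \<delta>(2) mult_right_mono[of "1+\<delta>" 2 "real n"] by simp
        hence "real (Suc m) ^ 2 \<le> (2 * real n) ^ 2" by (intro power_mono) auto
        hence "\<epsilon> * real n / (2 * real n) ^ 2 \<le> u m" unfolding u_def
          using num \<epsilon> order_trans[OF mult_nonneg_nonneg num] by (intro frac_le) auto
        thus ?thesis using n(3) by (simp add: power2_eq_square field_simps)
      qed
      hence "real (card {n..<n+k}) * (\<epsilon> / (4 * real n)) \<le> sum u {n..<n+k}"
        by (intro sum_bounded_below) auto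
      moreover have "real k * (\<epsilon> / (4 * real n)) \<ge> (\<delta> * real n / 2) * (\<epsilon> / (4 * real n))"
        using k2 \<epsilon> by (intro mult_right_mono) auto
      moreover have "(\<delta> * real n / 2) * (\<epsilon> / (4 * real n)) = \<delta> * \<epsilon> / 8" using n(3) by simp
      ultimately show False using N0[of n "n+k"] n(1) by simp
    qed
    have lo: "M n > (A - e) * real n"
    proof (rule ccontr)
      assume "\<not> M n > (A - e) * real n"
      hence Mn: "M n \<le> (A - 2 * \<epsilon>) * real n" using \<epsilon> by simp
      have kn: "2 * k \<le> n" using k(1) \<delta>(2) mult_right_mono[of \<delta> "1/2" "real n"] by linarith
      have "u m \<le> - (\<epsilon> / real n)" if m: "m \<in> {n-k..<n}" for m
      proof -
        have m1: "real (Suc m) \<ge> (1 - \<delta>) * real n" using m k(1) kn by (auto simp: algebra_simps)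
        have "M (Suc m) - A * real (Suc m) \<le> (A - 2 * \<epsilon>) * real n - A * ((1 - \<delta>) * real n)"
          using Mn monoD[OF M, of "Suc m" n] m mult_left_mono[OF m1 A] by auto
        also have "\<dots> \<le> - (\<epsilon> * real n)"
          using mult_right_mono[OF A\<delta>, of "real n"] by (simp add: algebra_simps)
        finally have num: "\<epsilon> * real n \<le> - (M (Suc m) - A * real (Suc m))" by simp
        have "real (Suc m) ^ 2 \<le> real n ^ 2" using m by (intro power_mono) auto
        hence "\<epsilon> * real n / real n ^ 2 \<le> - (M (Suc m) - A * real (Suc m)) / real (Suc m) ^ 2"
          using num \<epsilon> order_trans[OF mult_nonneg_nonneg num] by (intro frac_le) auto
        hence "\<epsilon> * real n / real n ^ 2 \<le> - u m" by (simp add: u_def minus_divide_left)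
        thus ?thesis using n(3) by (simp add: power2_eq_square field_simps)
      qed
      hence "sum u {n-k..<n} \<le> real (card {n-k..<n}) * (- (\<epsilon> / real n))"
        by (intro sum_bounded_above) auto
      moreover have "card {n-k..<n} = k" using kn by simp
      moreover have "real k * (\<epsilon> / real n) \<ge> (\<delta> * real n / 2) * (\<epsilon> / real n)"
        using k2 \<epsilon> by (intro mult_right_mono) auto
      moreover have "(\<delta> * real n / 2) * (\<epsilon> / real n) = \<delta> * \<epsilon> / 2" using n(3) by simp
      moreover have "\<delta> * \<epsilon> / 2 \<ge> \<delta> * \<epsilon> / 8" using \<delta> \<epsilon> by (simp add: field_simps)
      moreover have "\<bar>sum u {n-k..<n}\<bar> < \<delta> * \<epsilon> / 8" by (rule N0) (use n(1) kn in linarith)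
      moreover have "\<delta> * \<epsilon> > 0" using \<delta> \<epsilon> by simp
      ultimately show False by (simp only: mult_minus_right)
    qed
    show ?thesis using up lo n(3) by (simp add: abs_if field_simps)
  qed
  obtain N1 :: nat where N1: "real N1 \<ge> 2 / \<delta>" using real_arch_simple by blast
  have "\<forall>n\<ge>max (max (2 * N0) N1) 1. dist (M n / real n) A < e"
  proof (intro allI impI)
    fix n assume "n \<ge> max (max (2 * N0) N1) 1"
    hence "n \<ge> 2 * N0" "real n \<ge> real N1" "n \<ge> 1" by simp_all
    thus "dist (M n / real n) A < e" unfolding dist_real_def using N1 by (intro main) linarith+
  qed
  thus "eventually (\<lambda>n. dist (M n / real n) A < e) sequentially"
    unfolding eventually_sequentially by blast
qed

text \<open>Subtracting A times the zeta series removes the pole at 1. Summation by parts and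
  \<open>newman_tauberian\<close> then give convergence of the sum of (M n - A n) / n^2, from which
  \<open>mono_tauberian\<close> recovers M n / n. Note that \<open>d n\<close> is the coefficient of
  (n+1)^(-s).\<close>

theorem wiener_ikehara:
  fixes d :: "nat \<Rightarrow> real"
  defines "M \<equiv> (\<lambda>n. \<Sum>m<n. d m)"
  assumes d: "\<And>n. d n \<ge> 0" and C: "\<And>n. M n \<le> C * real n" and A: "A \<ge> 0"
    and D: "open D" "{s. Re s \<ge> 1} \<subseteq> D" "G holomorphic_on D"
    and F: "\<And>s. Re s > 1 \<Longrightarrow> (\<lambda>n. of_real (d n) * npow (Suc n) s) sums (of_real A / (s - 1) + G s)"
  shows "(\<lambda>n. M n / real n) \<longlonglongrightarrow> A"
proof -
  \<comment> \<open>The Abel identity for constant coefficients 1 reads zeta = V1 + zeta / s, hence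
    zeta = s V1 / (s - 1): the continuation of zeta costs nothing extra. At s = 1 the series for V1
    telescopes to 1, which is the residue.\<close>
  define V1 where "V1 = esum real"
  have V1h: "V1 holomorphic_on {s. Re s > 0}"
    unfolding V1_def by (rule esum_holomorphic[of _ 1]) auto
  \<comment> \<open>Zeta minus its polar part; the case s = 1 fills in the removable
    singularity.\<close>
  define zg where "zg = (\<lambda>s. if s = 1 then deriv (\<lambda>s. s * V1 s) 1 else s * V1 s / (s - 1) - 1 / (s - 1))"
  have ed1: "of_real (real (Suc n)) * ediff (Suc n) 1 = of_real (1 / real (Suc n) - 1 / real (Suc (Suc n)))" for n
  proof -
    have "ediff (Suc n) 1 = of_real (1 / real (Suc n) * (1 / real (Suc n)) - (1 / real (Suc n) - 1 / real (Suc (Suc n))))"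
      unfolding ediff_def npow_add npow_one_right[OF zero_less_Suc] by simp
    hence "of_real (real (Suc n)) * ediff (Suc n) 1 = of_real (real (Suc n) * (1 / real (Suc n) * (1 / real (Suc n)) - (1 / real (Suc n) - 1 / real (Suc (Suc n)))))"
      by (simp only: of_real_mult)
    also have "real (Suc n) * (1 / real (Suc n) * (1 / real (Suc n)) - (1 / real (Suc n) - 1 / real (Suc (Suc n)))) = 1 / real (Suc n) - 1 / real (Suc (Suc n))"
    proof -
      have "x * (1 / x * (1 / x) - (1 / x - 1 / (x + 1))) = 1 / x - 1 / (x + 1)" if "x > 0" for x :: real
      proof -
        have "x / (x + 1) = 1 - 1 / (x + 1)" using that by (simp add: field_simps)
        moreover have "x * (1 / x * (1 / x) - (1 / x - 1 / (x + 1))) = 1 / x - 1 + x / (x + 1)"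
          using that by (simp add: right_diff_distrib)
        ultimately show ?thesis by simp
      qed
      from this[of "real (Suc n)"] show ?thesis by (simp add: add_ac)
    qed
    finally show ?thesis .
  qed
  have V11: "V1 1 = 1"
  proof -
    have "(\<lambda>n. 1 / real (Suc n) - 1 / real (Suc (Suc n))) sums (1 / real (Suc 0) - 0)"
      by (rule telescope_sums'[of "\<lambda>n. 1 / real (Suc n)"]) real_asymp
    hence "(\<lambda>n. of_real (1 / real (Suc n) - 1 / real (Suc (Suc n)))) sums (of_real (1 / real (Suc 0) - 0) :: complex)"
      by (rule sums_of_real)
    hence "(\<lambda>n. of_real (real (Suc n)) * ediff (Suc n) 1) sums of_real (1 / real (Suc 0) - 0)" unfolding ed1 .
    moreover have "(\<lambda>n. of_real (real (Suc n)) * ediff (Suc n) 1) sums V1 1"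
      unfolding V1_def by (rule esum_sums[of _ 1]) auto
    ultimately have "of_real (1 / real (Suc 0) - 0) = V1 1" by (rule sums_unique2)
    thus ?thesis by simp
  qed
  have zgh: "zg holomorphic_on {s. Re s > 0}"
  proof -
    have "(\<lambda>s. if s = 1 then deriv (\<lambda>s. s * V1 s) 1 else s * V1 s / (s - 1) - (1 * V1 1) / (s - 1)) holomorphic_on {s. Re s > 0}"
      by (rule pole_theorem) (auto intro!: holomorphic_intros V1h simp: interior_open open_halfspace_Re_gt)
    thus ?thesis unfolding zg_def V11 mult_1_left .
  qed
  have zeta: "(\<lambda>n. npow (Suc n) s) sums (1 / (s - 1) + zg s)" if s: "Re s > 1" for s
  proof -
    have "summable (\<lambda>n. norm (npow (Suc n) s))"
      using summable_powr_nat[of "- Re s"] s by (simp add: norm_npow del: of_nat_Suc)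
    then obtain Z where Z: "(\<lambda>n. npow (Suc n) s) sums Z" using summable_norm_cancel[of "\<lambda>n. npow (Suc n) s"] by (auto simp: summable_def)
    have id: "(\<Sum>m<n. 1 :: real) = real n" for n by simp
    have "(\<lambda>n. of_real (real (Suc n)) * npow (Suc n) (1 + s)) sums (V1 s + Z / s)"
      unfolding V1_def using Z by (intro abel_sums[of "\<lambda>_. 1" 1 s Z, unfolded id] s) simp_all
    moreover have "(\<lambda>n. of_real (real (Suc n)) * npow (Suc n) (1 + s)) = (\<lambda>n. npow (Suc n) s)"
      by (rule ext, subst npow_add, subst npow_one_right) (simp_all del: of_nat_Suc)
    ultimately have "(\<lambda>n. npow (Suc n) s) sums (V1 s + Z / s)" by (simp only:)
    hence "Z = V1 s + Z / s" by (rule sums_unique2[OF Z])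
    moreover have "s \<noteq> 0" "s \<noteq> 1" using s by auto
    ultimately have "Z = s * V1 s / (s - 1)" by (simp add: field_simps)
    thus ?thesis using Z \<open>s \<noteq> 1\<close> by (simp add: zg_def)
  qed
  define x where "x = (\<lambda>n. d n - A)"
  define X where "X = (\<lambda>n. \<Sum>m<n. x m)"
  have XM: "X n = M n - A * real n" for n by (simp add: X_def x_def M_def sum_subtractf)
  have M0: "M n \<ge> 0" for n unfolding M_def by (intro sum_nonneg d)
  define B where "B = C + A"
  have XB: "\<bar>X n\<bar> \<le> B * real n" for n
  proof -
    have "A * real n \<ge> 0" using A by simp
    thus ?thesis using C[of n] M0[of n] unfolding XM B_def ring_distribs by linarith
  qed
  \<comment> \<open>The value given by \<open>abel_sums\<close> at the point 1 + z after the poles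
    of the series and of A times zeta have cancelled.\<close>
  define g where "g = (\<lambda>z. esum X (1 + z) + (G (1 + z) - A * zg (1 + z)) / (1 + z))"
  define D' where "D' = (\<lambda>z. 1 + z) -` D \<inter> {z. Re z > -1}"
  have "open D'" unfolding D'_def
    by (intro open_Int open_vimage D continuous_intros open_halfspace_Re_gt)
  moreover have "{z. Re z \<ge> 0} \<subseteq> D'"
  proof
    fix z assume "z \<in> {z. Re z \<ge> 0}"
    hence "1 + z \<in> {s. Re s \<ge> 1}" "Re z > -1" by auto
    thus "z \<in> D'" using D(2) unfolding D'_def by blast
  qed
  moreover have "g holomorphic_on D'"
  proof -
    have comp: "(\<lambda>z. f (1 + z)) holomorphic_on D'" if "f holomorphic_on E" "(\<lambda>z. 1 + z) ` D' \<subseteq> E" for f E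
      using holomorphic_on_compose_gen[OF holomorphic_on_add[OF holomorphic_on_const holomorphic_on_ident] that]
      by (simp add: o_def)
    have "esum X holomorphic_on {s. Re s > 0}" by (rule esum_holomorphic[OF XB])
    thus ?thesis unfolding g_def
      by (intro holomorphic_intros comp[OF zgh] comp[OF D(3)] comp[of "esum X" "{s. Re s > 0}"])
         (auto simp: D'_def add_eq_0_iff)
  qed
  moreover have "(\<lambda>n. complex_of_real (X (Suc n) / real (Suc n)) * exp (-(1+z) * of_real (ln (real (Suc n))))) sums g z"
    if z: "Re z > 0" for z
  proof -
    have s: "Re (1 + z) > 1" using z by simp
    have "(\<lambda>n. of_real (d n) * npow (Suc n) (1+z) - A * npow (Suc n) (1+z)) sums
       (of_real A / (1 + z - 1) + G (1 + z) - A * (1 / (1 + z - 1) + zg (1 + z)))"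
      by (intro sums_diff sums_mult F zeta s)
    hence "(\<lambda>n. of_real (x n) * npow (Suc n) (1+z)) sums (G (1+z) - A * zg (1 + z))"
      by (simp add: x_def algebra_simps)
    hence "(\<lambda>n. of_real (X (Suc n)) * npow (Suc n) (1 + (1+z))) sums g z"
      unfolding g_def X_def by (rule abel_sums[OF XB[unfolded X_def] s])
    moreover have "of_real (X (Suc n)) * npow (Suc n) (1 + (1+z)) =
       complex_of_real (X (Suc n) / real (Suc n)) * exp (-(1+z) * of_real (ln (real (Suc n))))" for n
      by (subst npow_add, subst npow_one_right) (simp_all add: npow_def del: of_nat_Suc)
    ultimately show ?thesis by simp
  qed
  moreover have "norm (complex_of_real (X (Suc n) / real (Suc n))) \<le> B" for n
    unfolding norm_of_real using XB[of "Suc n"] by (simp add: field_simps del: of_nat_Suc)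
  ultimately have "(\<lambda>n. complex_of_real (X (Suc n) / real (Suc n)) / of_nat (Suc n)) sums g 0"
    by (intro newman_tauberian[of _ B D'])
  hence "summable (\<lambda>n. complex_of_real (X (Suc n) / real (Suc n) ^ 2))"
    by (auto simp: sums_iff power2_eq_square)
  hence "summable (\<lambda>n. X (Suc n) / real (Suc n) ^ 2)" by (simp only: summable_of_real_iff)
  hence "summable (\<lambda>n. (M (Suc n) - A * real (Suc n)) / real (Suc n) ^ 2)" unfolding XM .
  moreover have "mono M" unfolding M_def by (intro monoI sum_mono2) (auto intro: d)
  ultimately show ?thesis using mono_tauberian A by blast
qed

section \<open>Arithmetic of the Eisenstein integers\<close>

text \<open>On \<open>Eis\<close> the squared modulus is an integer, so the floor is exact there;
  values in \<open>nat\<close> permit least elements and induction on the norm.\<close>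

definition enorm :: "complex \<Rightarrow> nat" where
  "enorm z = nat \<lfloor>(cmod z)\<^sup>2\<rfloor>"

definition edvd :: "complex \<Rightarrow> complex \<Rightarrow> bool" where
  "edvd a b \<longleftrightarrow> (\<exists>c\<in>Eis. b = a * c)"

definition eprime :: "complex \<Rightarrow> bool" where
  "eprime \<pi> \<longleftrightarrow> \<pi> \<in> Eis \<and> \<pi> \<noteq> 0 \<and> \<not> edvd \<pi> 1 \<and> (\<forall>a\<in>Eis. \<forall>b\<in>Eis. edvd \<pi> (a * b) \<longrightarrow> edvd \<pi> a \<or> edvd \<pi> b)"

definition sector :: "complex \<Rightarrow> bool" where
  "sector z \<longleftrightarrow> - pi / 6 \<le> Arg z \<and> Arg z < pi / 6"

text \<open>One generator for each nonzero prime ideal.\<close>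
definition sector_primes :: "complex set" where
  "sector_primes = {\<pi>. eprime \<pi> \<and> sector \<pi>}"

lemma Re_omega [simp]: "Re omega = 1 / 2" and Im_omega [simp]: "Im omega = sqrt 3 / 2"
  by (simp_all add: omega_def cos_60 sin_60)

lemma omega_sq: "omega * omega = omega - 1"
  by (simp add: complex_eq_iff)

lemma EisI: "of_int a + of_int b * omega \<in> Eis"
  unfolding Eis_def by blast

lemma EisE:
  assumes "z \<in> Eis"
  obtains a b where "z = of_int a + of_int b * omega"
  using assms unfolding Eis_def by blast

lemma Eis_of_int [simp]: "of_int a \<in> Eis" using EisI[of a 0] by simp
lemma Eis_of_nat [simp]: "of_nat a \<in> Eis" using Eis_of_int[of "int a"] by simp
lemma Eis_0 [simp]: "0 \<in> Eis" using Eis_of_int[of 0] by simp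
lemma Eis_1 [simp]: "1 \<in> Eis" using Eis_of_int[of 1] by simp
lemma Eis_omega [simp]: "omega \<in> Eis" using EisI[of 0 1] by simp

lemma Eis_add [intro, simp]:
  assumes "x \<in> Eis" "y \<in> Eis" shows "x + y \<in> Eis"
proof -
  obtain a b c d where "x = of_int a + of_int b * omega" "y = of_int c + of_int d * omega"
    using assms by (metis EisE)
  hence "x + y = of_int (a + c) + of_int (b + d) * omega" by (simp add: algebra_simps)
  thus ?thesis using EisI by metis
qed

lemma Eis_minus [intro, simp]:
  assumes "x \<in> Eis" shows "- x \<in> Eis"
proof -
  obtain a b where "x = of_int a + of_int b * omega" using assms by (metis EisE)
  hence "- x = of_int (- a) + of_int (- b) * omega" by (simp add: algebra_simps)
  thus ?thesis using EisI by metis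
qed

lemma Eis_diff [intro, simp]: "x \<in> Eis \<Longrightarrow> y \<in> Eis \<Longrightarrow> x - y \<in> Eis"
  using Eis_add[of x "- y"] by simp

lemma Eis_mult [intro, simp]:
  assumes "x \<in> Eis" "y \<in> Eis" shows "x * y \<in> Eis"
proof -
  obtain a b c d where xy: "x = of_int a + of_int b * omega" "y = of_int c + of_int d * omega"
    using assms by (metis EisE)
  have "x * y = of_int a * of_int c + (of_int a * of_int d + of_int b * of_int c) * omega + of_int b * of_int d * (omega * omega)"
    unfolding xy by (simp add: algebra_simps)
  also have "\<dots> = of_int (a * c - b * d) + of_int (a * d + b * c + b * d) * omega"
    unfolding omega_sq by (simp add: algebra_simps)
  finally show ?thesis using EisI by metis
qed

lemma Eis_power [intro, simp]: "x \<in> Eis \<Longrightarrow> x ^ n \<in> Eis"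
  by (induction n) auto

lemma Eis_cnj [intro, simp]:
  assumes "x \<in> Eis" shows "cnj x \<in> Eis"
proof -
  obtain a b where x: "x = of_int a + of_int b * omega" using assms by (metis EisE)
  have "cnj x = of_int a + of_int b * cnj omega" unfolding x by simp
  also have "cnj omega = 1 - omega" by (simp add: complex_eq_iff)
  also have "of_int a + of_int b * (1 - omega) = of_int (a + b) + of_int (- b) * omega"
    by (simp add: algebra_simps)
  finally have "cnj x = of_int (a + b) + of_int (- b) * omega" .
  thus ?thesis using EisI by metis
qed

lemma cmod_sq_lin: "(cmod (of_real x + of_real y * omega))\<^sup>2 = x\<^sup>2 + x * y + y\<^sup>2"
proof -
  have "(cmod (of_real x + of_real y * omega))\<^sup>2 = (x + y / 2)\<^sup>2 + (y * (sqrt 3 / 2))\<^sup>2"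
    by (simp add: cmod_power2)
  also have "\<dots> = x\<^sup>2 + x * y + y\<^sup>2"
    by (simp add: power2_eq_square algebra_simps)
  finally show ?thesis .
qed

lemma enorm_lin: "(cmod (of_int a + of_int b * omega))\<^sup>2 = real_of_int (a\<^sup>2 + a * b + b\<^sup>2)"
  using cmod_sq_lin[of "real_of_int a" "real_of_int b"] by simp

lemma real_enorm: "z \<in> Eis \<Longrightarrow> real (enorm z) = (cmod z)\<^sup>2"
  by (elim EisE) (metis enorm_def enorm_lin floor_of_int of_int_0_le_iff of_nat_nat zero_le_power2)

lemma enorm_0 [simp]: "enorm 0 = 0" by (simp add: enorm_def)

lemma enorm_eq_0_iff: "z \<in> Eis \<Longrightarrow> enorm z = 0 \<longleftrightarrow> z = 0"
  using real_enorm[of z] by (metis norm_eq_zero of_nat_eq_0_iff power2_eq_square mult_eq_0_iff)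

lemma enorm_pos: "z \<in> Eis \<Longrightarrow> z \<noteq> 0 \<Longrightarrow> enorm z > 0"
  using enorm_eq_0_iff by auto

lemma enorm_mult: "x \<in> Eis \<Longrightarrow> y \<in> Eis \<Longrightarrow> enorm (x * y) = enorm x * enorm y"
proof -
  assume "x \<in> Eis" "y \<in> Eis"
  hence "real (enorm (x * y)) = real (enorm x * enorm y)"
    by (simp add: real_enorm norm_mult power_mult_distrib)
  thus ?thesis by (simp only: of_nat_eq_iff)
qed

lemma enorm_of_nat: "enorm (of_nat n) = n\<^sup>2"
  by (simp add: enorm_def flip: of_nat_power)

lemma mult_cnj_enorm: "z \<in> Eis \<Longrightarrow> z * cnj z = of_nat (enorm z)"
  using real_enorm[of z] complex_norm_square[of z] by (metis of_real_of_nat_eq of_real_power)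

lemma enorm_1_iff: "z \<in> Eis \<Longrightarrow> enorm z = 1 \<longleftrightarrow> cmod z = 1"
  using real_enorm[of z] by (metis norm_ge_zero of_nat_1 of_nat_eq_iff one_power2 power2_eq_iff_nonneg zero_le_one)

lemma edvd_refl [simp]: "edvd a a" unfolding edvd_def by (intro bexI[of _ 1]) auto

lemma edvd_trans: "edvd a b \<Longrightarrow> edvd b c \<Longrightarrow> edvd a c"
  unfolding edvd_def by (metis Eis_mult mult.assoc)

lemma edvd_mult: "edvd a b \<Longrightarrow> c \<in> Eis \<Longrightarrow> edvd a (b * c)"
  unfolding edvd_def by (metis Eis_mult mult.assoc)

lemma edvd_add: "edvd a b \<Longrightarrow> edvd a c \<Longrightarrow> edvd a (b + c)"
  unfolding edvd_def by (metis Eis_add distrib_left)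

lemma edvd_minus: "edvd a b \<Longrightarrow> edvd a (- b)"
  unfolding edvd_def by (metis Eis_minus mult_minus_right)

lemma edvd_diff: "edvd a b \<Longrightarrow> edvd a c \<Longrightarrow> edvd a (b - c)"
  using edvd_add[of a b "-c"] edvd_minus by simp

lemma edvd_0 [simp]: "edvd a 0" unfolding edvd_def by (intro bexI[of _ 0]) auto

lemma edvd_cancel: "c \<noteq> 0 \<Longrightarrow> edvd (c * a) (c * b) \<longleftrightarrow> edvd a b"
  unfolding edvd_def by (auto simp: mult.assoc)

lemma edvd_cnj: "edvd (cnj a) (cnj b) \<longleftrightarrow> edvd a b"
  unfolding edvd_def by (metis Eis_cnj complex_cnj_cnj complex_cnj_mult)

lemma unit_iff: "u \<in> Eis \<Longrightarrow> edvd u 1 \<longleftrightarrow> cmod u = 1"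
proof
  assume u: "u \<in> Eis" "edvd u 1"
  then obtain c where c: "c \<in> Eis" "1 = u * c" unfolding edvd_def by blast
  have "enorm u * enorm c = 1" using enorm_mult[of u c] u c by (simp add: enorm_def)
  hence "enorm u = 1" by simp
  thus "cmod u = 1" using enorm_1_iff u by blast
next
  assume u: "u \<in> Eis" "cmod u = 1"
  have "u * cnj u = 1" using complex_norm_square[of u] u by simp
  thus "edvd u 1" unfolding edvd_def using u by (metis Eis_cnj)
qed

text \<open>Rounding both coordinates in the basis 1, omega leaves errors of at most 1/2, for which
  the norm form is at most 3/4. This is what makes the ring Euclidean.\<close>

lemma Eis_approx: "\<exists>q\<in>Eis. cmod (z - q) < 1"
proof -
  define y where "y = Im z * 2 / sqrt 3"
  define x where "x = Re z - y / 2"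
  have z: "z = of_real x + of_real y * omega" by (simp add: complex_eq_iff x_def y_def)
  define u v where "u = x - of_int (round x)" and "v = y - of_int (round y)"
  define q where "q = of_int (round x) + of_int (round y) * omega"
  have uv: "\<bar>u\<bar> \<le> 1/2" "\<bar>v\<bar> \<le> 1/2"
    unfolding u_def v_def using of_int_round_abs_le[of x] of_int_round_abs_le[of y] by (simp_all add: abs_minus_commute)
  have "z - q = of_real u + of_real v * omega" unfolding z q_def u_def v_def by (simp add: algebra_simps)
  hence "(cmod (z - q))\<^sup>2 = u\<^sup>2 + u * v + v\<^sup>2" using cmod_sq_lin by simp
  also have "\<dots> \<le> (1/2)\<^sup>2 + (1/2) * (1/2) + (1/2)\<^sup>2"
  proof (intro add_mono)
    show "u\<^sup>2 \<le> (1/2)\<^sup>2" "v\<^sup>2 \<le> (1/2)\<^sup>2" using uv by (auto intro: abs_le_square_iff[THEN iffD1])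
    have "u * v \<le> \<bar>u\<bar> * \<bar>v\<bar>" by (metis abs_ge_self abs_mult)
    also have "\<dots> \<le> (1/2) * (1/2)" using uv by (intro mult_mono) auto
    finally show "u * v \<le> (1/2) * (1/2)" .
  qed
  also have "\<dots> < 1\<^sup>2" by (simp add: power2_eq_square)
  finally have "cmod (z - q) < 1" using power2_less_imp_less by fastforce
  thus ?thesis unfolding q_def using EisI by blast
qed

lemma Eis_euclid:
  assumes "a \<in> Eis" "b \<in> Eis" "b \<noteq> 0"
  shows "\<exists>q\<in>Eis. enorm (a - b * q) < enorm b"
proof -
  obtain q where q: "q \<in> Eis" "cmod (a / b - q) < 1" using Eis_approx by blast
  have "a - b * q = b * (a / b - q)" using assms by (simp add: algebra_simps)
  hence "cmod (a - b * q) = cmod b * cmod (a / b - q)" by (simp add: norm_mult)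
  also have "\<dots> < cmod b" using q assms by simp
  finally have "(cmod (a - b * q))\<^sup>2 < (cmod b)\<^sup>2" by (intro power_strict_mono) auto
  hence "real (enorm (a - b * q)) < real (enorm b)" using assms q by (simp add: real_enorm)
  thus ?thesis using q by auto
qed

section \<open>Principal ideals and prime elements\<close>

lemma principal_ideal_mem: "x \<in> principal_ideal \<alpha> \<longleftrightarrow> edvd \<alpha> x"
  unfolding principal_ideal_def edvd_def by auto

text \<open>A nonzero element of least norm generates: a remainder on division by it lies in the
  ideal and has smaller norm, hence is 0.\<close>

lemma Eis_PID:
  assumes I: "eis_ideal I"
  shows "\<exists>\<alpha>\<in>Eis. I = principal_ideal \<alpha>"
proof (cases "I = {0}")
  case True
  thus ?thesis by (intro bexI[of _ 0]) (auto simp: principal_ideal_def intro: Eis_0)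
next
  case False
  have I': "I \<subseteq> Eis" "0 \<in> I" "\<And>x y. x \<in> I \<Longrightarrow> y \<in> I \<Longrightarrow> x + y \<in> I" "\<And>r x. r \<in> Eis \<Longrightarrow> x \<in> I \<Longrightarrow> r * x \<in> I"
    using I unfolding eis_ideal_def by auto
  obtain x where "x \<in> I \<and> x \<noteq> 0" using False I' by auto
  then obtain \<alpha> where \<alpha>: "\<alpha> \<in> I" "\<alpha> \<noteq> 0" "\<And>y. y \<in> I \<Longrightarrow> y \<noteq> 0 \<Longrightarrow> enorm \<alpha> \<le> enorm y"
    using ex_has_least_nat[of "\<lambda>x. x \<in> I \<and> x \<noteq> 0" x enorm] by auto
  have "I = principal_ideal \<alpha>"
  proof (intro equalityI subsetI)
    fix y assume y: "y \<in> I"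
    obtain q where q: "q \<in> Eis" "enorm (y - \<alpha> * q) < enorm \<alpha>" using Eis_euclid[of y \<alpha>] y \<alpha> I'(1) by auto
    have "y + (- q) * \<alpha> \<in> I" by (rule I'(3)[OF y I'(4)[OF Eis_minus[OF q(1)] \<alpha>(1)]])
    hence "y - \<alpha> * q \<in> I" by (simp add: mult.commute)
    hence "y - \<alpha> * q = 0" using \<alpha>(3) q(2) by force
    thus "y \<in> principal_ideal \<alpha>" using q unfolding principal_ideal_def by auto
  next
    fix y assume "y \<in> principal_ideal \<alpha>"
    thus "y \<in> I" using I'(4) \<alpha>(1) unfolding principal_ideal_def by (auto simp: mult.commute)
  qed
  thus ?thesis using \<alpha> I' by blast
qed

lemma eis_ideal_principal: "\<alpha> \<in> Eis \<Longrightarrow> eis_ideal (principal_ideal \<alpha>)"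
  unfolding eis_ideal_def
proof (intro conjI ballI)
  assume a: "\<alpha> \<in> Eis"
  thus "principal_ideal \<alpha> \<subseteq> Eis" by (auto simp: principal_ideal_def)
  show "r * x \<in> principal_ideal \<alpha>" if "r \<in> Eis" "x \<in> principal_ideal \<alpha>" for r x
    using that edvd_mult[of \<alpha> x r] by (simp add: principal_ideal_mem mult.commute)
qed (auto simp: principal_ideal_mem edvd_add)

lemma principal_eq_0: "principal_ideal \<alpha> = {0} \<longleftrightarrow> \<alpha> = 0"
  unfolding principal_ideal_def by (auto intro: Eis_0 Eis_1)

lemma principal_eq_Eis: "\<alpha> \<in> Eis \<Longrightarrow> principal_ideal \<alpha> = Eis \<longleftrightarrow> edvd \<alpha> 1"
proof
  assume "\<alpha> \<in> Eis" "edvd \<alpha> 1"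
  thus "principal_ideal \<alpha> = Eis"
    by (auto simp: principal_ideal_mem) (auto simp: edvd_def, metis Eis_mult mult.assoc mult.left_neutral)
qed (metis Eis_1 principal_ideal_mem)

lemma prime_ideal_iff: "eis_nonzero_prime_ideal P \<longleftrightarrow> (\<exists>\<pi>. eprime \<pi> \<and> P = principal_ideal \<pi>)"
proof
  assume P: "eis_nonzero_prime_ideal P"
  then obtain \<pi> where p: "\<pi> \<in> Eis" "P = principal_ideal \<pi>" using Eis_PID unfolding eis_nonzero_prime_ideal_def by blast
  hence "eprime \<pi>" using P principal_eq_0[of \<pi>] principal_eq_Eis[of \<pi>]
    unfolding eis_nonzero_prime_ideal_def eprime_def by (simp add: principal_ideal_mem)
  thus "\<exists>\<pi>. eprime \<pi> \<and> P = principal_ideal \<pi>" using p by blast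
next
  assume "\<exists>\<pi>. eprime \<pi> \<and> P = principal_ideal \<pi>"
  then obtain \<pi> where p: "eprime \<pi>" "P = principal_ideal \<pi>" by blast
  thus "eis_nonzero_prime_ideal P" using principal_eq_0[of \<pi>] principal_eq_Eis[of \<pi>] eis_ideal_principal[of \<pi>]
    unfolding eis_nonzero_prime_ideal_def eprime_def by (simp add: principal_ideal_mem)
qed

lemma principal_eq_iff:
  assumes "\<alpha> \<in> Eis" "\<beta> \<in> Eis" "\<alpha> \<noteq> 0"
  shows "principal_ideal \<alpha> = principal_ideal \<beta> \<longleftrightarrow> (\<exists>u\<in>Eis. cmod u = 1 \<and> \<beta> = \<alpha> * u)"
proof
  assume "principal_ideal \<alpha> = principal_ideal \<beta>"
  hence "edvd \<alpha> \<beta>" "edvd \<beta> \<alpha>" using edvd_refl principal_ideal_mem by metis+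
  then obtain c d where c: "c \<in> Eis" "\<beta> = \<alpha> * c" "d \<in> Eis" "\<alpha> = \<beta> * d" unfolding edvd_def by blast
  hence "\<alpha> * (c * d) = \<alpha> * 1" by (metis mult.assoc mult.right_neutral)
  hence "1 = c * d" using assms(3) by simp
  hence "edvd c 1" using c unfolding edvd_def by blast
  thus "\<exists>u\<in>Eis. cmod u = 1 \<and> \<beta> = \<alpha> * u" using c unit_iff by blast
next
  assume "\<exists>u\<in>Eis. cmod u = 1 \<and> \<beta> = \<alpha> * u"
  then obtain u where u: "u \<in> Eis" "cmod u = 1" "\<beta> = \<alpha> * u" by blast
  then obtain c where c: "c \<in> Eis" "1 = u * c" using unit_iff edvd_def by blast
  have "edvd \<alpha> \<beta>" using u unfolding edvd_def by blast
  moreover have "\<alpha> = \<beta> * c" using u c by (simp add: mult.assoc)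
  hence "edvd \<beta> \<alpha>" using c unfolding edvd_def by blast
  ultimately show "principal_ideal \<alpha> = principal_ideal \<beta>"
    by (auto simp: principal_ideal_mem set_eq_iff intro: edvd_trans)
qed

section \<open>Units and the sector of normalised generators\<close>

lemma cis_sixth_Eis: "cis (of_int k * (pi / 3)) \<in> Eis"
proof -
  have 1: "cis (real n * (pi / 3)) \<in> Eis" for n
    by (metis Complex.DeMoivre Eis_omega Eis_power omega_def)
  show ?thesis
  proof (cases "k \<ge> 0")
    case True thus ?thesis using 1[of "nat k"] by simp
  next
    case False
    have "cis (of_int k * (pi / 3)) = cnj (cis (real (nat (- k)) * (pi / 3)))"
      using False by (simp add: cis_cnj)
    thus ?thesis using 1[of "nat (- k)"] by simp
  qed
qed

lemma sector_associate:
  assumes "\<alpha> \<in> Eis" "\<alpha> \<noteq> 0"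
  shows "\<exists>u\<in>Eis. cmod u = 1 \<and> sector (\<alpha> * u)"
proof -
  \<comment> \<open>The nearest multiple of pi / 3 to the argument. Rounding by the floor of x + 1/2
    makes the remaining angle fall in the half-open interval from - pi / 6 to pi / 6.\<close>
  define k where "k = \<lfloor>Arg \<alpha> / (pi / 3) + 1 / 2\<rfloor>"
  define t where "t = Arg \<alpha> - of_int k * (pi / 3)"
  have "of_int k \<le> Arg \<alpha> / (pi / 3) + 1 / 2" "Arg \<alpha> / (pi / 3) + 1 / 2 < of_int k + 1"
    unfolding k_def by linarith+
  hence t: "- pi / 6 \<le> t" "t < pi / 6" unfolding t_def by (simp_all add: field_simps)
  have "\<alpha> * cis (of_int (- k) * (pi / 3)) = of_real (cmod \<alpha>) * cis t"
  proof -
    have a: "\<alpha> = of_real (cmod \<alpha>) * cis (Arg \<alpha>)" by (metis rcis_cmod_Arg rcis_def)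
    have "cis (Arg \<alpha>) * cis (of_int (- k) * (pi / 3)) = cis t" by (simp add: cis_mult t_def)
    thus ?thesis by (subst a) (simp only: mult.assoc)
  qed
  hence "Arg (\<alpha> * cis (of_int (- k) * (pi / 3))) = t"
    using assms t by (simp add: Arg_times_of_real Arg_cis)
  thus ?thesis using t cis_sixth_Eis[of "- k"] unfolding sector_def by (intro bexI[of _ "cis (of_int (- k) * (pi / 3))"]) auto
qed

text \<open>Completing the square gives (2a + b)^2 + 3 b^2 = 4, where 2a + b is twice the real part
  and therefore at least 2. The bound 1/2 is sharp: \<open>omega\<close> attains it.\<close>

lemma Eis_unit_right:
  assumes "u \<in> Eis" "cmod u = 1" "Re u > 1 / 2"
  shows "u = 1"
proof -
  obtain a b where u: "u = of_int a + of_int b * omega" using assms(1) by (rule EisE)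
  have n: "a\<^sup>2 + a * b + b\<^sup>2 = 1" using enorm_lin[of a b] assms(2) unfolding u by (metis of_int_eq_1_iff one_power2)
  have re: "2 * a + b > 1" using assms(3) unfolding u by simp
  have "4 * (a\<^sup>2 + a * b + b\<^sup>2) = (2 * a + b)\<^sup>2 + 3 * b\<^sup>2" by (simp add: power2_eq_square algebra_simps)
  hence e: "(2 * a + b)\<^sup>2 + 3 * b\<^sup>2 = 4" using n by simp
  have "(2 * a + b)\<^sup>2 \<ge> 2\<^sup>2" using re by (intro power_mono) auto
  hence "(2 * a + b)\<^sup>2 \<ge> 4" by simp
  hence "b\<^sup>2 \<le> 0" using e by linarith
  hence b: "b = 0" by simp
  hence "a\<^sup>2 = 1" using n by simp
  hence "a = 1" using re b by (auto simp: power2_eq_1_iff)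
  thus ?thesis using u b by simp
qed

text \<open>Two arguments in the sector differ by less than pi / 3, so the unit u has real part
  above 1/2.\<close>

lemma sector_unique:
  assumes "\<alpha> \<noteq> 0" "sector \<alpha>" "sector (\<alpha> * u)" "u \<in> Eis" "cmod u = 1"
  shows "u = 1"
proof -
  have u0: "u \<noteq> 0" using assms(5) by auto
  have a: "\<alpha> = of_real (cmod \<alpha>) * cis (Arg \<alpha>)" by (metis rcis_cmod_Arg rcis_def)
  have "\<alpha> * u = of_real (cmod \<alpha>) * (cis (Arg \<alpha>) * u)" by (subst a) simp
  moreover have "\<alpha> * u = of_real (cmod \<alpha>) * cis (Arg (\<alpha> * u))"
    using rcis_cmod_Arg[of "\<alpha> * u"] assms(5) by (simp add: rcis_def norm_mult)
  ultimately have "of_real (cmod \<alpha>) * (cis (Arg \<alpha>) * u) = of_real (cmod \<alpha>) * cis (Arg (\<alpha> * u))"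
    by (simp only:)
  hence "cis (Arg \<alpha>) * u = cis (Arg (\<alpha> * u))"
    using assms(1) by (simp only: mult_cancel_left of_real_eq_0_iff norm_eq_zero simp_thms)
  hence "u = cis (Arg (\<alpha> * u)) / cis (Arg \<alpha>)" by (simp add: field_simps)
  hence ue: "u = cis (Arg (\<alpha> * u) - Arg \<alpha>)" by (simp add: cis_divide)
  define t where "t = Arg (\<alpha> * u) - Arg \<alpha>"
  have t: "\<bar>t\<bar> < pi / 3" using assms(2,3) unfolding sector_def t_def by linarith
  have "cos (pi / 3) < cos \<bar>t\<bar>" using t by (intro cos_monotone_0_pi) auto
  moreover have "Re u = cos t" unfolding t_def by (subst ue) simp
  ultimately have "Re u > 1 / 2" by (simp add: cos_60)
  thus ?thesis using Eis_unit_right assms by blast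
qed

lemma principal_inj_sector_primes: "inj_on principal_ideal sector_primes"
proof (rule inj_onI)
  fix x y assume xy: "x \<in> sector_primes" "y \<in> sector_primes" "principal_ideal x = principal_ideal y"
  then obtain u where "u \<in> Eis" "cmod u = 1" "y = x * u"
    using principal_eq_iff[of x y] unfolding sector_primes_def eprime_def by auto
  thus "x = y" using sector_unique[of x u] xy unfolding sector_primes_def eprime_def by auto
qed

lemma eprime_assoc:
  assumes "eprime \<pi>" "u \<in> Eis" "cmod u = 1" shows "eprime (\<pi> * u)"
proof -
  have "principal_ideal \<pi> = principal_ideal (\<pi> * u)"
    using principal_eq_iff[of \<pi> "\<pi> * u"] assms unfolding eprime_def by auto
  hence "edvd \<pi> x \<longleftrightarrow> edvd (\<pi> * u) x" for x by (metis principal_ideal_mem)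
  thus ?thesis using assms unfolding eprime_def by auto
qed

lemma prime_ideals_eq: "{P. eis_nonzero_prime_ideal P} = principal_ideal ` sector_primes"
proof (intro equalityI subsetI)
  fix P assume "P \<in> {P. eis_nonzero_prime_ideal P}"
  then obtain \<pi> where p: "eprime \<pi>" "P = principal_ideal \<pi>" using prime_ideal_iff by auto
  then obtain u where u: "u \<in> Eis" "cmod u = 1" "sector (\<pi> * u)" using sector_associate unfolding eprime_def by blast
  have "principal_ideal \<pi> = principal_ideal (\<pi> * u)"
    using principal_eq_iff[of \<pi> "\<pi> * u"] u p unfolding eprime_def by auto
  thus "P \<in> principal_ideal ` sector_primes" using p u eprime_assoc unfolding sector_primes_def by auto
qed (auto simp: prime_ideal_iff sector_primes_def)

lemma theta_principal:
  assumes "\<pi> \<in> sector_primes" shows "theta (principal_ideal \<pi>) = Arg \<pi>"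
proof -
  have p: "\<pi> \<in> Eis" "\<pi> \<noteq> 0" "sector \<pi>" using assms unfolding sector_primes_def eprime_def by auto
  have "(THE \<alpha>. \<alpha> \<in> Eis \<and> principal_ideal \<alpha> = principal_ideal \<pi> \<and> - pi / 6 \<le> Arg \<alpha> \<and> Arg \<alpha> < pi / 6) = \<pi>"
  proof (rule the_equality)
    fix \<alpha> assume a: "\<alpha> \<in> Eis \<and> principal_ideal \<alpha> = principal_ideal \<pi> \<and> - pi / 6 \<le> Arg \<alpha> \<and> Arg \<alpha> < pi / 6"
    then obtain u where "u \<in> Eis" "cmod u = 1" "\<alpha> = \<pi> * u" using principal_eq_iff[of \<pi> \<alpha>] p by auto
    thus "\<alpha> = \<pi>" using sector_unique[of \<pi> u] p a by (auto simp: sector_def)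
  qed (use p in \<open>auto simp: sector_def\<close>)
  thus ?thesis unfolding theta_def by simp
qed

subsection \<open>Residue classes and factorisation\<close>

definition transversal :: "complex \<Rightarrow> complex set \<Rightarrow> bool" where
  "transversal \<alpha> R \<longleftrightarrow> R \<subseteq> Eis \<and> finite R \<and> (\<forall>z\<in>Eis. \<exists>!r. r \<in> R \<and> edvd \<alpha> (z - r))"

lemma transversalD:
  assumes "transversal \<alpha> R"
  shows "R \<subseteq> Eis" "finite R" "z \<in> Eis \<Longrightarrow> \<exists>r\<in>R. edvd \<alpha> (z - r)"
    "r \<in> R \<Longrightarrow> s \<in> R \<Longrightarrow> edvd \<alpha> (r - s) \<Longrightarrow> r = s"
proof -
  assume rs: "r \<in> R" "s \<in> R" "edvd \<alpha> (r - s)"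
  hence "r \<in> Eis" using assms unfolding transversal_def by auto
  hence "\<exists>!t. t \<in> R \<and> edvd \<alpha> (r - t)" using assms unfolding transversal_def by blast
  moreover have "edvd \<alpha> (r - r)" by simp
  ultimately show "r = s" using rs by blast
qed (use assms in \<open>auto simp: transversal_def\<close>)

lemma transversalI:
  assumes "R \<subseteq> Eis" "finite R" "\<And>z. z \<in> Eis \<Longrightarrow> \<exists>r\<in>R. edvd \<alpha> (z - r)"
    "\<And>r s. r \<in> R \<Longrightarrow> s \<in> R \<Longrightarrow> edvd \<alpha> (r - s) \<Longrightarrow> r = s"
  shows "transversal \<alpha> R"
  unfolding transversal_def
proof (intro conjI ballI ex_ex1I assms(1,2))
  fix z assume "z \<in> Eis" thus "\<exists>r. r \<in> R \<and> edvd \<alpha> (z - r)" using assms(3) by blast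
next
  fix z r s assume "z \<in> Eis" "r \<in> R \<and> edvd \<alpha> (z - r)" "s \<in> R \<and> edvd \<alpha> (z - s)"
  moreover have "(z - s) - (z - r) = r - s" by simp
  ultimately show "r = s" using assms(4) edvd_diff by metis
qed

lemma transversal_card_le:
  assumes R: "transversal \<alpha> R" and S: "transversal \<alpha> S"
  shows "card R \<le> card S"
proof -
  have "\<forall>r\<in>R. \<exists>s\<in>S. edvd \<alpha> (r - s)" using transversalD(1)[OF R] transversalD(3)[OF S] by blast
  then obtain f where f: "\<And>r. r \<in> R \<Longrightarrow> f r \<in> S \<and> edvd \<alpha> (r - f r)" by metis
  have "inj_on f R"
  proof (rule inj_onI)
    fix r r' assume r: "r \<in> R" "r' \<in> R" "f r = f r'"
    have "(r - f r) - (r' - f r') = r - r'" using r by simp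
    thus "r = r'" using f r edvd_diff transversalD(4)[OF R] by metis
  qed
  thus ?thesis using f transversalD(2)[OF S] by (intro card_inj_on_le[of f]) auto
qed

lemma transversal_card_eq: "transversal \<alpha> R \<Longrightarrow> transversal \<alpha> S \<Longrightarrow> card R = card S"
  using transversal_card_le le_antisym by blast

text \<open>Two-digit expansions: r + \<alpha> * s runs through the classes modulo \<alpha> *
  \<beta> as r and s run through the digits modulo \<alpha> and \<beta>.\<close>

lemma transversal_mult:
  assumes R: "transversal \<alpha> R" and S: "transversal \<beta> S" and \<alpha>: "\<alpha> \<noteq> 0" "\<alpha> \<in> Eis" "\<beta> \<in> Eis"
  shows "\<exists>T. transversal (\<alpha> * \<beta>) T \<and> card T = card R * card S"
proof -
  define f where "f = (\<lambda>(r, s). r + \<alpha> * s)"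
  have RE: "r \<in> Eis" if "r \<in> R" for r using transversalD(1)[OF R] that by blast
  have SE: "s \<in> Eis" if "s \<in> S" for s using transversalD(1)[OF S] that by blast
  have eq: "r = r' \<and> s = s'"
    if rs: "r \<in> R" "r' \<in> R" "s \<in> S" "s' \<in> S" and d: "edvd (\<alpha> * \<beta>) (f (r, s) - f (r', s'))" for r r' s s'
  proof -
    obtain c where c: "c \<in> Eis" "f (r, s) - f (r', s') = \<alpha> * \<beta> * c" using d unfolding edvd_def by blast
    have "r - r' = \<alpha> * (\<beta> * c - (s - s'))" using c(2) by (simp add: f_def algebra_simps)
    moreover have "\<beta> * c - (s - s') \<in> Eis" using c(1) \<alpha>(3) SE[OF rs(3)] SE[OF rs(4)] by simp
    ultimately have r: "r = r'" using transversalD(4)[OF R rs(1,2)] unfolding edvd_def by blast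
    hence "\<alpha> * (s - s') = \<alpha> * (\<beta> * c)" using c(2) by (simp add: f_def algebra_simps)
    hence "s - s' = \<beta> * c" using \<alpha>(1) by (simp only: mult_cancel_left) simp
    hence "s = s'" using transversalD(4)[OF S rs(3,4)] c(1) unfolding edvd_def by blast
    thus ?thesis using r by simp
  qed
  have "transversal (\<alpha> * \<beta>) (f ` (R \<times> S))"
  proof (rule transversalI)
    show "f ` (R \<times> S) \<subseteq> Eis" using RE SE \<alpha>(2) by (auto simp: f_def)
    show "finite (f ` (R \<times> S))" using transversalD(2)[OF R] transversalD(2)[OF S] by simp
    fix z assume z: "z \<in> Eis"
    obtain r where r: "r \<in> R" "edvd \<alpha> (z - r)" using transversalD(3)[OF R z] by blast
    then obtain w where w: "w \<in> Eis" "z - r = \<alpha> * w" unfolding edvd_def by blast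
    obtain s where s: "s \<in> S" "edvd \<beta> (w - s)" using transversalD(3)[OF S w(1)] by blast
    have "z - f (r, s) = \<alpha> * (w - s)" using w(2) by (simp add: f_def algebra_simps)
    hence "edvd (\<alpha> * \<beta>) (z - f (r, s))" using s(2) edvd_cancel[OF \<alpha>(1)] by simp
    thus "\<exists>r\<in>f ` (R \<times> S). edvd (\<alpha> * \<beta>) (z - r)" using r(1) s(1) by blast
  next
    fix x y assume "x \<in> f ` (R \<times> S)" "y \<in> f ` (R \<times> S)" "edvd (\<alpha> * \<beta>) (x - y)"
    thus "x = y" using eq by auto
  qed
  moreover have "inj_on f (R \<times> S)"
  proof (rule inj_onI)
    fix p q assume "p \<in> R \<times> S" "q \<in> R \<times> S" "f p = f q"
    thus "p = q" using eq[of "fst p" "fst q" "snd p" "snd q"] by (auto simp: prod_eq_iff)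
  qed
  hence "card (f ` (R \<times> S)) = card R * card S" by (simp add: card_image card_cartesian_product)
  ultimately show ?thesis by blast
qed

lemma transversal_of_nat:
  assumes m: "m > 0"
  shows "\<exists>R. transversal (of_nat m) R \<and> card R = m\<^sup>2"
proof -
  define f where "f = (\<lambda>(a::int, b::int). of_int a + of_int b * omega)"
  define I where "I = {0..<int m} \<times> {0..<int m}"
  have coord: "a = a' \<and> b = b'" if "f (a, b) = f (a', b')" for a b a' b'
    using that by (auto simp: f_def complex_eq_iff)
  have dv: "int m dvd a \<and> int m dvd b" if d: "edvd (of_nat m) (f (a, b))" for a b
  proof -
    obtain c where c: "c \<in> Eis" "f (a, b) = of_nat m * c" using d unfolding edvd_def by blast
    then obtain x y where "c = of_int x + of_int y * omega" by (metis EisE)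
    hence "f (a, b) = f (int m * x, int m * y)" using c(2) by (simp add: f_def algebra_simps)
    thus ?thesis using coord[of a b "int m * x" "int m * y"] by simp
  qed
  have "transversal (of_nat m) (f ` I)"
  proof (rule transversalI)
    show "f ` I \<subseteq> Eis" by (auto simp: f_def EisI)
    show "finite (f ` I)" by (simp add: I_def)
    fix z assume "z \<in> Eis"
    then obtain a b where z: "z = of_int a + of_int b * omega" by (rule EisE)
    have "z - f (a mod int m, b mod int m) = of_int (a - a mod int m) + of_int (b - b mod int m) * omega"
      by (simp add: z f_def algebra_simps)
    also have "\<dots> = of_nat m * (of_int (a div int m) + of_int (b div int m) * omega)"
      unfolding minus_mod_eq_mult_div by (simp add: algebra_simps)
    finally have "edvd (of_nat m) (z - f (a mod int m, b mod int m))"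
      unfolding edvd_def using EisI by blast
    moreover have "(a mod int m, b mod int m) \<in> I" using m by (simp add: I_def)
    ultimately show "\<exists>r\<in>f ` I. edvd (of_nat m) (z - r)" by blast
  next
    fix r s assume "r \<in> f ` I" "s \<in> f ` I" and d: "edvd (of_nat m) (r - s)"
    then obtain a b a' b' where ab: "r = f (a, b)" "s = f (a', b')" "(a, b) \<in> I" "(a', b') \<in> I" by auto
    have "r - s = f (a - a', b - b')" by (simp add: ab f_def algebra_simps)
    hence "int m dvd a - a'" "int m dvd b - b'" using dv d by auto
    hence "a mod int m = a' mod int m" "b mod int m = b' mod int m" by (simp_all add: mod_eq_dvd_iff)
    hence "a = a'" "b = b'" using ab(3,4) by (simp_all add: I_def)
    thus "r = s" using ab by simp
  qed
  moreover have "inj_on f I" using coord by (auto intro!: inj_onI)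
  hence "card (f ` I) = m\<^sup>2" by (simp add: card_image I_def card_cartesian_product power2_eq_square)
  ultimately show ?thesis by blast
qed

lemma transversal_cnj:
  assumes R: "transversal \<alpha> R" shows "transversal (cnj \<alpha>) (cnj ` R)"
proof (rule transversalI)
  show "cnj ` R \<subseteq> Eis" using transversalD(1)[OF R] by auto
  show "finite (cnj ` R)" using transversalD(2)[OF R] by simp
  fix z assume "z \<in> Eis"
  then obtain r where "r \<in> R" "edvd \<alpha> (cnj z - r)" using transversalD(3)[OF R, of "cnj z"] by auto
  thus "\<exists>r\<in>cnj ` R. edvd (cnj \<alpha>) (z - r)" using edvd_cnj[of \<alpha> "cnj z - r"] by auto
next
  fix r s assume "r \<in> cnj ` R" "s \<in> cnj ` R" and d: "edvd (cnj \<alpha>) (r - s)"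
  then obtain r' s' where r: "r = cnj r'" "s = cnj s'" "r' \<in> R" "s' \<in> R" by blast
  have "edvd \<alpha> (r' - s')" using d edvd_cnj[of \<alpha> "r' - s'"] by (simp add: r)
  thus "r = s" using transversalD(4)[OF R r(3,4)] r by simp
qed

text \<open>Finiteness is inherited from the finer modulus. The choice of \<open>rep z\<close>
  depends only on the class of z, because congruent elements satisfy the same predicate under
  \<open>SOME\<close>.\<close>

lemma transversal_coarser:
  assumes R: "transversal \<gamma> R" and d: "edvd \<alpha> \<gamma>"
  shows "\<exists>S. transversal \<alpha> S"
proof -
  define rep where "rep = (\<lambda>z. SOME w. w \<in> R \<and> edvd \<alpha> (z - w))"
  have rep: "rep z \<in> R \<and> edvd \<alpha> (z - rep z)" if "z \<in> Eis" for z
  proof -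
    obtain r where "r \<in> R" "edvd \<gamma> (z - r)" using transversalD(3)[OF R \<open>z \<in> Eis\<close>] by blast
    hence "r \<in> R \<and> edvd \<alpha> (z - r)" using edvd_trans d by blast
    thus ?thesis unfolding rep_def by (rule someI)
  qed
  have "transversal \<alpha> (rep ` Eis)"
  proof (rule transversalI)
    show "rep ` Eis \<subseteq> Eis" using rep transversalD(1)[OF R] by blast
    show "finite (rep ` Eis)" by (rule finite_subset[OF _ transversalD(2)[OF R]]) (use rep in blast)
    show "\<exists>r\<in>rep ` Eis. edvd \<alpha> (z - r)" if "z \<in> Eis" for z using rep[OF that] that by blast
  next
    fix r s assume "r \<in> rep ` Eis" "s \<in> rep ` Eis" and d: "edvd \<alpha> (r - s)"
    then obtain x y where x: "x \<in> Eis" "r = rep x" "y \<in> Eis" "s = rep y" by blast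
    have xy: "edvd \<alpha> (x - y)"
    proof -
      have "x - y = (x - r) + (r - s) - (y - s)" by simp
      thus ?thesis using rep[OF x(1)] rep[OF x(3)] d x by (metis edvd_add edvd_diff)
    qed
    have "edvd \<alpha> (x - w) = edvd \<alpha> (y - w)" for w
    proof -
      have "x - w = (x - y) + (y - w)" "y - w = (x - w) - (x - y)" by simp_all
      thus ?thesis using xy by (metis edvd_add edvd_diff)
    qed
    thus "r = s" unfolding x rep_def by simp
  qed
  thus ?thesis by blast
qed

text \<open>The index is found without lattice volumes: n = \<alpha> * cnj \<alpha> is a rational
  integer with n^2 classes, conjugation shows that \<alpha> and cnj \<alpha> have equally many, and
  multiplicativity makes the square of that number n^2.\<close>

lemma transversal_exists:
  assumes a: "\<alpha> \<in> Eis" "\<alpha> \<noteq> 0"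
  shows "\<exists>R. transversal \<alpha> R \<and> card R = enorm \<alpha>"
proof -
  have n: "of_nat (enorm \<alpha>) = \<alpha> * cnj \<alpha>" using mult_cnj_enorm[OF a(1)] by simp
  obtain T where T: "transversal (of_nat (enorm \<alpha>)) T" "card T = (enorm \<alpha>)\<^sup>2"
    using transversal_of_nat[of "enorm \<alpha>"] enorm_pos[OF a] by blast
  have "edvd \<alpha> (of_nat (enorm \<alpha>))" unfolding n using a by (intro edvd_mult) auto
  then obtain R where R: "transversal \<alpha> R" using transversal_coarser[OF T(1)] by blast
  obtain U where U: "transversal (\<alpha> * cnj \<alpha>) U" "card U = card R * card (cnj ` R)"
    using transversal_mult[OF R transversal_cnj[OF R]] a by auto
  have "card U = card T" using transversal_card_eq U(1) T(1) unfolding n by blast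
  moreover have "card (cnj ` R) = card R" by (intro card_image inj_onI) simp
  ultimately have "(card R)\<^sup>2 = (enorm \<alpha>)\<^sup>2" using U(2) T(2) by (simp add: power2_eq_square)
  hence "card R = enorm \<alpha>" by simp
  thus ?thesis using R by blast
qed

lemma ideal_norm_principal:
  assumes a: "\<alpha> \<in> Eis" "\<alpha> \<noteq> 0"
  shows "ideal_norm (principal_ideal \<alpha>) = enorm \<alpha>"
proof -
  obtain R where R: "transversal \<alpha> R" "card R = enorm \<alpha>" using transversal_exists[OF a] by blast
  define cl where "cl = (\<lambda>z. {w \<in> Eis. edvd \<alpha> (z - w)})"
  have cl_eq: "cl x = cl y" if "edvd \<alpha> (x - y)" for x y
  proof -
    have "x - w = (x - y) + (y - w)" "y - w = (x - w) - (x - y)" for w by simp_all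
    thus ?thesis unfolding cl_def using that by (metis edvd_add edvd_diff)
  qed
  have "cl ` Eis = cl ` R"
  proof (intro equalityI subsetI)
    fix C assume "C \<in> cl ` Eis"
    then obtain z where z: "z \<in> Eis" "C = cl z" by blast
    then obtain r where "r \<in> R" "edvd \<alpha> (z - r)" using transversalD(3)[OF R(1)] by blast
    thus "C \<in> cl ` R" using cl_eq z by blast
  qed (use transversalD(1)[OF R(1)] in blast)
  moreover have "inj_on cl R"
  proof (rule inj_onI)
    fix r s assume rs: "r \<in> R" "s \<in> R" "cl r = cl s"
    have "s \<in> cl s" using rs(2) transversalD(1)[OF R(1)] by (auto simp: cl_def)
    hence "s \<in> cl r" by (simp only: rs(3))
    hence "edvd \<alpha> (r - s)" by (simp add: cl_def)
    thus "r = s" using transversalD(4)[OF R(1) rs(1,2)] by blast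
  qed
  ultimately have "card (cl ` Eis) = enorm \<alpha>" using R(2) by (simp add: card_image)
  thus ?thesis unfolding ideal_norm_def principal_ideal_mem cl_def .
qed

section \<open>Prime divisors and prime power divisors\<close>

lemma sector_primesD: "\<pi> \<in> sector_primes \<Longrightarrow> \<pi> \<in> Eis" "\<pi> \<in> sector_primes \<Longrightarrow> \<pi> \<noteq> 0" "\<pi> \<in> sector_primes \<Longrightarrow> \<not> edvd \<pi> 1"
  "\<pi> \<in> sector_primes \<Longrightarrow> a \<in> Eis \<Longrightarrow> b \<in> Eis \<Longrightarrow> edvd \<pi> (a * b) \<Longrightarrow> edvd \<pi> a \<or> edvd \<pi> b"
  unfolding sector_primes_def eprime_def by auto

lemma sector_primes_enorm_ge: "\<pi> \<in> sector_primes \<Longrightarrow> enorm \<pi> \<ge> 2"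
  using sector_primesD(1-3)[of \<pi>] enorm_pos[of \<pi>] enorm_1_iff[of \<pi>] unit_iff[of \<pi>] by (cases "enorm \<pi> = 1") auto

text \<open>A nonunit divisor p of least norm is prime. If p divides x * y but not x, the generator
  of the ideal (p, x) must be a unit: otherwise minimality makes it an associate of p, which would
  then divide x. The resulting relation 1 = p c + x d, multiplied by y, shows that p divides
  y.\<close>

lemma prime_divisor_exists_sector_primes:
  assumes a: "\<alpha> \<in> Eis" "\<alpha> \<noteq> 0" "\<not> edvd \<alpha> 1"
  shows "\<exists>\<pi>\<in>sector_primes. edvd \<pi> \<alpha>"
proof -
  define Q where "Q = (\<lambda>d. d \<in> Eis \<and> \<not> edvd d 1 \<and> edvd d \<alpha>)"
  have "Q \<alpha>" using a by (simp add: Q_def)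
  then obtain p where p: "Q p" "\<And>d. Q d \<Longrightarrow> enorm p \<le> enorm d" using ex_has_least_nat[of Q \<alpha> enorm] by blast
  have pE: "p \<in> Eis" "\<not> edvd p 1" "edvd p \<alpha>" using p(1) by (auto simp: Q_def)
  have p0: "p \<noteq> 0" using pE(3) a(2) by (auto simp: edvd_def)
  have "edvd p x \<or> edvd p y" if xy: "x \<in> Eis" "y \<in> Eis" "edvd p (x * y)" for x y
  proof (rule ccontr)
    assume n: "\<not> (edvd p x \<or> edvd p y)"
    define J where "J = {p * c + x * d | c d. c \<in> Eis \<and> d \<in> Eis}"
    have "eis_ideal J" unfolding eis_ideal_def
    proof (intro conjI ballI)
      show "J \<subseteq> Eis" using pE xy by (auto simp: J_def)
      show "0 \<in> J" unfolding J_def by (intro CollectI exI[of _ 0]) auto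
      fix u v assume "u \<in> J" "v \<in> J"
      then obtain c d c' d' where "c \<in> Eis" "d \<in> Eis" "c' \<in> Eis" "d' \<in> Eis" "u = p * c + x * d" "v = p * c' + x * d'"
        unfolding J_def by blast
      moreover from this have "u + v = p * (c + c') + x * (d + d')" by (simp add: algebra_simps)
      ultimately show "u + v \<in> J" unfolding J_def by (intro CollectI exI[of _ "c + c'"] exI[of _ "d + d'"]) auto
    next
      fix r u assume "r \<in> Eis" "u \<in> J"
      then obtain c d where "c \<in> Eis" "d \<in> Eis" "u = p * c + x * d" unfolding J_def by blast
      moreover from this have "r * u = p * (r * c) + x * (r * d)" by (simp add: algebra_simps)
      ultimately show "r * u \<in> J" using \<open>r \<in> Eis\<close> unfolding J_def by (intro CollectI exI[of _ "r * c"] exI[of _ "r * d"]) auto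
    qed
    then obtain \<delta> where \<delta>: "\<delta> \<in> Eis" "J = principal_ideal \<delta>" using Eis_PID by blast
    have "p * 1 + x * 0 \<in> J" "p * 0 + x * 1 \<in> J" unfolding J_def using Eis_0 Eis_1 by blast+
    hence dp: "edvd \<delta> p" and dx: "edvd \<delta> x" using \<delta>(2) principal_ideal_mem by simp_all
    have "edvd \<delta> 1"
    proof (rule ccontr)
      assume nu: "\<not> edvd \<delta> 1"
      hence "Q \<delta>" using \<delta>(1) dp pE(3) edvd_trans unfolding Q_def by blast
      hence le: "enorm p \<le> enorm \<delta>" by (rule p(2))
      obtain c where c: "c \<in> Eis" "p = \<delta> * c" using dp unfolding edvd_def by blast
      have "enorm p = enorm \<delta> * enorm c" using c \<delta> by (simp add: enorm_mult)
      moreover have "enorm p > 0" using pE p0 enorm_pos by blast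
      ultimately have "enorm c = 1" using le by (cases "enorm c") auto
      hence "edvd c 1" using c enorm_1_iff unit_iff by blast
      then obtain e where e: "e \<in> Eis" "1 = c * e" unfolding edvd_def by blast
      have "\<delta> = p * e" unfolding c(2) mult.assoc e(2)[symmetric] by simp
      hence "edvd p \<delta>" using e unfolding edvd_def by blast
      thus False using dx n edvd_trans by blast
    qed
    hence "1 \<in> J" using \<delta>(2) principal_ideal_mem by simp
    then obtain c d where cd: "c \<in> Eis" "d \<in> Eis" "1 = p * c + x * d" unfolding J_def by blast
    have "y = (p * c + x * d) * y" using cd(3) by simp
    also have "\<dots> = p * (c * y) + (x * y) * d" by (simp add: algebra_simps)
    finally have "y = p * (c * y) + (x * y) * d" .
    moreover have "edvd p (p * (c * y))" using cd xy unfolding edvd_def by blast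
    moreover have "edvd p ((x * y) * d)" using edvd_mult[OF xy(3) cd(2)] .
    ultimately have "edvd p y" using edvd_add by metis
    thus False using n by blast
  qed
  hence ep: "eprime p" using pE p0 unfolding eprime_def by blast
  obtain u where u: "u \<in> Eis" "cmod u = 1" "sector (p * u)" using sector_associate[OF pE(1) p0] by blast
  have "p * u \<in> sector_primes" using eprime_assoc[OF ep u(1,2)] u(3) by (simp add: sector_primes_def)
  moreover have "edvd (p * u) \<alpha>"
  proof -
    have "principal_ideal p = principal_ideal (p * u)"
      using principal_eq_iff[of p "p * u"] u pE p0 by auto
    thus ?thesis using pE(3) by (metis principal_ideal_mem)
  qed
  ultimately show ?thesis by blast
qed

text \<open>Divisibility between primes makes them associates, and the sector contains only one
  associate of each.\<close>

lemma sector_primes_edvd_imp_eq: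
  assumes "\<pi> \<in> sector_primes" "\<rho> \<in> sector_primes" "edvd \<pi> \<rho>" shows "\<pi> = \<rho>"
proof -
  obtain c where c: "c \<in> Eis" "\<rho> = \<pi> * c" using assms(3) unfolding edvd_def by blast
  have "edvd \<rho> (\<pi> * c)" using c by simp
  hence "edvd \<rho> \<pi> \<or> edvd \<rho> c" using sector_primesD(4)[OF assms(2) sector_primesD(1)[OF assms(1)] c(1)] by blast
  hence "edvd \<rho> \<pi>"
  proof
    assume "edvd \<rho> c"
    then obtain d where d: "d \<in> Eis" "c = \<rho> * d" unfolding edvd_def by blast
    have "\<rho> * (\<pi> * d) = \<pi> * (\<rho> * d)" by (simp add: mult_ac)
    also have "\<dots> = \<rho> * 1" unfolding d(2)[symmetric] c(2)[symmetric] by simp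
    finally have "1 = \<pi> * d" using sector_primesD(2)[OF assms(2)] by (simp only: mult_cancel_left simp_thms)
    hence "edvd \<pi> 1" using d unfolding edvd_def by blast
    thus ?thesis using sector_primesD(3)[OF assms(1)] by blast
  qed
  hence "principal_ideal \<pi> = principal_ideal \<rho>"
    using assms(3) by (auto simp: principal_ideal_mem set_eq_iff intro: edvd_trans)
  thus ?thesis using principal_inj_sector_primes assms by (auto dest: inj_onD)
qed

lemma prime_power_edvd_cancel:
  assumes "\<pi> \<in> sector_primes" "\<rho> \<in> Eis" "\<not> edvd \<pi> \<rho>" "\<beta> \<in> Eis" "edvd (\<pi> ^ j) (\<rho> * \<beta>)"
  shows "edvd (\<pi> ^ j) \<beta>"
  using assms(5)
proof (induction j)
  case 0 thus ?case using assms(4) by (auto simp: edvd_def)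
next
  case (Suc j)
  obtain d where d: "d \<in> Eis" "\<rho> * \<beta> = \<pi> ^ Suc j * d" using Suc.prems unfolding edvd_def by blast
  have "edvd (\<pi> ^ j) (\<rho> * \<beta>)" unfolding edvd_def using d sector_primesD(1)[OF assms(1)]
    by (intro bexI[of _ "\<pi> * d"]) (auto simp: mult_ac)
  then obtain c where c: "c \<in> Eis" "\<beta> = \<pi> ^ j * c" using Suc.IH unfolding edvd_def by blast
  have "\<pi> ^ j * (\<rho> * c) = \<pi> ^ j * (\<pi> * d)" using c d by (simp add: mult_ac)
  hence "\<rho> * c = \<pi> * d" using sector_primesD(2)[OF assms(1)] by simp
  hence "edvd \<pi> (\<rho> * c)" using d unfolding edvd_def by blast
  hence "edvd \<pi> c" using sector_primesD(4)[OF assms(1,2) c(1)] assms(3) by blast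
  hence "edvd (\<pi> ^ j * \<pi>) (\<pi> ^ j * c)" using edvd_cancel[of "\<pi> ^ j"] sector_primesD(2)[OF assms(1)] by simp
  thus ?case using c by (simp add: mult.commute)
qed

text \<open>One pair for every admissible exponent: the valuation at \<pi> becomes a number of
  pairs, so that a sum over \<open>ppdiv \<alpha>\<close> weighs each prime with its
  multiplicity.\<close>

definition ppdiv :: "complex \<Rightarrow> (complex \<times> nat) set" where
  "ppdiv \<alpha> = {(\<pi>, j). \<pi> \<in> sector_primes \<and> j \<ge> 1 \<and> edvd (\<pi> ^ j) \<alpha>}"

lemma ppdiv_unit: 
  assumes "\<alpha> \<in> Eis" "edvd \<alpha> 1" shows "ppdiv \<alpha> = {}"
proof -
  have False if "\<pi> \<in> sector_primes" "j \<ge> 1" "edvd (\<pi> ^ j) \<alpha>" for \<pi> j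
  proof -
    obtain i where "j = Suc i" using \<open>j \<ge> 1\<close> by (cases j) auto
    hence "edvd \<pi> (\<pi> ^ j)" using sector_primesD(1)[OF that(1)] unfolding edvd_def by auto
    hence "edvd \<pi> 1" using that(3) assms(2) edvd_trans by blast
    thus False using sector_primesD(3)[OF that(1)] by blast
  qed
  thus ?thesis unfolding ppdiv_def by blast
qed

text \<open>Multiplication by \<pi> raises the exponents at \<pi> by one, which frees the exponent
  1, and leaves all other primes alone.\<close>

lemma ppdiv_mult:
  assumes p: "\<pi> \<in> sector_primes" and b: "\<beta> \<in> Eis"
  shows "ppdiv (\<pi> * \<beta>) = insert (\<pi>, 1) ((\<lambda>(\<rho>, j). (\<rho>, if \<rho> = \<pi> then j + 1 else j)) ` ppdiv \<beta>)"
proof -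
  have 1: "edvd (\<pi> ^ Suc j) (\<pi> * \<beta>) \<longleftrightarrow> edvd (\<pi> ^ j) \<beta>" for j
    using edvd_cancel[OF sector_primesD(2)[OF p], of "\<pi> ^ j" \<beta>] by simp
  have 2: "edvd (\<rho> ^ j) (\<pi> * \<beta>) \<longleftrightarrow> edvd (\<rho> ^ j) \<beta>" if "\<rho> \<in> sector_primes" "\<rho> \<noteq> \<pi>" for \<rho> j
  proof
    assume "edvd (\<rho> ^ j) (\<pi> * \<beta>)"
    moreover have "\<not> edvd \<rho> \<pi>" using sector_primes_edvd_imp_eq[OF that(1) p] that(2) by blast
    ultimately show "edvd (\<rho> ^ j) \<beta>" using prime_power_edvd_cancel[OF that(1) sector_primesD(1)[OF p] _ b] by blast
  next
    assume "edvd (\<rho> ^ j) \<beta>"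
    thus "edvd (\<rho> ^ j) (\<pi> * \<beta>)" using edvd_mult[of _ \<beta> \<pi>] sector_primesD(1)[OF p] by (simp add: mult.commute)
  qed
  show ?thesis
  proof (intro equalityI subsetI)
    fix x assume "x \<in> ppdiv (\<pi> * \<beta>)"
    then obtain \<rho> j where x: "x = (\<rho>, j)" "\<rho> \<in> sector_primes" "j \<ge> 1" "edvd (\<rho> ^ j) (\<pi> * \<beta>)" unfolding ppdiv_def by blast
    show "x \<in> insert (\<pi>, 1) ((\<lambda>(\<rho>, j). (\<rho>, if \<rho> = \<pi> then j + 1 else j)) ` ppdiv \<beta>)"
    proof (cases "\<rho> = \<pi>")
      case True
      show ?thesis
      proof (cases "j = 1")
        case False
        then obtain i where i: "j = Suc i" "i \<ge> 1" using x(3) by (cases j) auto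
        hence "(\<pi>, i) \<in> ppdiv \<beta>" using x(2,4) True 1 unfolding ppdiv_def by simp
        thus ?thesis using x(1) True i by (intro insertI2 image_eqI[of _ _ "(\<pi>, i)"]) auto
      qed (use x True in simp)
    next
      case False
      hence "(\<rho>, j) \<in> ppdiv \<beta>" using x 2 unfolding ppdiv_def by simp
      thus ?thesis using x(1) False by (intro insertI2 image_eqI[of _ _ "(\<rho>, j)"]) auto
    qed
  next
    fix x assume "x \<in> insert (\<pi>, 1) ((\<lambda>(\<rho>, j). (\<rho>, if \<rho> = \<pi> then j + 1 else j)) ` ppdiv \<beta>)"
    thus "x \<in> ppdiv (\<pi> * \<beta>)"
    proof
      assume "x = (\<pi>, 1)"
      thus ?thesis using p 1[of 0] b unfolding ppdiv_def by (auto simp: edvd_def)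
    next
      assume "x \<in> (\<lambda>(\<rho>, j). (\<rho>, if \<rho> = \<pi> then j + 1 else j)) ` ppdiv \<beta>"
      then obtain \<rho> j where "x = (\<rho>, if \<rho> = \<pi> then j + 1 else j)" "\<rho> \<in> sector_primes" "j \<ge> 1" "edvd (\<rho> ^ j) \<beta>"
        unfolding ppdiv_def by auto
      thus ?thesis using 1[of j] 2[of \<rho> j] unfolding ppdiv_def by (auto split: if_splits)
    qed
  qed
qed

text \<open>The identity between log and the divisor sum of the von Mangoldt function. Induction on
  the norm, splitting off one prime at a time, makes it the only form of unique factorisation
  required for the logarithmic derivative.\<close>

lemma ppdiv_finite_sum:
  assumes "\<alpha> \<in> Eis" "\<alpha> \<noteq> 0"
  shows "finite (ppdiv \<alpha>) \<and> (\<Sum>(\<pi>, j)\<in>ppdiv \<alpha>. ln (real (enorm \<pi>))) = ln (real (enorm \<alpha>))"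
  using assms
proof (induction "enorm \<alpha>" arbitrary: \<alpha> rule: less_induct)
  case less
  show ?case
  proof (cases "edvd \<alpha> 1")
    case True
    hence "enorm \<alpha> = 1" using less.prems unit_iff enorm_1_iff by blast
    thus ?thesis using ppdiv_unit[OF less.prems(1) True] by simp
  next
    case False
    then obtain \<pi> where p: "\<pi> \<in> sector_primes" "edvd \<pi> \<alpha>" using prime_divisor_exists_sector_primes less.prems by blast
    then obtain \<beta> where b: "\<beta> \<in> Eis" "\<alpha> = \<pi> * \<beta>" unfolding edvd_def by blast
    have b0: "\<beta> \<noteq> 0" using b less.prems by auto
    have n: "enorm \<alpha> = enorm \<pi> * enorm \<beta>" using b p sector_primesD(1) enorm_mult by blast
    have pos: "enorm \<beta> > 0" using enorm_pos b b0 by blast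
    have "enorm \<beta> < enorm \<alpha>" using n sector_primes_enorm_ge[OF p(1)] pos by simp
    from less.hyps[OF this b(1) b0] have IH: "finite (ppdiv \<beta>)"
      "(\<Sum>(\<pi>, j)\<in>ppdiv \<beta>. ln (real (enorm \<pi>))) = ln (real (enorm \<beta>))" by auto
    define g where "g = (\<lambda>(\<rho>, j::nat). (\<rho>, if \<rho> = \<pi> then j + 1 else j))"
    have inj: "inj_on g (ppdiv \<beta>)" by (auto intro!: inj_onI simp: g_def split: if_splits)
    have nin: "(\<pi>, 1) \<notin> g ` ppdiv \<beta>" by (auto simp: g_def ppdiv_def split: if_splits)
    have eq: "ppdiv \<alpha> = insert (\<pi>, 1) (g ` ppdiv \<beta>)" using ppdiv_mult[OF p(1) b(1)] b(2) by (simp add: g_def)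
    have "(\<Sum>(\<pi>, j)\<in>ppdiv \<alpha>. ln (real (enorm \<pi>))) = ln (real (enorm \<pi>)) + (\<Sum>x\<in>g ` ppdiv \<beta>. ln (real (enorm (fst x))))"
      unfolding eq using nin IH(1) by (simp add: case_prod_unfold)
    also have "(\<Sum>x\<in>g ` ppdiv \<beta>. ln (real (enorm (fst x)))) = (\<Sum>x\<in>ppdiv \<beta>. ln (real (enorm (fst x))))"
      unfolding sum.reindex[OF inj] by (simp add: g_def case_prod_unfold o_def)
    also have "\<dots> = ln (real (enorm \<beta>))" using IH(2) by (simp add: case_prod_unfold)
    also have "ln (real (enorm \<pi>)) + ln (real (enorm \<beta>)) = ln (real (enorm \<alpha>))"
      unfolding n using sector_primes_enorm_ge[OF p(1)] pos by (simp add: ln_mult)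
    finally show ?thesis using eq IH(1) by simp
  qed
qed

subsection \<open>Chebyshev's upper bound\<close>

text \<open>The coefficient occurs twice in row 2 n + 1, whose sum is 2 * 4^n.\<close>

lemma central_binomial_le: "(2 * n + 1) choose n \<le> 4 ^ n"
proof -
  have "2 * ((2 * n + 1) choose n) = (\<Sum>k\<in>{n, n + 1}. (2 * n + 1) choose k)"
    using binomial_symmetric[of n "2 * n + 1"] by simp
  also have "\<dots> \<le> (\<Sum>k\<le>2 * n + 1. (2 * n + 1) choose k)" by (intro sum_mono2) auto
  also have "\<dots> = 2 ^ (2 * n + 1)" by (rule choose_row_sum)
  also have "\<dots> = 2 * 4 ^ n" by (simp add: power_mult)
  finally show ?thesis by simp
qed

definition primorial :: "nat \<Rightarrow> nat" where
  "primorial n = \<Prod>{p. prime p \<and> p \<le> n}"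

lemma prod_primes_dvd:
  fixes S :: "nat set"
  assumes "finite S" "\<And>p. p \<in> S \<Longrightarrow> prime p" "\<And>p. p \<in> S \<Longrightarrow> p dvd m"
  shows "\<Prod>S dvd m"
  using assms
proof (induction S rule: finite_induct)
  case (insert p S)
  have "coprime p (\<Prod>S)" 
  proof (rule prod_coprime_right)
    fix q assume "q \<in> S"
    thus "coprime p q" using insert by (metis insert_iff primes_coprime)
  qed
  thus ?case using insert by (simp add: divides_mult)
qed auto

text \<open>Strong induction in the manner of Erdos. For n = 2 k + 1 the primes between k + 2 and n
  divide the binomial coefficient n choose k, which is at most 4^k; the others are covered by the
  bound for k + 1. An even n > 2 is not prime.\<close>

lemma primorial_le: "primorial n \<le> 4 ^ n"
proof (induction n rule: less_induct)
  case (less n)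
  have fin: "finite {p. prime p \<and> p \<le> m}" for m :: nat by (rule finite_subset[of _ "{..m}"]) auto
  have "n \<le> 1 \<or> n = 2 \<or> (\<exists>k. n = 2 * k \<and> k \<ge> 2) \<or> (\<exists>k. n = 2 * k + 1 \<and> k \<ge> 1)"
    by presburger
  then consider "n \<le> 1" | "n = 2" | k where "n = 2 * k" "k \<ge> 2" | k where "n = 2 * k + 1" "k \<ge> 1"
    by blast
  thus ?case
  proof cases
    case 1
    have "\<not> (prime p \<and> p \<le> n)" for p using 1 prime_gt_1_nat[of p] by linarith
    hence "{p. prime p \<and> p \<le> n} = {}" by blast
    thus ?thesis unfolding primorial_def by (simp only: prod.empty) simp
  next
    case 2
    have "{p::nat. prime p \<and> p \<le> 2} = {2}" by (auto dest!: prime_ge_2_nat)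
    thus ?thesis unfolding primorial_def 2 by simp
  next
    case (3 k)
    have np: "\<not> prime n"
    proof
      assume "prime n"
      hence "(2::nat) = 1 \<or> 2 = n" using 3 unfolding prime_nat_iff by (metis dvd_triv_left)
      thus False using 3 by auto
    qed
    have "p \<le> n \<longleftrightarrow> p \<le> n - 1" if "prime p" for p
    proof -
      have "p \<noteq> n" using that np by blast
      thus ?thesis using 3 by linarith
    qed
    hence "{p. prime p \<and> p \<le> n} = {p. prime p \<and> p \<le> n - 1}" by blast
    hence "primorial n = primorial (n - 1)" unfolding primorial_def by simp
    also have "\<dots> \<le> 4 ^ (n - 1)" using 3 by (intro less) auto
    also have "\<dots> \<le> 4 ^ n" by (intro power_increasing) auto
    finally show ?thesis .
  next
    case (4 k)
    define S where "S = {p. prime p \<and> k + 1 < p \<and> p \<le> n}"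
    have "{p. prime p \<and> p \<le> n} = {p. prime p \<and> p \<le> k + 1} \<union> S" using 4 by (auto simp: S_def)
    moreover have "finite S" by (rule finite_subset[of _ "{..n}"]) (auto simp: S_def)
    ultimately have eq: "primorial n = primorial (k + 1) * \<Prod>S"
      unfolding primorial_def using fin by (subst prod.union_disjoint[symmetric]) (auto simp: S_def)
    have "\<Prod>S dvd (n choose k)"
    proof (rule prod_primes_dvd[OF \<open>finite S\<close>])
      fix p assume p: "p \<in> S"
      thus pp: "prime p" by (simp add: S_def)
      have "fact k * fact (n - k) * (n choose k) = (fact n :: nat)" using 4 by (intro binomial_fact_lemma) auto
      moreover have "p dvd (fact n :: nat)" using p pp by (simp add: S_def prime_dvd_fact_iff)
      ultimately have "p dvd fact k * fact (n - k) * (n choose k)" by simp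
      moreover have "n - k = k + 1" using 4 by simp
      hence "\<not> p dvd fact k" "\<not> p dvd fact (n - k)"
        unfolding prime_dvd_fact_iff[OF pp] using p by (simp_all add: S_def)
      ultimately show "p dvd (n choose k)" using pp by (auto simp: prime_dvd_mult_iff)
    qed
    hence "\<Prod>S \<le> n choose k" using 4 by (intro dvd_imp_le) auto
    also have "\<dots> \<le> 4 ^ k" using central_binomial_le[of k] 4 by simp
    finally have "primorial n \<le> 4 ^ (k + 1) * 4 ^ k" unfolding eq using 4 by (intro mult_mono less) auto
    also have "\<dots> = 4 ^ n" using 4 by (simp add: power_add mult_2)
    finally show ?thesis .
  qed
qed

text \<open>Taken at m = N(\<pi>), this places \<pi> above a rational prime q \<le> N(\<pi>), which
  reduces Chebyshev's bound to rational primes.\<close>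

lemma sector_primes_edvd_rational_prime:
  assumes p: "\<pi> \<in> sector_primes" and m: "m \<ge> 1" "edvd \<pi> (of_nat m)"
  shows "\<exists>q. prime q \<and> q dvd m \<and> edvd \<pi> (of_nat q)"
  using m
proof (induction m rule: less_induct)
  case (less m)
  have "m \<noteq> 1" using less.prems sector_primesD(3)[OF p] by auto
  then obtain q where q: "prime q" "q dvd m" using prime_factor_nat by blast
  then obtain k where k: "m = q * k" by auto
  have "edvd \<pi> (of_nat q) \<or> edvd \<pi> (of_nat k)"
    using sector_primesD(4)[OF p, of "of_nat q" "of_nat k"] less.prems by (simp add: k)
  thus ?case
  proof
    assume "edvd \<pi> (of_nat k)"
    moreover have k1: "k \<ge> 1" using k less.prems(1) by (cases k) auto
    moreover have "k < m"
    proof -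
      have "2 * k \<le> m" unfolding k by (rule mult_le_mono1[OF prime_ge_2_nat[OF q(1)]])
      thus ?thesis using k1 by linarith
    qed
    ultimately obtain r where "prime r" "r dvd k" "edvd \<pi> (of_nat r)" using less.IH by blast
    thus ?thesis using k by auto
  qed (use q in blast)
qed

lemma Eis_bounded_finite: "finite {\<alpha> \<in> Eis. enorm \<alpha> \<le> n}"
proof -
  define I where "I = {- int n - int n..int n + int n}"
  have "{\<alpha> \<in> Eis. enorm \<alpha> \<le> n} \<subseteq> (\<lambda>(a, b). of_int a + of_int b * omega) ` (I \<times> I)"
  proof
    fix \<alpha> assume a: "\<alpha> \<in> {\<alpha> \<in> Eis. enorm \<alpha> \<le> n}"
    then obtain a b where ab: "\<alpha> = of_int a + of_int b * omega" by (auto elim: EisE)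
    have "real_of_int (a\<^sup>2 + a * b + b\<^sup>2) \<le> real n" using a real_enorm[of \<alpha>] enorm_lin[of a b] by (simp add: ab)
    hence l: "a\<^sup>2 + a * b + b\<^sup>2 \<le> int n" by linarith
    have sq: "3 * y\<^sup>2 \<le> 4 * int n" if "x\<^sup>2 + x * y + y\<^sup>2 \<le> int n" for x y :: int
    proof -
      have "3 * y\<^sup>2 = 4 * (x\<^sup>2 + x * y + y\<^sup>2) - (2 * x + y)\<^sup>2"
        by (simp add: power2_eq_square algebra_simps)
      also have "\<dots> \<le> 4 * (x\<^sup>2 + x * y + y\<^sup>2)" by simp
      also have "\<dots> \<le> 4 * int n" by (rule mult_left_mono[OF that]) simp
      finally show ?thesis .
    qed
    have "3 * b\<^sup>2 \<le> 4 * int n" by (rule sq[OF l])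
    moreover have "3 * a\<^sup>2 \<le> 4 * int n" by (rule sq[of b]) (use l in \<open>simp add: algebra_simps\<close>)
    moreover have "\<bar>x\<bar> \<le> x\<^sup>2" for x :: int
    proof (cases "x = 0")
      case False
      hence "\<bar>x\<bar> * 1 \<le> \<bar>x\<bar> * \<bar>x\<bar>" by (intro mult_left_mono) auto
      thus ?thesis by (simp add: power2_eq_square)
    qed simp
    hence "\<bar>a\<bar> \<le> a\<^sup>2" "\<bar>b\<bar> \<le> b\<^sup>2" by blast+
    ultimately have "a \<in> I" "b \<in> I" unfolding I_def by auto
    thus "\<alpha> \<in> (\<lambda>(a, b). of_int a + of_int b * omega) ` (I \<times> I)" using ab by force
  qed
  thus ?thesis by (rule finite_subset) (simp add: I_def)
qed

lemma sector_primes_bounded_finite: "finite {\<pi> \<in> sector_primes. enorm \<pi> \<le> n}"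
  by (rule finite_subset[OF _ Eis_bounded_finite[of n]]) (auto dest: sector_primesD)

text \<open>Every prime of norm at most n divides the rational integer \<open>primorial n\<close>,
  so the sum is at most the logarithm of its norm. The norm of a rational integer is its square,
  whence the factor 2 in front of ln 4.\<close>

lemma chebyshev_sector_primes: "(\<Sum>\<pi> | \<pi> \<in> sector_primes \<and> enorm \<pi> \<le> n. ln (real (enorm \<pi>))) \<le> 2 * ln 4 * real n"
proof -
  have fin: "finite {p::nat. prime p \<and> p \<le> n}" by (rule finite_subset[of _ "{..n}"]) auto
  define Q where "Q = (of_nat (primorial n) :: complex)"
  have pos: "primorial n > 0" unfolding primorial_def by (intro prod_pos) (auto simp: prime_gt_0_nat)
  have Q: "Q \<in> Eis" "Q \<noteq> 0" using pos by (simp_all add: Q_def)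
  define T where "T = {\<pi>. \<pi> \<in> sector_primes \<and> enorm \<pi> \<le> n}"
  have "(\<lambda>\<pi>. (\<pi>, 1 :: nat)) ` T \<subseteq> ppdiv Q"
  proof
    fix x assume "x \<in> (\<lambda>\<pi>. (\<pi>, 1::nat)) ` T"
    then obtain \<pi> where p: "x = (\<pi>, 1)" "\<pi> \<in> sector_primes" "enorm \<pi> \<le> n" by (auto simp: T_def)
    have "edvd \<pi> (\<pi> * cnj \<pi>)" using sector_primesD(1)[OF p(2)] by (intro edvd_mult) auto
    hence "edvd \<pi> (of_nat (enorm \<pi>))" using mult_cnj_enorm[OF sector_primesD(1)[OF p(2)]] by simp
    then obtain q where q: "prime q" "q dvd enorm \<pi>" "edvd \<pi> (of_nat q)"
      using sector_primes_edvd_rational_prime[OF p(2)] sector_primes_enorm_ge[OF p(2)] by (metis One_nat_def Suc_1 Suc_leD)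
    have "q \<le> enorm \<pi>" using q(2) sector_primes_enorm_ge[OF p(2)] by (intro dvd_imp_le) auto
    hence "q \<in> {q. prime q \<and> q \<le> n}" using q(1) p(3) by simp
    hence "q dvd primorial n" unfolding primorial_def by (rule dvd_prodI[OF fin])
    then obtain k where "primorial n = q * k" by auto
    hence "edvd \<pi> Q" using edvd_mult[OF q(3), of "of_nat k"] by (simp add: Q_def)
    thus "x \<in> ppdiv Q" using p by (simp add: ppdiv_def)
  qed
  hence "(\<Sum>(\<pi>, j)\<in>(\<lambda>\<pi>. (\<pi>, 1 :: nat)) ` T. ln (real (enorm \<pi>))) \<le> (\<Sum>(\<pi>, j)\<in>ppdiv Q. ln (real (enorm \<pi>)))"
    using ppdiv_finite_sum[OF Q] by (intro sum_mono2) (auto simp: ppdiv_def dest: sector_primes_enorm_ge)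
  also have "\<dots> = ln (real (enorm Q))" using ppdiv_finite_sum[OF Q] by simp
  also have "\<dots> = 2 * ln (real (primorial n))" unfolding Q_def enorm_of_nat using pos by (simp add: ln_realpow)
  also have "\<dots> \<le> 2 * ln (real (4 ^ n))" using primorial_le[of n] pos by (intro mult_left_mono) (auto simp flip: of_nat_power)
  also have "\<dots> = 2 * ln 4 * real n" by (simp add: ln_realpow)
  finally have "(\<Sum>(\<pi>, j)\<in>(\<lambda>\<pi>. (\<pi>, 1 :: nat)) ` T. ln (real (enorm \<pi>))) \<le> 2 * ln 4 * real n" .
  moreover have "inj_on (\<lambda>\<pi>. (\<pi>, 1::nat)) T" by (auto intro: inj_onI)
  ultimately show ?thesis unfolding T_def[symmetric] by (simp add: sum.reindex)
qed

section \<open>Hecke series\<close>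

lemma summable_on_Times_mult:
  fixes f :: "'a \<Rightarrow> real" and g :: "'b \<Rightarrow> real"
  assumes "f summable_on A" "g summable_on B" "\<And>x. x \<in> A \<Longrightarrow> f x \<ge> 0" "\<And>y. y \<in> B \<Longrightarrow> g y \<ge> 0"
  shows "(\<lambda>(x, y). f x * g y) summable_on A \<times> B"
proof (rule summable_on_SigmaI)
  show "((\<lambda>y. case (x, y) of (x, y) \<Rightarrow> f x * g y) has_sum f x * infsum g B) B" for x
    using has_sum_cmult_right[OF has_sum_infsum[OF assms(2)], of "f x"] by simp
  show "(\<lambda>x. f x * infsum g B) summable_on A" by (rule summable_on_cmult_left[OF assms(1)])
qed (use assms in auto)

lemma norm_exp_minus_one_le:
  fixes u :: complex assumes "norm u \<le> b"
  shows "norm (exp u - 1) \<le> exp b * norm u"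
proof -
  have "norm (exp u - exp 0) \<le> exp b * norm (u - 0)"
  proof (rule field_differentiable_bound[of "cball 0 b" exp exp])
    fix z :: complex assume "z \<in> cball 0 b"
    thus "norm (exp z) \<le> exp b" using complex_Re_le_cmod[of z] by simp
  qed (use assms order_trans[OF norm_ge_zero assms] in \<open>auto intro!: derivative_eq_intros\<close>)
  thus ?thesis by simp
qed

lemma npow_deriv: "(npow n has_field_derivative - of_real (ln (real n)) * npow n s) (at s)"
  unfolding npow_def by (auto intro!: derivative_eq_intros)

text \<open>The index set is arbitrary because the same facts are needed for lattice points and for
  prime powers. Absolute convergence at the abscissa halfway between \<sigma>0 and Re z supplies the
  local majorant.\<close>

lemma
  fixes c :: "'i \<Rightarrow> complex" and N :: "'i \<Rightarrow> nat"
  assumes N: "\<And>i. i \<in> I \<Longrightarrow> N i \<ge> 1"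
    and S: "\<And>p. p > \<sigma>0 \<Longrightarrow> (\<lambda>i. norm (c i) * real (N i) powr (- p)) summable_on I"
  shows dirichlet_holomorphic: "(\<lambda>s. \<Sum>\<^sub>\<infinity>i\<in>I. c i * npow (N i) s) holomorphic_on {s. Re s > \<sigma>0}"
    and dirichlet_deriv: "Re s > \<sigma>0 \<Longrightarrow> ((\<lambda>i. - of_real (ln (real (N i))) * (c i * npow (N i) s)) has_sum
         deriv (\<lambda>s. \<Sum>\<^sub>\<infinity>i\<in>I. c i * npow (N i) s) s) I"
    and dirichlet_summable: "Re s > \<sigma>0 \<Longrightarrow> (\<lambda>i. c i * npow (N i) s) summable_on I"
proof -
  have nm: "norm (c i * npow (N i) s) = norm (c i) * real (N i) powr (- Re s)" if "i \<in> I" for i s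
    using N[OF that] by (simp add: norm_mult norm_npow)
  have ex: "\<exists>V M. open V \<and> z \<in> V \<and> M summable_on I \<and> (\<forall>i\<in>I. \<forall>w\<in>V \<inter> {s. Re s > \<sigma>0}. norm (c i * npow (N i) w) \<le> M i)"
    if z: "z \<in> {s. Re s > \<sigma>0}" for z
  proof (intro exI conjI ballI)
    define p where "p = (Re z + \<sigma>0) / 2"
    show "open {w. Re w > p}" by (rule open_halfspace_Re_gt)
    show "z \<in> {w. Re w > p}" using z by (simp add: p_def)
    show "(\<lambda>i. norm (c i) * real (N i) powr (- p)) summable_on I" using z by (intro S) (simp add: p_def)
    fix i w assume i: "i \<in> I" and w: "w \<in> {w. Re w > p} \<inter> {s. Re s > \<sigma>0}"
    have "real (N i) powr (- Re w) \<le> real (N i) powr (- p)" using N[OF i] w by (intro powr_mono) auto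
    thus "norm (c i * npow (N i) w) \<le> norm (c i) * real (N i) powr (- p)"
      unfolding nm[OF i] by (rule mult_left_mono) simp
  qed
  have dt: "deriv (\<lambda>s. c i * npow (N i) s) s = - of_real (ln (real (N i))) * (c i * npow (N i) s)" for i s
    by (rule DERIV_imp_deriv) (auto intro!: derivative_eq_intros npow_deriv)
  have ho: "(\<lambda>s. c i * npow (N i) s) holomorphic_on A" for i A by (intro holomorphic_intros)
  show "(\<lambda>s. \<Sum>\<^sub>\<infinity>i\<in>I. c i * npow (N i) s) holomorphic_on {s. Re s > \<sigma>0}"
    by (rule holomorphic_infsum_and_deriv(1)[OF open_halfspace_Re_gt ho ex])
  show "((\<lambda>i. - of_real (ln (real (N i))) * (c i * npow (N i) s)) has_sum
         deriv (\<lambda>s. \<Sum>\<^sub>\<infinity>i\<in>I. c i * npow (N i) s) s) I" if "Re s > \<sigma>0"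
    using holomorphic_infsum_and_deriv(2)[OF open_halfspace_Re_gt ho ex, of s] that unfolding dt by simp
  have *: "(\<lambda>i. norm (c i * npow (N i) s)) summable_on I" if "Re s > \<sigma>0"
    using S[OF that] by (rule summable_on_cong[THEN iffD2, rotated]) (rule nm)
  show "(\<lambda>i. c i * npow (N i) s) summable_on I" if "Re s > \<sigma>0"
    by (rule abs_summable_summable) (rule *[OF that])
qed

section \<open>Absolute convergence over the lattice\<close>

definition Eis_nonzero :: "complex set" where "Eis_nonzero = Eis - {0}"

lemma Eis_nonzero_D: "\<alpha> \<in> Eis_nonzero \<Longrightarrow> \<alpha> \<in> Eis" "\<alpha> \<in> Eis_nonzero \<Longrightarrow> \<alpha> \<noteq> 0" "\<alpha> \<in> Eis_nonzero \<Longrightarrow> enorm \<alpha> \<ge> 1"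
  using enorm_pos[of \<alpha>] by (auto simp: Eis_nonzero_def)

lemma summable_on_int_powr:
  assumes p: "p > 1"
  shows "(\<lambda>a::int. real_of_int (max 1 \<bar>a\<bar>) powr (- p)) summable_on UNIV"
proof -
  define f where "f = (\<lambda>a::int. real_of_int (max 1 \<bar>a\<bar>) powr (- p))"
  have S: "(\<lambda>n. (real n + 1) powr (- p)) summable_on UNIV"
    using summable_on_powr_nat[of "- p"] p by (simp add: add.commute)
  define A B where "A = (\<lambda>n. int (Suc n)) ` UNIV" and "B = (\<lambda>n. - int (Suc n)) ` UNIV"
  have 1: "f summable_on A" unfolding A_def
    by (subst summable_on_reindex) (use S in \<open>auto simp: inj_on_def f_def o_def max_def add.commute\<close>)
  have 2: "f summable_on B" unfolding B_def
    by (subst summable_on_reindex) (use S in \<open>auto simp: inj_on_def f_def o_def max_def add.commute\<close>)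
  have "f summable_on A \<union> B" by (rule summable_on_Un_disjoint[OF 1 2]) (auto simp: A_def B_def)
  hence "f summable_on (A \<union> B) \<union> {0}" by (rule summable_on_Un_disjoint) (auto simp: A_def B_def)
  moreover have "(A \<union> B) \<union> {0} = UNIV"
  proof (intro equalityI subsetI UNIV_I)
    fix x :: int
    have "x \<in> A" if "x > 0" unfolding A_def by (rule image_eqI[of _ _ "nat (x - 1)"]) (use that in auto)
    moreover have "x \<in> B" if "x < 0" unfolding B_def by (rule image_eqI[of _ _ "nat (- x - 1)"]) (use that in auto)
    ultimately show "x \<in> (A \<union> B) \<union> {0}" by (cases x "0::int" rule: linorder_cases) auto
  qed
  ultimately show ?thesis unfolding f_def by simp
qed

text \<open>Off the axes this is (|a| - |b|)^2 \<ge> 0; the \<open>max 1\<close> keeps the estimate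
  valid on the axes. The product form allows the lattice sum to be compared with a product of two
  one-dimensional sums.\<close>

lemma norm_form_ge:
  fixes a b :: int
  assumes "\<not> (a = 0 \<and> b = 0)"
  shows "max 1 \<bar>a\<bar> * max 1 \<bar>b\<bar> \<le> a\<^sup>2 + a * b + b\<^sup>2"
proof -
  have sq: "\<bar>x\<bar> \<le> x\<^sup>2" for x :: int
  proof (cases "x = 0")
    case False
    hence "\<bar>x\<bar> * 1 \<le> \<bar>x\<bar> * \<bar>x\<bar>" by (intro mult_left_mono) auto
    thus ?thesis by (simp add: power2_eq_square)
  qed simp
  show ?thesis
  proof (cases "a = 0 \<or> b = 0")
    case True
    thus ?thesis using assms sq[of a] sq[of b] by (auto simp: max_def)
  next
    case False
    have "0 \<le> (\<bar>a\<bar> - \<bar>b\<bar>)\<^sup>2" by simp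
    also have "\<dots> = a\<^sup>2 + b\<^sup>2 - 2 * \<bar>a * b\<bar>" by (simp add: power2_diff abs_mult)
    finally have "\<bar>a * b\<bar> \<le> a\<^sup>2 + a * b + b\<^sup>2" by linarith
    moreover have "max 1 \<bar>a\<bar> = \<bar>a\<bar>" "max 1 \<bar>b\<bar> = \<bar>b\<bar>" using False by auto
    ultimately show ?thesis by (simp add: abs_mult)
  qed
qed

lemma Eis_coord_bij: "bij_betw (\<lambda>(a, b). of_int a + of_int b * omega) UNIV Eis"
  unfolding bij_betw_def
proof
  show "inj (\<lambda>(a, b). of_int a + of_int b * omega)" by (auto simp: inj_on_def complex_eq_iff)
  show "range (\<lambda>(a, b). of_int a + of_int b * omega) = Eis" by (auto simp: Eis_def)
qed

text \<open>In the coordinates a, b the terms are dominated by a product of one-dimensional terms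
  with the same exponent, by \<open>norm_form_ge\<close>; hence p > 1 is enough.\<close>

lemma summable_on_enorm:
  assumes p: "p > 1"
  shows "(\<lambda>\<alpha>. real (enorm \<alpha>) powr (- p)) summable_on Eis_nonzero"
proof -
  define m where "m = (\<lambda>a::int. real_of_int (max 1 \<bar>a\<bar>) powr (- p))"
  define h where "h = (\<lambda>(a::int, b::int). of_int a + of_int b * omega)"
  have "(\<lambda>(a, b). m a * m b) summable_on UNIV \<times> UNIV"
    using summable_on_int_powr[OF p] by (intro summable_on_Times_mult) (auto simp: m_def)
  hence S: "(\<lambda>(a, b). m a * m b) summable_on (UNIV - {(0, 0)})" by (rule summable_on_subset_banach) auto
  have le: "real (enorm (h x)) powr (- p) \<le> (case x of (a, b) \<Rightarrow> m a * m b)" if "x \<in> UNIV - {(0, 0)}" for x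
  proof -
    obtain a b where x: "x = (a, b)" by fastforce
    have hE: "h x \<in> Eis" by (simp add: x h_def EisI)
    have "real_of_int (max 1 \<bar>a\<bar>) * real_of_int (max 1 \<bar>b\<bar>) = real_of_int (max 1 \<bar>a\<bar> * max 1 \<bar>b\<bar>)" by (simp only: of_int_mult)
    also have "\<dots> \<le> real_of_int (a\<^sup>2 + a * b + b\<^sup>2)" using norm_form_ge[of a b] that x by (simp only: of_int_le_iff) auto
    also have "\<dots> = real (enorm (h x))" unfolding real_enorm[OF hE] by (simp only: h_def x prod.case enorm_lin)
    finally have "real (enorm (h x)) powr (- p) \<le> (real_of_int (max 1 \<bar>a\<bar>) * real_of_int (max 1 \<bar>b\<bar>)) powr (- p)"
      using p by (intro powr_mono2') auto
    also have "\<dots> = m a * m b" by (simp add: m_def powr_mult)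
    finally show ?thesis by (simp add: x)
  qed
  have "(\<lambda>x. real (enorm (h x)) powr (- p)) summable_on (UNIV - {(0, 0)})"
    by (rule summable_on_comparison_test[OF S le]) auto
  moreover have "bij_betw h (UNIV - {(0, 0)}) Eis_nonzero"
    using bij_betw_DiffI[OF Eis_coord_bij, of "{(0,0)}" "{0}"] unfolding h_def Eis_nonzero_def by (auto simp: bij_betw_def)
  ultimately show ?thesis using summable_on_reindex_bij_betw by blast
qed

section \<open>Hecke characters and their zeta series\<close>

definition hecke_char :: "int \<Rightarrow> complex \<Rightarrow> complex" where
  "hecke_char k z = sgn z powi (6 * k)"

lemma hecke_char_0 [simp]: "hecke_char 0 z = 1" by (simp add: hecke_char_def)

lemma hecke_char_1 [simp]: "hecke_char k 1 = 1" by (simp add: hecke_char_def)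

lemma hecke_char_mult: "hecke_char k (z * w) = hecke_char k z * hecke_char k w"
  by (simp add: hecke_char_def sgn_mult power_int_mult_distrib)

lemma norm_hecke_char: "z \<noteq> 0 \<Longrightarrow> norm (hecke_char k z) = 1"
  by (simp add: hecke_char_def norm_power_int norm_sgn)

lemma hecke_char_add: "z \<noteq> 0 \<Longrightarrow> hecke_char (k + l) z = hecke_char k z * hecke_char l z"
  by (simp add: hecke_char_def power_int_add distrib_left sgn_zero_iff)

lemma hecke_char_uminus: "z \<noteq> 0 \<Longrightarrow> hecke_char (- k) z = cnj (hecke_char k z)"
proof -
  assume z: "z \<noteq> 0"
  have "hecke_char (- k) z * hecke_char k z = 1" using hecke_char_add[OF z, of "- k" k] by simp
  moreover have "cnj (hecke_char k z) * hecke_char k z = 1"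
    using complex_norm_square[of "hecke_char k z"] norm_hecke_char[OF z, of k] by (simp add: mult.commute)
  moreover have "hecke_char k z \<noteq> 0" using norm_hecke_char[OF z, of k] by auto
  ultimately show ?thesis by (metis mult_right_cancel)
qed

lemma hecke_char_of_nat: "n > 0 \<Longrightarrow> hecke_char k (of_nat n) = 1"
  by (simp add: hecke_char_def sgn_eq)

text \<open>The norm equation confines both coordinates to -1, 0, 1, which leaves the sixth roots of
  unity. Triviality on units prevents the terms of norm 1 from cancelling in the zeta
  series.\<close>

lemma hecke_char_unit: 
  assumes "u \<in> Eis" "cmod u = 1" shows "hecke_char k u = 1"
proof -
  have six: "u ^ 6 = 1"
  proof -
    obtain a b where u: "u = of_int a + of_int b * omega" using assms(1) by (rule EisE)
    have n: "a\<^sup>2 + a * b + b\<^sup>2 = 1" using enorm_lin[of a b] assms(2) unfolding u by (metis of_int_eq_1_iff one_power2)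
    have "max 1 \<bar>a\<bar> * max 1 \<bar>b\<bar> \<le> 1" using norm_form_ge[of a b] n by (cases "a = 0 \<and> b = 0") auto
    moreover have "max 1 \<bar>a\<bar> \<le> max 1 \<bar>a\<bar> * max 1 \<bar>b\<bar>" "max 1 \<bar>b\<bar> \<le> max 1 \<bar>a\<bar> * max 1 \<bar>b\<bar>"
      using mult_left_mono[of 1 "max 1 \<bar>b\<bar>" "max 1 \<bar>a\<bar>"] mult_right_mono[of 1 "max 1 \<bar>a\<bar>" "max 1 \<bar>b\<bar>"] by auto
    ultimately have "\<bar>a\<bar> \<le> 1" "\<bar>b\<bar> \<le> 1" by linarith+
    hence ab: "a \<in> {-1, 0, 1}" "b \<in> {-1, 0, 1}" by auto
    have o6: "omega ^ 6 = 1" unfolding omega_def Complex.DeMoivre by simp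
    have o3: "omega ^ 3 = -1" unfolding omega_def Complex.DeMoivre by simp
    have o1: "omega - 1 = omega ^ 2" by (simp add: power2_eq_square omega_sq)
    have "u \<in> {1, -1, omega, - omega, omega ^ 2, - (omega ^ 2)}"
      using ab n unfolding u o1[symmetric] by auto
    moreover have o12: "omega ^ 12 = 1" using power_mult[of omega 6 2] o6 by simp
    ultimately show ?thesis using o6 by (auto simp: power_mult[symmetric])
  qed
  have "sgn u = u" using assms(2) by (simp add: sgn_eq)
  thus ?thesis unfolding hecke_char_def power_int_mult using six by simp
qed

lemma Eis_nonzero_mult: "\<alpha> \<in> Eis_nonzero \<Longrightarrow> \<beta> \<in> Eis_nonzero \<Longrightarrow> \<alpha> * \<beta> \<in> Eis_nonzero" by (auto simp: Eis_nonzero_def)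

text \<open>The sum runs over elements instead of ideals, which makes it six times the Hecke
  L-function. This suits the decomposition into cosets, and the factor disappears in the logarithmic
  derivative.\<close>

definition hecke_zeta :: "int \<Rightarrow> complex \<Rightarrow> complex" where
  "hecke_zeta k s = (\<Sum>\<^sub>\<infinity>\<alpha>\<in>Eis_nonzero. hecke_char k \<alpha> * npow (enorm \<alpha>) s)"

lemma hecke_zeta_conv: "p > 1 \<Longrightarrow> (\<lambda>\<alpha>. norm (hecke_char k \<alpha>) * real (enorm \<alpha>) powr (- p)) summable_on Eis_nonzero"
  using summable_on_enorm[of p] by (rule summable_on_cong[THEN iffD2, rotated]) (auto simp: norm_hecke_char Eis_nonzero_def)

lemma hecke_zeta_holomorphic: "hecke_zeta k holomorphic_on {s. Re s > 1}"
  unfolding hecke_zeta_def[abs_def] by (rule dirichlet_holomorphic[OF Eis_nonzero_D(3) hecke_zeta_conv])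

lemma hecke_zeta_summable:
  assumes "Re s > 1"
  shows "(\<lambda>\<alpha>. hecke_char k \<alpha> * npow (enorm \<alpha>) s) summable_on Eis_nonzero"
  by (rule dirichlet_summable[OF Eis_nonzero_D(3) hecke_zeta_conv assms])

text \<open>For complex arguments, not only for Eisenstein integers, so that values at neighbouring lattice points can be compared.\<close>
definition hecke_term :: "int \<Rightarrow> complex \<Rightarrow> complex \<Rightarrow> complex" where
  "hecke_term k s z = (if z = 0 then 0 else hecke_char k z * exp (- s * of_real (ln ((cmod z)\<^sup>2))))"

lemma hecke_term_0 [simp]: "hecke_term k s 0 = 0" by (simp add: hecke_term_def)

lemma hecke_term_mult: "hecke_term k s (z * w) = hecke_term k s z * hecke_term k s w"
  by (simp add: hecke_term_def hecke_char_mult norm_mult power_mult_distrib ln_mult exp_add[symmetric] algebra_simps)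

lemma hecke_term_nonzero: "\<alpha> \<in> Eis_nonzero \<Longrightarrow> hecke_term k s \<alpha> = hecke_char k \<alpha> * npow (enorm \<alpha>) s"
  using Eis_nonzero_D[of \<alpha>] by (simp add: hecke_term_def npow_def real_enorm)

lemma hecke_term_holomorphic [holomorphic_intros]: "(\<lambda>s. hecke_term k s z) holomorphic_on A"
  unfolding hecke_term_def by (cases "z = 0") (auto intro!: holomorphic_intros)

lemma norm_hecke_term: "\<alpha> \<in> Eis_nonzero \<Longrightarrow> norm (hecke_term k s \<alpha>) = real (enorm \<alpha>) powr (- Re s)"
  using Eis_nonzero_D[of \<alpha>] by (simp add: hecke_term_nonzero norm_mult norm_hecke_char norm_npow)

lemma norm_hecke_term_le_1: "z \<in> Eis \<Longrightarrow> Re s \<ge> 0 \<Longrightarrow> norm (hecke_term k s z) \<le> 1"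
proof (cases "z = 0")
  case False
  assume "z \<in> Eis" "Re s \<ge> 0"
  hence z: "z \<in> Eis_nonzero" using False by (simp add: Eis_nonzero_def)
  have "real (enorm z) powr (- Re s) \<le> real (enorm z) powr 0"
    using Eis_nonzero_D(3)[OF z] \<open>Re s \<ge> 0\<close> by (intro powr_mono) auto
  thus ?thesis using norm_hecke_term[OF z] Eis_nonzero_D(3)[OF z] by simp
qed simp

text \<open>A Lipschitz bound at 1, uniform for |s| \<le> T. Near 1 the term is exp u with u linear
  in the real and imaginary parts of Ln w, the character contributing 6 |k| and the power 2 T; the
  leading 2 comes from |Ln w| \<le> 2 |w - 1|.\<close>

lemma hecke_term_near_1:
  assumes w: "cmod (w - 1) < 1 / 2" and T: "cmod s \<le> T"
  shows "norm (hecke_term k s w - 1) \<le> 2 * (6 * \<bar>of_int k\<bar> + 2 * T) * exp (6 * \<bar>of_int k\<bar> + 2 * T) * cmod (w - 1)"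
proof -
  have w0: "w \<noteq> 0" using w by auto
  define L where "L = Ln w"
  define u where "u = \<i> * of_real (6 * of_int k * Im L) - s * of_real (2 * Re L)"
  have expL: "w = of_real (cmod w) * cis (Im L)"
    using exp_Ln[OF w0] exp_eq_polar[of "Ln w"] w0 by (simp add: L_def Re_Ln)
  have "sgn w = w / of_real (cmod w)" by (simp add: sgn_eq)
  also have "\<dots> = (of_real (cmod w) * cis (Im L)) / of_real (cmod w)"
    using expL by (rule arg_cong[of _ _ "\<lambda>x. x / of_real (cmod w)"])
  also have "\<dots> = cis (Im L)" using w0 by simp
  finally have "hecke_char k w = cis (of_int (6 * k) * Im L)" by (simp add: hecke_char_def cis_power_int)
  moreover have "ln ((cmod w)\<^sup>2) = 2 * Re L" using w0 by (simp add: L_def Re_Ln ln_realpow)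
  ultimately have ffu: "hecke_term k s w = exp u"
    using w0 by (simp add: hecke_term_def u_def cis_conv_exp exp_add[symmetric] algebra_simps)
  have T0: "T \<ge> 0" using T norm_ge_zero order_trans by blast
  have nL: "cmod L \<le> 2 * cmod (w - 1)" using norm_Ln_le[OF w] by (simp add: L_def)
  define K where "K = 6 * \<bar>real_of_int k\<bar> + 2 * T"
  have K0: "K \<ge> 0" using T0 by (simp add: K_def)
  have "cmod u \<le> cmod (\<i> * of_real (6 * of_int k * Im L)) + cmod (s * of_real (2 * Re L))"
    unfolding u_def by (rule norm_triangle_ineq4)
  also have "\<dots> = 6 * \<bar>of_int k\<bar> * \<bar>Im L\<bar> + 2 * cmod s * \<bar>Re L\<bar>" by (simp add: norm_mult abs_mult)
  also have "\<dots> \<le> 6 * \<bar>of_int k\<bar> * cmod L + 2 * T * cmod L"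
    using T T0 by (intro add_mono mult_mono abs_Im_le_cmod abs_Re_le_cmod) auto
  also have "\<dots> = K * cmod L" by (simp add: K_def algebra_simps)
  finally have u1: "cmod u \<le> K * cmod L" .
  have u2: "cmod u \<le> K * (2 * cmod (w - 1))" using u1 mult_left_mono[OF nL K0] by linarith
  have "K * (2 * cmod (w - 1)) \<le> K * 1" using w K0 by (intro mult_left_mono) auto
  hence "norm (exp u - 1) \<le> exp K * cmod u" using u2 by (intro norm_exp_minus_one_le) simp
  also have "\<dots> \<le> exp K * (K * (2 * cmod (w - 1)))" using u2 by (intro mult_left_mono) auto
  finally show ?thesis unfolding ffu K_def[symmetric] by (simp add: algebra_simps)
qed

section \<open>Differences over the cosets of a modulus\<close>

definition coset_term :: "int \<Rightarrow> complex \<Rightarrow> complex set \<Rightarrow> complex \<Rightarrow> complex \<Rightarrow> complex" where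
  "coset_term k \<gamma> R \<beta> s = (\<Sum>r\<in>R. hecke_term k s (\<gamma> * \<beta> + r) - hecke_term k s (\<gamma> * \<beta>))"

text \<open>With w = 1 + r / (\<gamma> \<beta>) the difference is f(\<gamma> \<beta>) (f(w) - 1),
  and the second factor is O(1 / |\<beta>|). The terms are therefore of order N(\<beta>)^(-Re s -
  1/2), which is summable exactly as soon as Re s > 1/2.\<close>

lemma coset_term_sum_holomorphic:
  assumes \<gamma>: "\<gamma> \<in> Eis_nonzero" and R: "finite R" "R \<subseteq> Eis"
  shows "(\<lambda>s. \<Sum>\<^sub>\<infinity>\<beta>\<in>Eis. coset_term k \<gamma> R \<beta> s) holomorphic_on {s. Re s > 1 / 2}"
proof (rule holomorphic_infsum_and_deriv(1)[OF open_halfspace_Re_gt])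
  show "coset_term k \<gamma> R \<beta> holomorphic_on {s. Re s > 1 / 2}" for \<beta>
    unfolding coset_term_def by (intro holomorphic_intros)
next
  fix z assume z: "z \<in> {s. Re s > 1 / 2}"
  define \<sigma> where "\<sigma> = (Re z + 1 / 2) / 2"
  have \<sigma>: "\<sigma> > 1 / 2" "\<sigma> < Re z" using z by (auto simp: \<sigma>_def)
  define T where "T = cmod z + 1"
  define \<rho> where "\<rho> = Max (insert 1 (cmod ` R))"
  have \<rho>: "\<rho> \<ge> 1" "\<And>r. r \<in> R \<Longrightarrow> cmod r \<le> \<rho>" using R(1) by (auto simp: \<rho>_def)
  define C where "C = 2 * (6 * \<bar>real_of_int k\<bar> + 2 * T) * exp (6 * \<bar>real_of_int k\<bar> + 2 * T)"
  have C0: "C \<ge> 0" by (simp add: C_def T_def)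
  \<comment> \<open>The finitely many \<beta>, including 0, for which w may fail to lie within
    distance 1/2 of 1. For them every single value is bounded by 1, which explains the constant in
    M.\<close>
  define Bad where "Bad = {\<beta> \<in> Eis. cmod (\<gamma> * \<beta>) \<le> 2 * \<rho>}"
  define M where "M = (\<lambda>\<beta>. if \<beta> \<in> Bad then 2 * real (card R) else real (card R) * (C * \<rho>) * real (enorm \<beta>) powr (- (\<sigma> + 1 / 2)))"
  have \<gamma>1: "cmod \<gamma> \<ge> 1" 
  proof -
    have "1 \<le> (cmod \<gamma>)\<^sup>2" using Eis_nonzero_D[OF \<gamma>] real_enorm[of \<gamma>] by (metis of_nat_1 of_nat_le_iff)
    thus ?thesis by (metis norm_ge_zero one_le_power one_power2 power2_le_imp_le)
  qed
  have "Bad \<subseteq> {\<beta> \<in> Eis. enorm \<beta> \<le> nat \<lceil>(2 * \<rho>)\<^sup>2\<rceil>}"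
  proof
    fix \<beta> assume b: "\<beta> \<in> Bad"
    hence "cmod \<gamma> * cmod \<beta> \<le> 2 * \<rho>" by (simp add: Bad_def norm_mult)
    moreover have "1 * cmod \<beta> \<le> cmod \<gamma> * cmod \<beta>" using \<gamma>1 by (intro mult_right_mono) auto
    ultimately have "(cmod \<beta>)\<^sup>2 \<le> (2 * \<rho>)\<^sup>2" by (intro power_mono) auto
    hence "real (enorm \<beta>) \<le> (2 * \<rho>)\<^sup>2" using b real_enorm by (simp add: Bad_def)
    hence "enorm \<beta> \<le> nat \<lceil>(2 * \<rho>)\<^sup>2\<rceil>" by linarith
    thus "\<beta> \<in> {\<beta> \<in> Eis. enorm \<beta> \<le> nat \<lceil>(2 * \<rho>)\<^sup>2\<rceil>}" using b by (simp add: Bad_def)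
  qed
  hence Badfin: "finite Bad" by (rule finite_subset) (rule Eis_bounded_finite)
  have good: "\<beta> \<in> Eis_nonzero" if "\<beta> \<in> Eis - Bad" for \<beta>
    using that \<rho>(1) by (auto simp: Bad_def Eis_nonzero_def)
  have Msum: "M summable_on Eis"
  proof -
    have "(\<lambda>\<beta>. real (card R) * (C * \<rho>) * real (enorm \<beta>) powr (- (\<sigma> + 1 / 2))) summable_on Eis_nonzero"
      using \<sigma> by (intro summable_on_cmult_right summable_on_enorm) auto
    hence "(\<lambda>\<beta>. real (card R) * (C * \<rho>) * real (enorm \<beta>) powr (- (\<sigma> + 1 / 2))) summable_on (Eis - Bad)"
      by (rule summable_on_subset_banach) (use good in blast)
    hence "M summable_on (Eis - Bad)" by (rule summable_on_cong[THEN iffD2, rotated]) (simp add: M_def)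
    moreover have "M summable_on Bad" using Badfin by simp
    ultimately have "M summable_on (Eis - Bad) \<union> Bad" by (rule summable_on_Un_disjoint) auto
    moreover have "(Eis - Bad) \<union> Bad = Eis" by (auto simp: Bad_def)
    ultimately show ?thesis by simp
  qed
  have bound: "norm (coset_term k \<gamma> R \<beta> s) \<le> M \<beta>" if b: "\<beta> \<in> Eis" and s: "Re s > \<sigma>" "cmod s < T" for \<beta> s
  proof (cases "\<beta> \<in> Bad")
    case True
    have "norm (coset_term k \<gamma> R \<beta> s) \<le> (\<Sum>r\<in>R. 2)" unfolding coset_term_def
    proof (rule sum_norm_le)
      fix r assume r: "r \<in> R"
      have "norm (hecke_term k s (\<gamma> * \<beta> + r) - hecke_term k s (\<gamma> * \<beta>)) \<le> norm (hecke_term k s (\<gamma> * \<beta> + r)) + norm (hecke_term k s (\<gamma> * \<beta>))"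
        by (rule norm_triangle_ineq4)
      also have "\<dots> \<le> 1 + 1" using b r R(2) Eis_nonzero_D(1)[OF \<gamma>] s \<sigma> by (intro add_mono norm_hecke_term_le_1) auto
      finally show "norm (hecke_term k s (\<gamma> * \<beta> + r) - hecke_term k s (\<gamma> * \<beta>)) \<le> 2" by simp
    qed
    thus ?thesis using True by (simp add: M_def)
  next
    case False
    have bE: "\<beta> \<in> Eis_nonzero" using good b False by blast
    have gb: "\<gamma> * \<beta> \<in> Eis_nonzero" using Eis_nonzero_mult \<gamma> bE by blast
    have b0: "\<beta> \<noteq> 0" "\<gamma> * \<beta> \<noteq> 0" "cmod \<beta> > 0" using Eis_nonzero_D(2)[OF bE] Eis_nonzero_D(2)[OF gb] by auto
    have big: "cmod (\<gamma> * \<beta>) > 2 * \<rho>" using False b by (simp add: Bad_def)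
    have half: "cmod \<beta> = real (enorm \<beta>) powr (1 / 2)"
      using real_enorm[of \<beta>] b by (simp add: powr_half_sqrt)
    have "norm (coset_term k \<gamma> R \<beta> s) \<le> (\<Sum>r\<in>R. (C * \<rho>) * real (enorm \<beta>) powr (- (\<sigma> + 1 / 2)))" unfolding coset_term_def
    proof (rule sum_norm_le)
      fix r assume r: "r \<in> R"
      define w where "w = 1 + r / (\<gamma> * \<beta>)"
      have w1: "cmod (w - 1) = cmod r / cmod (\<gamma> * \<beta>)" by (simp add: w_def norm_divide)
      have "cmod r / cmod (\<gamma> * \<beta>) < 1 / 2" using \<rho>(2)[OF r] big b0 \<rho>(1) by (simp add: field_simps)
      hence wh: "cmod (w - 1) < 1 / 2" using w1 by simp
      have "\<gamma> * \<beta> + r = (\<gamma> * \<beta>) * w" using b0 by (simp add: w_def distrib_left)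
      hence "hecke_term k s (\<gamma> * \<beta> + r) - hecke_term k s (\<gamma> * \<beta>) = hecke_term k s (\<gamma> * \<beta>) * (hecke_term k s w - 1)"
        by (simp only: hecke_term_mult[of k s "\<gamma> * \<beta>" w] right_diff_distrib mult_1_right)
      hence "norm (hecke_term k s (\<gamma> * \<beta> + r) - hecke_term k s (\<gamma> * \<beta>)) = norm (hecke_term k s (\<gamma> * \<beta>)) * norm (hecke_term k s w - 1)"
        by (simp only: norm_mult)
      also have "\<dots> \<le> real (enorm \<beta>) powr (- \<sigma>) * (C * (\<rho> * real (enorm \<beta>) powr (- (1 / 2))))"
      proof (rule mult_mono)
        have le: "enorm \<beta> \<le> enorm (\<gamma> * \<beta>)"
          using Eis_nonzero_D(3)[OF \<gamma>] enorm_mult[of \<gamma> \<beta>] Eis_nonzero_D(1)[OF \<gamma>] b by simp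
        have "norm (hecke_term k s (\<gamma> * \<beta>)) = real (enorm (\<gamma> * \<beta>)) powr (- Re s)" by (rule norm_hecke_term[OF gb])
        also have "\<dots> \<le> real (enorm (\<gamma> * \<beta>)) powr (- \<sigma>)" using Eis_nonzero_D(3)[OF gb] s by (intro powr_mono) auto
        also have "\<dots> \<le> real (enorm \<beta>) powr (- \<sigma>)" using le Eis_nonzero_D(3)[OF bE] \<sigma> by (intro powr_mono2') auto
        finally show "norm (hecke_term k s (\<gamma> * \<beta>)) \<le> real (enorm \<beta>) powr (- \<sigma>)" .
        have "norm (hecke_term k s w - 1) \<le> C * cmod (w - 1)"
          using hecke_term_near_1[OF wh, of s T k] s unfolding C_def by simp
        also have "cmod (w - 1) \<le> \<rho> * real (enorm \<beta>) powr (- (1 / 2))"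
        proof -
          have "cmod (w - 1) \<le> \<rho> / cmod \<beta>" unfolding w1 norm_mult
          proof (rule frac_le)
            show "cmod \<beta> \<le> cmod \<gamma> * cmod \<beta>" using \<gamma>1 mult_right_mono[of 1 "cmod \<gamma>" "cmod \<beta>"] by simp
          qed (use \<rho> r b0 in auto)
          also have "\<rho> / cmod \<beta> = \<rho> * real (enorm \<beta>) powr (- (1 / 2))"
            by (simp only: half powr_minus divide_inverse[of \<rho>])
          finally show ?thesis .
        qed
        finally show "norm (hecke_term k s w - 1) \<le> C * (\<rho> * real (enorm \<beta>) powr (- (1 / 2)))"
          using C0 by (simp add: mult_left_mono)
      qed auto
      also have "\<dots> = (C * \<rho>) * real (enorm \<beta>) powr (- (\<sigma> + 1 / 2))"
        using powr_add[of "real (enorm \<beta>)" "- \<sigma>" "- (1 / 2)"] by simp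
      finally show "norm (hecke_term k s (\<gamma> * \<beta> + r) - hecke_term k s (\<gamma> * \<beta>)) \<le> (C * \<rho>) * real (enorm \<beta>) powr (- (\<sigma> + 1 / 2))" .
    qed
    thus ?thesis using False by (simp add: M_def)
  qed
  have "open {w. Re w > \<sigma> \<and> cmod w < T}" by (intro open_Collect_conj open_Collect_less continuous_intros)
  moreover have "z \<in> {w. Re w > \<sigma> \<and> cmod w < T}" using \<sigma> by (simp add: T_def)
  moreover have "\<forall>i\<in>Eis. \<forall>w\<in>{w. Re w > \<sigma> \<and> cmod w < T} \<inter> {s. Re s > 1 / 2}. norm (coset_term k \<gamma> R i w) \<le> M i"
    using bound by simp
  ultimately show "\<exists>V M. open V \<and> z \<in> V \<and> M summable_on Eis \<and> (\<forall>i\<in>Eis. \<forall>w\<in>V \<inter> {s. Re s > 1 / 2}. norm (coset_term k \<gamma> R i w) \<le> M i)"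
    using Msum by blast
qed

text \<open>Each Eisenstein integer is uniquely \<gamma> \<beta> + r, so the first terms sum to Z;
  the subtracted ones occur N(\<gamma>) times each and factor as f(\<gamma>) f(\<beta>). The term at
  0 is harmless because \<open>hecke_term\<close> is 0 there.\<close>

lemma coset_term_sum_eq:
  assumes \<gamma>: "\<gamma> \<in> Eis_nonzero" and R: "transversal \<gamma> R" "card R = enorm \<gamma>" and s: "Re s > 1"
  shows "(\<Sum>\<^sub>\<infinity>\<beta>\<in>Eis. coset_term k \<gamma> R \<beta> s) = hecke_zeta k s * (1 - of_nat (enorm \<gamma>) * hecke_term k s \<gamma>)"
proof -
  have ZE: "((\<lambda>\<alpha>. hecke_term k s \<alpha>) has_sum hecke_zeta k s) Eis"
  proof -
    have "((\<lambda>\<alpha>. hecke_term k s \<alpha>) has_sum hecke_zeta k s) Eis_nonzero"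
      using has_sum_infsum[OF hecke_zeta_summable[OF s, of k]] unfolding hecke_zeta_def
      by (rule has_sum_cong[THEN iffD2, rotated]) (rule hecke_term_nonzero)
    thus ?thesis by (rule has_sum_cong_neutral[THEN iffD1, rotated 3]) (auto simp: Eis_nonzero_def)
  qed
  define h where "h = (\<lambda>(\<beta>, r). \<gamma> * \<beta> + r)"
  have \<gamma>0: "\<gamma> \<noteq> 0" "\<gamma> \<in> Eis" using Eis_nonzero_D[OF \<gamma>] by auto
  have RE: "r \<in> Eis" if "r \<in> R" for r using transversalD(1)[OF R(1)] that by blast
  have bij: "bij_betw h (Eis \<times> R) Eis"
  proof (rule bij_betw_imageI)
    show "inj_on h (Eis \<times> R)"
    proof (rule inj_onI, clarify)
      fix \<beta> r \<beta>' r' assume a: "\<beta> \<in> Eis" "r \<in> R" "\<beta>' \<in> Eis" "r' \<in> R" "h (\<beta>, r) = h (\<beta>', r')"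
      have "r - r' = \<gamma> * (\<beta>' - \<beta>)" using a(5) by (simp add: h_def algebra_simps)
      hence "edvd \<gamma> (r - r')" using a unfolding edvd_def by blast
      hence "r = r'" using transversalD(4)[OF R(1)] a by blast
      moreover from this have "\<beta> = \<beta>'" using a(5) \<gamma>0 by (simp add: h_def)
      ultimately show "\<beta> = \<beta>' \<and> r = r'" by simp
    qed
    show "h ` (Eis \<times> R) = Eis"
    proof (intro equalityI subsetI)
      fix z assume z: "z \<in> Eis"
      obtain r where r: "r \<in> R" "edvd \<gamma> (z - r)" using transversalD(3)[OF R(1) z] by blast
      then obtain \<beta> where "\<beta> \<in> Eis" "z - r = \<gamma> * \<beta>" unfolding edvd_def by blast
      hence "z = h (\<beta>, r)" by (simp add: h_def algebra_simps)
      thus "z \<in> h ` (Eis \<times> R)" using r \<open>\<beta> \<in> Eis\<close> by blast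
    qed (use RE \<gamma>0 in \<open>auto simp: h_def\<close>)
  qed
  have "((\<lambda>x. hecke_term k s (h x)) has_sum hecke_zeta k s) (Eis \<times> R)"
    using ZE has_sum_reindex[of h "Eis \<times> R" "hecke_term k s" "hecke_zeta k s"] bij unfolding bij_betw_def by (simp add: o_def)
  hence 1: "((\<lambda>\<beta>. \<Sum>r\<in>R. hecke_term k s (\<gamma> * \<beta> + r)) has_sum hecke_zeta k s) Eis"
    by (rule has_sum_SigmaD) (use transversalD(2)[OF R(1)] in \<open>auto simp: h_def intro: has_sum_finite\<close>)
  have 2: "((\<lambda>\<beta>. - (of_nat (enorm \<gamma>) * hecke_term k s \<gamma>) * hecke_term k s \<beta>) has_sum - (of_nat (enorm \<gamma>) * hecke_term k s \<gamma>) * hecke_zeta k s) Eis"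
    by (rule has_sum_cmult_right[OF ZE])
  have "coset_term k \<gamma> R \<beta> s = (\<Sum>r\<in>R. hecke_term k s (\<gamma> * \<beta> + r)) + - (of_nat (enorm \<gamma>) * hecke_term k s \<gamma>) * hecke_term k s \<beta>" for \<beta>
    by (simp add: coset_term_def sum_subtractf R(2) hecke_term_mult)
  hence "(\<Sum>\<^sub>\<infinity>\<beta>\<in>Eis. coset_term k \<gamma> R \<beta> s) = hecke_zeta k s + - (of_nat (enorm \<gamma>) * hecke_term k s \<gamma>) * hecke_zeta k s"
    using infsumI[OF has_sum_add[OF 1 2]] by simp
  thus ?thesis by (simp add: algebra_simps)
qed

subsection \<open>Analytic continuation\<close>

text \<open>
  The integers $\lambda^j + \bar\lambda^j$ for $\lambda = 2 + \omega$, which has trace $5$ and norm $7$.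
  If $\chi_k(\lambda) = 1$, then $7$ would divide one of them.
\<close>
fun lucas5_7 :: "nat \<Rightarrow> int" where
  "lucas5_7 0 = 2"
| "lucas5_7 (Suc 0) = 5"
| "lucas5_7 (Suc (Suc j)) = 5 * lucas5_7 (Suc j) - 7 * lucas5_7 j"

text \<open>Modulo 7 the recurrence is multiplication by the unit 5, starting from 5.\<close>

lemma lucas5_7_not_dvd: "\<not> 7 dvd lucas5_7 (Suc j)"
proof (induction j)
  case (Suc j)
  show ?case
  proof
    assume "7 dvd lucas5_7 (Suc (Suc j))"
    hence "7 dvd (5 * lucas5_7 (Suc j) - 7 * lucas5_7 j) + 7 * lucas5_7 j" by (intro dvd_add) auto
    hence "7 dvd 5 * lucas5_7 (Suc j)" by simp
    thus False using Suc by presburger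
  qed
qed simp

lemma lucas5_7_eq:
  fixes z :: complex
  defines "z \<equiv> 2 + omega"
  shows "z ^ j + cnj z ^ j = of_int (lucas5_7 j)"
proof (induction j rule: lucas5_7.induct)
  case 2
  show ?case by (simp add: z_def complex_eq_iff)
next
  case (3 j)
  have z2: "z * z = 5 * z - 7" unfolding z_def using omega_sq by (simp add: algebra_simps)
  hence c2: "cnj z * cnj z = 5 * cnj z - 7" by (metis complex_cnj_diff complex_cnj_mult complex_cnj_numeral)
  have "z ^ Suc (Suc j) + cnj z ^ Suc (Suc j) = (z * z) * z ^ j + (cnj z * cnj z) * cnj z ^ j" by simp
  also have "\<dots> = 5 * (z ^ Suc j + cnj z ^ Suc j) - 7 * (z ^ j + cnj z ^ j)"
    unfolding z2 c2 by (simp add: algebra_simps)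
  finally show ?case unfolding 3 by simp
qed simp

text \<open>If the character were 1 at \<lambda> = 2 + omega, then \<lambda>^j with j = |6 k| would
  be the positive real |\<lambda>|^j, so the integer \<lambda>^j + cnj \<lambda>^j would have square
  4 * 7^j and be divisible by 7.\<close>

lemma hecke_char_nontrivial:
  assumes k: "k \<noteq> 0" shows "hecke_char k (2 + omega) \<noteq> 1"
proof
  define z :: complex where "z = 2 + omega"
  assume "hecke_char k (2 + omega) = 1"
  hence c: "sgn z powi (6 * k) = 1" by (simp add: hecke_char_def z_def)
  define j where "j = nat \<bar>6 * k\<bar>"
  have sj: "sgn z ^ j = 1"
  proof (cases "k \<ge> 0")
    case True thus ?thesis using c by (simp add: j_def power_int_def)
  next
    case False
    hence "inverse (sgn z) ^ j = 1" using c by (simp add: j_def power_int_def)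
    thus ?thesis by (simp add: power_inverse)
  qed
  obtain i where i: "j = Suc i" using k unfolding j_def by (cases "nat \<bar>6 * k\<bar>") auto
  have nz: "(cmod z)\<^sup>2 = 7" using enorm_lin[of 2 1] by (simp add: z_def)
  have "z = of_real (cmod z) * sgn z" by (cases "z = 0") (auto simp: sgn_eq)
  hence "z ^ j = of_real (cmod z) ^ j * sgn z ^ j" by (metis power_mult_distrib)
  hence zj: "z ^ j = of_real (cmod z ^ j)" using sj by simp
  hence "cnj z ^ j = of_real (cmod z ^ j)" by (metis complex_cnj_complex_of_real complex_cnj_power)
  hence "of_int (lucas5_7 j) = complex_of_real (2 * cmod z ^ j)"
    using lucas5_7_eq[of j] zj unfolding z_def[symmetric] by simp
  hence "complex_of_real (real_of_int (lucas5_7 j)) = complex_of_real (2 * cmod z ^ j)" by simp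
  hence "real_of_int (lucas5_7 j) = 2 * cmod z ^ j" by (simp only: of_real_eq_iff)
  hence "(real_of_int (lucas5_7 j))\<^sup>2 = 4 * ((cmod z)\<^sup>2) ^ j"
    by (simp add: power_mult_distrib power_mult[symmetric] mult.commute)
  hence "real_of_int ((lucas5_7 j)\<^sup>2) = real_of_int (4 * 7 ^ j)" unfolding nz by simp
  hence "(lucas5_7 j)\<^sup>2 = 4 * 7 ^ j" by (simp only: of_int_eq_iff)
  hence "7 dvd (lucas5_7 j)\<^sup>2" by (simp add: i)
  moreover have "prime (7::int)" by simp
  ultimately have "7 dvd lucas5_7 j" by (rule prime_dvd_power[rotated])
  thus False using lucas5_7_not_dvd i by simp
qed

lemma pow9_eq_pow4:
  assumes "(9::nat) ^ m = 4 ^ n" shows "m = 0"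
proof (rule ccontr)
  assume "m \<noteq> 0"
  have "odd ((9::nat) ^ m)" by simp
  hence "odd ((4::nat) ^ n)" using assms by simp
  hence "n = 0" by (cases n) auto
  thus False using assms \<open>m \<noteq> 0\<close> by simp
qed

text \<open>A common nonzero t would make ln 4 / ln 9 rational, that is, a power of 4 equal to a
  nontrivial power of 9, which parity excludes.\<close>

lemma exp_it_ln_4_9:
  assumes "exp (- (\<i> * of_real t) * of_real (ln 4)) = 1" "exp (- (\<i> * of_real t) * of_real (ln 9)) = 1"
  shows "t = 0"
proof (rule ccontr)
  assume t: "t \<noteq> 0"
  obtain m :: int where m: "t * ln 4 = 2 * pi * of_int m"
    using assms(1) unfolding exp_eq_1 by (auto simp: mult_ac) (metis minus_equation_iff mult_minus_right of_int_minus mult.commute mult.left_commute)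
  obtain n :: int where n: "t * ln 9 = 2 * pi * of_int n"
    using assms(2) unfolding exp_eq_1 by (auto simp: mult_ac) (metis minus_equation_iff mult_minus_right of_int_minus mult.commute mult.left_commute)
  have "t * ln 4 * of_int n = t * ln 9 * of_int m" unfolding m n by simp
  hence "ln 4 * of_int n = ln 9 * real_of_int m" using t by simp
  hence "\<bar>ln 4 * of_int n\<bar> = \<bar>ln 9 * real_of_int m\<bar>" by simp
  hence "real (nat \<bar>n\<bar>) * ln 4 = real (nat \<bar>m\<bar>) * ln 9" by (simp add: abs_mult mult.commute)
  hence "ln (4 ^ nat \<bar>n\<bar>) = ln (9 ^ nat \<bar>m\<bar> :: real)" by (simp add: ln_realpow)
  hence "(4 :: real) ^ nat \<bar>n\<bar> = 9 ^ nat \<bar>m\<bar>" by (simp add: ln_inj_iff)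
  hence "real (9 ^ nat \<bar>m\<bar>) = real (4 ^ nat \<bar>n\<bar>)" by simp
  hence "(9 :: nat) ^ nat \<bar>m\<bar> = 4 ^ nat \<bar>n\<bar>" by (simp only: of_nat_eq_iff)
  hence "m = 0" using pow9_eq_pow4 by fastforce
  thus False using m t by simp
qed

section \<open>Zeros of the factor and patching of the continuations\<close>

definition shift_factor :: "int \<Rightarrow> complex \<Rightarrow> complex \<Rightarrow> complex" where
  "shift_factor k \<gamma> s = 1 - of_nat (enorm \<gamma>) * hecke_term k s \<gamma>"

definition pole_factor :: "int \<Rightarrow> complex \<Rightarrow> complex" where
  "pole_factor k s = (if k = 0 then s - 1 else 1)"

text \<open>
  For $k = 0$ the factor vanishes at $s = 1$. Dividing it by $s - 1$ turns the continuation of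
  $Z_0$ into one of $(s - 1) Z_0$, so that all $k$ can be treated alike.
\<close>
definition regular_factor :: "int \<Rightarrow> complex \<Rightarrow> complex \<Rightarrow> complex" where
  "regular_factor k \<gamma> s = (if k = 0 then (if s = 1 then deriv (shift_factor 0 \<gamma>) 1 else shift_factor 0 \<gamma> s / (s - 1)) else shift_factor k \<gamma> s)"

lemma shift_factor_holomorphic: "shift_factor k \<gamma> holomorphic_on A"
  unfolding shift_factor_def by (intro holomorphic_intros)

lemma shift_factor_0_1: "\<gamma> \<in> Eis_nonzero \<Longrightarrow> shift_factor 0 \<gamma> 1 = 0"
  using Eis_nonzero_D(3)[of \<gamma>] npow_one_right[of "enorm \<gamma>"] by (simp add: shift_factor_def hecke_term_nonzero)

lemma regular_factor_holomorphic:
  assumes \<gamma>: "\<gamma> \<in> Eis_nonzero" shows "regular_factor k \<gamma> holomorphic_on UNIV"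
proof (cases "k = 0")
  case True
  have "(\<lambda>s. if s = 1 then deriv (shift_factor 0 \<gamma>) 1 else shift_factor 0 \<gamma> s / (s - 1) - shift_factor 0 \<gamma> 1 / (s - 1)) holomorphic_on UNIV"
    by (rule pole_theorem[OF shift_factor_holomorphic]) auto
  thus ?thesis unfolding regular_factor_def[abs_def] shift_factor_0_1[OF \<gamma>] div_0 diff_zero using True by simp
next
  case False
  thus ?thesis unfolding regular_factor_def[abs_def] using shift_factor_holomorphic[of k \<gamma> UNIV] by simp
qed

lemma shift_factor_regular_factor: "s \<noteq> 1 \<Longrightarrow> shift_factor k \<gamma> s = pole_factor k s * regular_factor k \<gamma> s"
  by (simp add: pole_factor_def regular_factor_def)

lemma of_nat_nonzero: "n > 0 \<Longrightarrow> of_nat n \<in> Eis_nonzero" by (simp add: Eis_nonzero_def)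

text \<open>Positive integers have character value 1 for every k, so these factors depend on s
  alone.\<close>

lemma shift_factor_of_nat:
  assumes "n > 0"
  shows "shift_factor k (of_nat n) (1 + s) = 1 - exp (- s * of_real (ln (real (n\<^sup>2))))"
proof -
  have "hecke_term k (1 + s) (of_nat n) = npow (n\<^sup>2) (1 + s)"
    using hecke_term_nonzero[OF of_nat_nonzero[OF assms]] hecke_char_of_nat[OF assms] by (simp add: enorm_of_nat)
  also have "\<dots> = 1 / of_nat (n\<^sup>2) * npow (n\<^sup>2) s" using assms by (simp only: npow_add npow_one_right zero_less_power)
  finally have "of_nat (n\<^sup>2) * hecke_term k (1 + s) (of_nat n) = npow (n\<^sup>2) s" using assms by simp
  thus ?thesis unfolding shift_factor_def enorm_of_nat by (simp only: npow_def)
qed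

text \<open>Away from s = 1, simultaneous zeros for 2 and 3 force Re s = 1 by taking moduli and then
  Im s = 0 by \<open>exp_it_ln_4_9\<close>. At s = 1 the divided factor of 2 has the value ln 4 when
  k = 0, and 2 + omega serves for k \<noteq> 0.\<close>

lemma regular_factor_nonzero_exists:
  assumes s: "Re s \<ge> 1" shows "\<exists>\<gamma>\<in>Eis_nonzero. regular_factor k \<gamma> s \<noteq> 0"
proof (cases "s = 1")
  case True
  show ?thesis
  proof (cases "k = 0")
    case k: True
    have "(\<lambda>s. shift_factor 0 (of_nat 2) s) = (\<lambda>s. 1 - exp (- (s - 1) * of_real (ln 4)))"
      using shift_factor_of_nat[of 2 0 "s - 1" for s] by (simp add: fun_eq_iff)
    moreover have "((\<lambda>s. 1 - exp (- (s - 1) * of_real (ln 4))) has_field_derivative of_real (ln 4)) (at 1)"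
      by (auto intro!: derivative_eq_intros)
    ultimately have "deriv (shift_factor 0 (of_nat 2)) 1 = of_real (ln 4)" using DERIV_imp_deriv by metis
    hence "regular_factor k (of_nat 2) s \<noteq> 0" using True k by (simp add: regular_factor_def)
    thus ?thesis using of_nat_nonzero[of 2] by auto
  next
    case k: False
    have g: "2 + omega \<in> Eis_nonzero" by (auto simp: Eis_nonzero_def complex_eq_iff intro!: Eis_add Eis_of_nat[of 2, simplified])
    have "shift_factor k (2 + omega) 1 = 1 - hecke_char k (2 + omega)"
      using Eis_nonzero_D(3)[OF g] npow_one_right[of "enorm (2 + omega)"] by (simp add: shift_factor_def hecke_term_nonzero[OF g])
    thus ?thesis using hecke_char_nontrivial[OF k] g k True by (intro bexI[of _ "2 + omega"]) (auto simp: regular_factor_def)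
  qed
next
  case False
  hence Et0: "regular_factor k \<gamma> s = 0 \<Longrightarrow> shift_factor k \<gamma> s = 0" for \<gamma> using shift_factor_regular_factor by simp
  show ?thesis
  proof (rule ccontr)
    assume "\<not> ?thesis"
    hence "shift_factor k (of_nat 2) (1 + (s - 1)) = 0" "shift_factor k (of_nat 3) (1 + (s - 1)) = 0"
      using Et0 of_nat_nonzero[of 2] of_nat_nonzero[of 3] by auto
    hence e: "exp (- (s - 1) * of_real (ln 4)) = 1" "exp (- (s - 1) * of_real (ln 9)) = 1"
      using shift_factor_of_nat[of 2 k "s - 1"] shift_factor_of_nat[of 3 k "s - 1"] by simp_all
    have "norm (exp (- (s - 1) * of_real (ln 4))) = exp (- (Re s - 1) * ln 4)" by simp
    hence "exp (- (Re s - 1) * ln 4) = 1" unfolding e(1) by simp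
    hence "- (Re s - 1) * ln 4 = 0" by (simp only: exp_eq_one_iff)
    hence "Re s = 1" by simp
    hence "s - 1 = \<i> * of_real (Im s)" by (simp add: complex_eq_iff)
    hence "Im s = 0" using exp_it_ln_4_9 e by metis
    thus False using False \<open>Re s = 1\<close> by (simp add: complex_eq_iff)
  qed
qed

definition residue_reps :: "complex \<Rightarrow> complex set" where
  "residue_reps \<gamma> = (SOME R. transversal \<gamma> R \<and> card R = enorm \<gamma>)"

lemma residue_reps: "\<gamma> \<in> Eis_nonzero \<Longrightarrow> transversal \<gamma> (residue_reps \<gamma>) \<and> card (residue_reps \<gamma>) = enorm \<gamma>"
  unfolding residue_reps_def by (rule someI_ex) (rule transversal_exists, auto simp: Eis_nonzero_def)

definition coset_series :: "int \<Rightarrow> complex \<Rightarrow> complex \<Rightarrow> complex" where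
  "coset_series k \<gamma> s = (\<Sum>\<^sub>\<infinity>\<beta>\<in>Eis. coset_term k \<gamma> (residue_reps \<gamma>) \<beta> s)"

lemma coset_series_holomorphic: "\<gamma> \<in> Eis_nonzero \<Longrightarrow> coset_series k \<gamma> holomorphic_on {s. Re s > 1 / 2}"
  unfolding coset_series_def[abs_def] using residue_reps[of \<gamma>] transversalD(1,2)[of \<gamma> "residue_reps \<gamma>"]
  by (intro coset_term_sum_holomorphic) auto

lemma coset_series_eq:
  assumes "\<gamma> \<in> Eis_nonzero" "Re s > 1"
  shows "coset_series k \<gamma> s = pole_factor k s * hecke_zeta k s * regular_factor k \<gamma> s"
proof -
  have "s \<noteq> 1" using assms(2) by auto
  have "coset_series k \<gamma> s = hecke_zeta k s * shift_factor k \<gamma> s"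
    unfolding coset_series_def shift_factor_def using residue_reps[OF assms(1)] assms by (intro coset_term_sum_eq) auto
  thus ?thesis unfolding shift_factor_regular_factor[OF \<open>s \<noteq> 1\<close>] by simp
qed

text \<open>For Re s > 1 both sides are the same product of Z, the pole factor and the two regular
  factors; the identity theorem carries this to the larger half plane. The cross-multiplied form
  stays meaningful where a factor vanishes.\<close>

lemma coset_series_Et_cross:
  assumes "\<gamma> \<in> Eis_nonzero" "\<delta> \<in> Eis_nonzero" "Re s > 1 / 2"
  shows "coset_series k \<gamma> s * regular_factor k \<delta> s = coset_series k \<delta> s * regular_factor k \<gamma> s"
proof (rule analytic_continuation_open[of "{s. Re s > 1}" "{s. Re s > 1 / 2}"
      "\<lambda>s. coset_series k \<gamma> s * regular_factor k \<delta> s" "\<lambda>s. coset_series k \<delta> s * regular_factor k \<gamma> s"])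
  show "open {s. Re s > 1}" "open {s. Re s > 1 / 2}" by (rule open_halfspace_Re_gt)+
  have "(2::complex) \<in> {s. Re s > 1}" by simp
  thus "{s. Re s > 1} \<noteq> {}" by blast
  show "connected {s. Re s > 1 / 2}" by (intro convex_connected convex_halfspace_Re_gt)
  show "(\<lambda>s. coset_series k \<gamma> s * regular_factor k \<delta> s) holomorphic_on {s. Re s > 1 / 2}"
    "(\<lambda>s. coset_series k \<delta> s * regular_factor k \<gamma> s) holomorphic_on {s. Re s > 1 / 2}"
    by (intro holomorphic_on_mult coset_series_holomorphic assms holomorphic_on_subset[OF regular_factor_holomorphic subset_UNIV])+
  show "coset_series k \<gamma> s * regular_factor k \<delta> s = coset_series k \<delta> s * regular_factor k \<gamma> s" if "s \<in> {s. Re s > 1}" for s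
    using coset_series_eq[OF assms(1), of s k] coset_series_eq[OF assms(2), of s k] that by simp
qed (use assms in auto)

definition continuation_domain :: "int \<Rightarrow> complex set" where
  "continuation_domain k = {s. Re s > 1 / 2 \<and> (\<exists>\<gamma>\<in>Eis_nonzero. regular_factor k \<gamma> s \<noteq> 0)}"

text \<open>The modulus is chosen separately at each point. By \<open>coset_series_Et_cross\<close>
  the quotient does not depend on the choice, so near any point one fixed \<gamma> can be
  used.\<close>

definition hecke_continued :: "int \<Rightarrow> complex \<Rightarrow> complex" where
  "hecke_continued k s = (let \<gamma> = (SOME \<gamma>. \<gamma> \<in> Eis_nonzero \<and> regular_factor k \<gamma> s \<noteq> 0) in coset_series k \<gamma> s / regular_factor k \<gamma> s)"

lemma hecke_continued_eq:
  assumes "\<gamma> \<in> Eis_nonzero" "regular_factor k \<gamma> s \<noteq> 0" "Re s > 1 / 2"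
  shows "hecke_continued k s = coset_series k \<gamma> s / regular_factor k \<gamma> s"
proof -
  define \<delta> where "\<delta> = (SOME \<gamma>. \<gamma> \<in> Eis_nonzero \<and> regular_factor k \<gamma> s \<noteq> 0)"
  have d: "\<delta> \<in> Eis_nonzero \<and> regular_factor k \<delta> s \<noteq> 0" unfolding \<delta>_def by (rule someI[of _ \<gamma>]) (use assms in auto)
  have "hecke_continued k s = coset_series k \<delta> s / regular_factor k \<delta> s" by (simp add: hecke_continued_def \<delta>_def Let_def)
  thus ?thesis using coset_series_Et_cross[OF assms(1) conjunct1[OF d] assms(3), of k] d assms(2) by (simp add: frac_eq_eq)
qed

lemma regular_factor_nz_open: "\<gamma> \<in> Eis_nonzero \<Longrightarrow> open {s. Re s > 1 / 2 \<and> regular_factor k \<gamma> s \<noteq> 0}"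
  by (intro open_Collect_conj open_halfspace_Re_gt open_Collect_neq continuous_intros
      holomorphic_on_imp_continuous_on regular_factor_holomorphic)

lemma continuation_domain_open: "open (continuation_domain k)"
proof -
  have "continuation_domain k = (\<Union>\<gamma>\<in>Eis_nonzero. {s. Re s > 1 / 2 \<and> regular_factor k \<gamma> s \<noteq> 0})" by (auto simp: continuation_domain_def)
  thus ?thesis using regular_factor_nz_open by auto
qed

lemma continuation_domain_closed_halfplane: "{s. Re s \<ge> 1} \<subseteq> continuation_domain k"
  using regular_factor_nonzero_exists by (fastforce simp: continuation_domain_def)

lemma hecke_continued_holomorphic: "hecke_continued k holomorphic_on continuation_domain k"
proof -
  have "hecke_continued k analytic_on {s}" if s: "s \<in> continuation_domain k" for s
  proof -
    obtain \<gamma> where g: "\<gamma> \<in> Eis_nonzero" "regular_factor k \<gamma> s \<noteq> 0" "Re s > 1 / 2" using s by (auto simp: continuation_domain_def)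
    define U where "U = {s. Re s > 1 / 2 \<and> regular_factor k \<gamma> s \<noteq> 0}"
    have "(\<lambda>s. coset_series k \<gamma> s / regular_factor k \<gamma> s) holomorphic_on U"
      by (intro holomorphic_intros holomorphic_on_subset[OF coset_series_holomorphic[OF g(1)]] holomorphic_on_subset[OF regular_factor_holomorphic[OF g(1)]])
         (auto simp: U_def)
    hence "hecke_continued k holomorphic_on U"
      by (rule holomorphic_transform) (use hecke_continued_eq[OF g(1)] in \<open>auto simp: U_def\<close>)
    thus ?thesis using regular_factor_nz_open[OF g(1), of k] g unfolding analytic_at U_def by blast
  qed
  hence "hecke_continued k analytic_on continuation_domain k" using analytic_on_analytic_at by blast
  thus ?thesis by (rule analytic_imp_holomorphic)
qed

lemma hecke_continued_Z: "Re s > 1 \<Longrightarrow> hecke_continued k s = pole_factor k s * hecke_zeta k s"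
proof -
  assume s: "Re s > 1"
  then obtain \<gamma> where "\<gamma> \<in> Eis_nonzero" "regular_factor k \<gamma> s \<noteq> 0" using regular_factor_nonzero_exists[of s k] by auto
  thus ?thesis using hecke_continued_eq[of \<gamma> k s] coset_series_eq[of \<gamma> s k] s by simp
qed

subsection \<open>The logarithmic derivative\<close>

text \<open>The set J selects exponents: {1..} for the full von Mangoldt series, {1} for the primes,
  {2..} for the part that already converges beyond Re s = 1.\<close>

definition prime_power_index :: "nat set \<Rightarrow> (complex \<times> nat) set" where "prime_power_index J = sector_primes \<times> J"

definition log_prime_norm :: "complex \<times> nat \<Rightarrow> real" where "log_prime_norm x = ln (real (enorm (fst x)))"

definition prime_power_value :: "complex \<times> nat \<Rightarrow> complex" where "prime_power_value x = fst x ^ snd x"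

definition mangoldt_series :: "int \<Rightarrow> nat set \<Rightarrow> complex \<Rightarrow> complex" where
  "mangoldt_series k J s = (\<Sum>\<^sub>\<infinity>x\<in>prime_power_index J. of_real (log_prime_norm x) * hecke_char k (prime_power_value x) * npow (enorm (prime_power_value x)) s)"

lemma prime_power_value_nonzero: "x \<in> prime_power_index J \<Longrightarrow> prime_power_value x \<in> Eis_nonzero"
  by (auto simp: prime_power_index_def prime_power_value_def Eis_nonzero_def dest: sector_primesD(1,2))

lemma log_prime_norm_nonneg: "x \<in> prime_power_index J \<Longrightarrow> log_prime_norm x \<ge> 0"
  using sector_primes_enorm_ge by (force simp: prime_power_index_def log_prime_norm_def)

text \<open>Termwise differentiation of the zeta series for k = 0 at the real point p gives this
  convergence without any estimate of the logarithm.\<close>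

lemma ln_summable:
  assumes p: "p > 1"
  shows "(\<lambda>\<alpha>. ln (real (enorm \<alpha>)) * real (enorm \<alpha>) powr (- p)) summable_on Eis_nonzero"
proof -
  have "((\<lambda>\<alpha>. - of_real (ln (real (enorm \<alpha>))) * (hecke_char 0 \<alpha> * npow (enorm \<alpha>) (of_real p))) has_sum
         deriv (\<lambda>s. \<Sum>\<^sub>\<infinity>\<alpha>\<in>Eis_nonzero. hecke_char 0 \<alpha> * npow (enorm \<alpha>) s) (of_real p)) Eis_nonzero"
    by (rule dirichlet_deriv[OF Eis_nonzero_D(3) hecke_zeta_conv]) (use p in auto)
  hence "(\<lambda>\<alpha>. norm (- of_real (ln (real (enorm \<alpha>))) * (hecke_char 0 \<alpha> * npow (enorm \<alpha>) (of_real p)))) summable_on Eis_nonzero"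
    by (intro summable_on_iff_abs_summable_on_complex[THEN iffD1] has_sum_imp_summable)
  thus ?thesis
  proof (rule summable_on_cong[THEN iffD1, rotated])
    fix \<alpha> assume "\<alpha> \<in> Eis_nonzero"
    hence "enorm \<alpha> \<ge> 1" by (rule Eis_nonzero_D(3))
    thus "norm (- of_real (ln (real (enorm \<alpha>))) * (hecke_char 0 \<alpha> * npow (enorm \<alpha>) (of_real p)))
        = ln (real (enorm \<alpha>)) * real (enorm \<alpha>) powr (- p)"
      by (simp add: norm_mult norm_npow)
  qed
qed

text \<open>Dirichlet convolution as a change of variables: a pair of a cofactor \<beta> and a prime
  power corresponds to their product together with that prime power divisor of it.\<close>

lemma pair_bij: "bij_betw (\<lambda>(\<beta>, x). (prime_power_value x * \<beta>, x)) (Eis_nonzero \<times> prime_power_index {1..}) (Sigma Eis_nonzero ppdiv)"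
proof (rule bij_betw_imageI)
  show "inj_on (\<lambda>(\<beta>, x). (prime_power_value x * \<beta>, x)) (Eis_nonzero \<times> prime_power_index {1..})"
  proof (rule inj_onI)
    fix u v assume a: "u \<in> Eis_nonzero \<times> prime_power_index {1..}" "v \<in> Eis_nonzero \<times> prime_power_index {1..}"
      "(case u of (\<beta>, x) \<Rightarrow> (prime_power_value x * \<beta>, x)) = (case v of (\<beta>, x) \<Rightarrow> (prime_power_value x * \<beta>, x))"
    have "snd u = snd v" "prime_power_value (snd u) * fst u = prime_power_value (snd v) * fst v"
      using a(3) unfolding case_prod_unfold prod.inject by blast+
    moreover have "prime_power_value (snd u) \<noteq> 0" using Eis_nonzero_D(2)[OF prime_power_value_nonzero[of "snd u" "{1..}"]] a(1) by auto
    ultimately show "u = v" by (cases u; cases v) auto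
  qed
  show "(\<lambda>(\<beta>, x). (prime_power_value x * \<beta>, x)) ` (Eis_nonzero \<times> prime_power_index {1..}) = Sigma Eis_nonzero ppdiv"
  proof (intro equalityI subsetI)
    fix y assume "y \<in> (\<lambda>(\<beta>, x). (prime_power_value x * \<beta>, x)) ` (Eis_nonzero \<times> prime_power_index {1..})"
    then obtain \<beta> x where y: "y = (prime_power_value x * \<beta>, x)" "\<beta> \<in> Eis_nonzero" "x \<in> prime_power_index {1..}" by auto
    have "x \<in> ppdiv (prime_power_value x * \<beta>)"
      using y(2,3) Eis_nonzero_D(1)[of \<beta>] by (cases x) (auto simp: ppdiv_def prime_power_index_def prime_power_value_def edvd_def)
    thus "y \<in> Sigma Eis_nonzero ppdiv" using y Eis_nonzero_mult prime_power_value_nonzero by blast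
  next
    fix y assume "y \<in> Sigma Eis_nonzero ppdiv"
    then obtain \<alpha> \<pi> j where y: "y = (\<alpha>, (\<pi>, j))" "\<alpha> \<in> Eis_nonzero" "\<pi> \<in> sector_primes" "j \<ge> 1" "edvd (\<pi> ^ j) \<alpha>"
      by (auto simp: ppdiv_def)
    then obtain \<beta> where b: "\<beta> \<in> Eis" "\<alpha> = \<pi> ^ j * \<beta>" by (auto simp: edvd_def)
    hence "\<beta> \<in> Eis_nonzero" using y(2) by (auto simp: Eis_nonzero_def)
    thus "y \<in> (\<lambda>(\<beta>, x). (prime_power_value x * \<beta>, x)) ` (Eis_nonzero \<times> prime_power_index {1..})"
      using y b by (intro image_eqI[of _ _ "(\<beta>, (\<pi>, j))"]) (auto simp: prime_power_value_def prime_power_index_def)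
  qed
qed

lemma ppdiv_sum: "\<alpha> \<in> Eis_nonzero \<Longrightarrow> finite (ppdiv \<alpha>)" "\<alpha> \<in> Eis_nonzero \<Longrightarrow> (\<Sum>x\<in>ppdiv \<alpha>. log_prime_norm x) = ln (real (enorm \<alpha>))"
  using ppdiv_finite_sum[of \<alpha>] by (auto simp: Eis_nonzero_def log_prime_norm_def case_prod_unfold)

lemma pair_summable:
  assumes p: "p > 1"
  shows "(\<lambda>(\<alpha>, x). log_prime_norm x * real (enorm \<alpha>) powr (- p)) summable_on Sigma Eis_nonzero ppdiv"
proof (rule summable_on_SigmaI)
  fix \<alpha> assume a: "\<alpha> \<in> Eis_nonzero"
  show "((\<lambda>x. case (\<alpha>, x) of (\<alpha>, x) \<Rightarrow> log_prime_norm x * real (enorm \<alpha>) powr (- p)) has_sum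
      ln (real (enorm \<alpha>)) * real (enorm \<alpha>) powr (- p)) (ppdiv \<alpha>)"
    using ppdiv_sum[OF a] by (intro has_sum_finite_iff[THEN iffD2]) (auto simp: sum_distrib_right[symmetric])
next
  fix \<alpha> x assume "\<alpha> \<in> Eis_nonzero" "x \<in> ppdiv \<alpha>"
  hence "x \<in> prime_power_index UNIV" by (auto simp: ppdiv_def prime_power_index_def)
  thus "0 \<le> (case (\<alpha>, x) of (\<alpha>, x) \<Rightarrow> log_prime_norm x * real (enorm \<alpha>) powr (- p))" using log_prime_norm_nonneg by simp
qed (rule ln_summable[OF p])

lemma mangoldt_series_conv:
  assumes "p > 1"
  shows "(\<lambda>x. norm (of_real (log_prime_norm x) * hecke_char k (prime_power_value x)) * real (enorm (prime_power_value x)) powr (- p)) summable_on prime_power_index {1..}"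
proof -
  have "(\<lambda>y. (case (case y of (\<beta>, x) \<Rightarrow> (prime_power_value x * \<beta>, x)) of (\<alpha>, x) \<Rightarrow> log_prime_norm x * real (enorm \<alpha>) powr (- p))) summable_on Eis_nonzero \<times> prime_power_index {1..}"
    using pair_summable[OF assms] unfolding summable_on_reindex_bij_betw[OF pair_bij] .
  hence "(\<lambda>(\<beta>, x). log_prime_norm x * real (enorm (prime_power_value x * \<beta>)) powr (- p)) summable_on Eis_nonzero \<times> prime_power_index {1..}"
    by (simp add: case_prod_unfold)
  \<comment> \<open>The row \<beta> = 1 of the double series is the von Mangoldt series
    itself.\<close>
  from summable_on_SigmaD1[OF this, of 1]
  have "(\<lambda>x. log_prime_norm x * real (enorm (prime_power_value x)) powr (- p)) summable_on prime_power_index {1..}" by (simp add: Eis_nonzero_def)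
  thus ?thesis
  proof (rule summable_on_cong[THEN iffD1, rotated])
    fix x assume x: "x \<in> prime_power_index {1..}"
    show "log_prime_norm x * real (enorm (prime_power_value x)) powr (- p) = norm (of_real (log_prime_norm x) * hecke_char k (prime_power_value x)) * real (enorm (prime_power_value x)) powr (- p)"
      using log_prime_norm_nonneg[OF x] Eis_nonzero_D(2)[OF prime_power_value_nonzero[OF x]] by (simp add: norm_mult norm_hecke_char)
  qed
qed

lemma prime_power_index_enorm: "x \<in> prime_power_index J \<Longrightarrow> enorm (prime_power_value x) \<ge> 1"
  using Eis_nonzero_D(3) prime_power_value_nonzero by blast

lemma mangoldt_series_1_summable:
  assumes "Re s > 1"
  shows "(\<lambda>x. of_real (log_prime_norm x) * hecke_char k (prime_power_value x) * npow (enorm (prime_power_value x)) s) summable_on prime_power_index {1..}"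
  by (rule dirichlet_summable[OF prime_power_index_enorm mangoldt_series_conv assms])

lemma mangoldt_series_1_holomorphic: "mangoldt_series k {1..} holomorphic_on {s. Re s > 1}"
  unfolding mangoldt_series_def[abs_def] by (rule dirichlet_holomorphic[OF prime_power_index_enorm mangoldt_series_conv])

text \<open>One absolutely convergent double series is summed in two ways. Over the prime power
  divisors of \<alpha> it gives ln N(\<alpha>), hence - Z'; over pairs of cofactor and prime power
  it factors as Z times the von Mangoldt series. No Euler product is involved.\<close>

lemma hecke_zeta_deriv:
  assumes s: "Re s > 1"
  shows "(hecke_zeta k has_field_derivative - (hecke_zeta k s * mangoldt_series k {1..} s)) (at s)"
proof -
  define F where "F = (\<lambda>(\<alpha>, x). of_real (log_prime_norm x) * hecke_term k s \<alpha>)"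
  have nF: "norm (F y) = (case y of (\<alpha>, x) \<Rightarrow> log_prime_norm x * real (enorm \<alpha>) powr (- Re s))" if "y \<in> Sigma Eis_nonzero ppdiv" for y
  proof -
    obtain \<alpha> x where y: "y = (\<alpha>, x)" by (cases y)
    have "x \<in> prime_power_index UNIV" using that y by (auto simp: ppdiv_def prime_power_index_def)
    hence "log_prime_norm x \<ge> 0" by (rule log_prime_norm_nonneg)
    thus ?thesis using that by (simp add: y F_def norm_mult norm_hecke_term)
  qed
  have "(\<lambda>y. norm (F y)) summable_on Sigma Eis_nonzero ppdiv"
    using pair_summable[OF s] by (rule summable_on_cong[THEN iffD2, rotated]) (rule nF)
  hence FS: "F summable_on Sigma Eis_nonzero ppdiv" by (rule abs_summable_summable)
  define S where "S = infsum F (Sigma Eis_nonzero ppdiv)"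
  have S: "(F has_sum S) (Sigma Eis_nonzero ppdiv)" using FS by (simp add: S_def)
  have "((\<lambda>\<alpha>. of_real (ln (real (enorm \<alpha>))) * hecke_term k s \<alpha>) has_sum S) Eis_nonzero"
  proof (rule has_sum_SigmaD[OF S])
    fix \<alpha> assume a: "\<alpha> \<in> Eis_nonzero"
    have "(\<Sum>x\<in>ppdiv \<alpha>. of_real (log_prime_norm x) * hecke_term k s \<alpha>) = of_real (\<Sum>x\<in>ppdiv \<alpha>. log_prime_norm x) * hecke_term k s \<alpha>"
      by (simp add: sum_distrib_right)
    thus "((\<lambda>x. F (\<alpha>, x)) has_sum of_real (ln (real (enorm \<alpha>))) * hecke_term k s \<alpha>) (ppdiv \<alpha>)"
      using ppdiv_sum[OF a] by (intro has_sum_finite_iff[THEN iffD2]) (auto simp: F_def)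
  qed
  hence "((\<lambda>\<alpha>. - (of_real (ln (real (enorm \<alpha>))) * hecke_term k s \<alpha>)) has_sum - S) Eis_nonzero"
    by (simp add: has_sum_uminus)
  hence "((\<lambda>\<alpha>. - of_real (ln (real (enorm \<alpha>))) * (hecke_char k \<alpha> * npow (enorm \<alpha>) s)) has_sum - S) Eis_nonzero"
    by (rule has_sum_cong[THEN iffD1, rotated]) (simp add: hecke_term_nonzero)
  moreover have "((\<lambda>\<alpha>. - of_real (ln (real (enorm \<alpha>))) * (hecke_char k \<alpha> * npow (enorm \<alpha>) s)) has_sum deriv (hecke_zeta k) s) Eis_nonzero"
    unfolding hecke_zeta_def[abs_def] by (rule dirichlet_deriv[OF Eis_nonzero_D(3) hecke_zeta_conv s])
  ultimately have 1: "deriv (hecke_zeta k) s = - S" using has_sum_unique by blast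
  have "((\<lambda>y. F (case y of (\<beta>, x) \<Rightarrow> (prime_power_value x * \<beta>, x))) has_sum S) (Eis_nonzero \<times> prime_power_index {1..})"
    using S unfolding has_sum_reindex_bij_betw[OF pair_bij] .
  moreover have "((\<lambda>x. F (case (\<beta>, x) of (\<beta>, x) \<Rightarrow> (prime_power_value x * \<beta>, x))) has_sum hecke_term k s \<beta> * mangoldt_series k {1..} s) (prime_power_index {1..})" for \<beta>
  proof -
    have "((\<lambda>x. hecke_term k s \<beta> * (of_real (log_prime_norm x) * hecke_char k (prime_power_value x) * npow (enorm (prime_power_value x)) s)) has_sum hecke_term k s \<beta> * mangoldt_series k {1..} s) (prime_power_index {1..})"
      unfolding mangoldt_series_def by (intro has_sum_cmult_right has_sum_infsum mangoldt_series_1_summable s)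
    thus ?thesis
      by (rule has_sum_cong[THEN iffD1, rotated]) (auto simp: F_def hecke_term_mult hecke_term_nonzero[OF prime_power_value_nonzero])
  qed
  ultimately have "((\<lambda>\<beta>. hecke_term k s \<beta> * mangoldt_series k {1..} s) has_sum S) Eis_nonzero" by (rule has_sum_SigmaD)
  moreover have "((\<lambda>\<beta>. hecke_term k s \<beta> * mangoldt_series k {1..} s) has_sum hecke_zeta k s * mangoldt_series k {1..} s) Eis_nonzero"
  proof -
    have "((\<lambda>\<alpha>. hecke_char k \<alpha> * npow (enorm \<alpha>) s * mangoldt_series k {1..} s) has_sum hecke_zeta k s * mangoldt_series k {1..} s) Eis_nonzero"
      unfolding hecke_zeta_def by (intro has_sum_cmult_left has_sum_infsum hecke_zeta_summable s)
    thus ?thesis by (rule has_sum_cong[THEN iffD1, rotated]) (simp add: hecke_term_nonzero)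
  qed
  ultimately have "S = hecke_zeta k s * mangoldt_series k {1..} s" using has_sum_unique by blast
  hence "deriv (hecke_zeta k) s = - (hecke_zeta k s * mangoldt_series k {1..} s)" using 1 by simp
  moreover have "(hecke_zeta k has_field_derivative deriv (hecke_zeta k) s) (at s)"
    using s by (intro holomorphic_derivI[OF hecke_zeta_holomorphic open_halfspace_Re_gt]) simp
  ultimately show ?thesis by simp
qed

text \<open>Far to the right the terms of norm 1 dominate: each equals 1 because the character is
  trivial on units, while all the others together stay below 1 in modulus.\<close>

lemma hecke_zeta_not_identically_0: "\<exists>s. Re s > 1 \<and> hecke_zeta k s \<noteq> 0"
proof -
  define U where "U = {\<alpha> \<in> Eis_nonzero. enorm \<alpha> = 1}"
  have fU: "finite U" by (rule finite_subset[OF _ Eis_bounded_finite[of 1]]) (auto simp: U_def Eis_nonzero_def)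
  define B where "B = (\<Sum>\<^sub>\<infinity>\<alpha>\<in>Eis_nonzero - U. real (enorm \<alpha>) powr (- 2))"
  have S2: "(\<lambda>\<alpha>. real (enorm \<alpha>) powr (- 2)) summable_on Eis_nonzero - U"
    by (rule summable_on_subset_banach[OF summable_on_enorm[of 2]]) auto
  have B0: "B \<ge> 0" unfolding B_def by (rule infsum_nonneg) simp
  \<comment> \<open>For norms at least 2, raising the exponent from 2 to 2 + m gains a factor
    2^(-m), which pushes the bound B below 1.\<close>
  obtain m :: nat where m: "B < 2 ^ m" using real_arch_pow[of 2 B] by auto
  define s :: complex where "s = of_real (2 + real m)"
  have s: "Re s > 1" by (simp add: s_def)
  have term_U: "hecke_char k \<alpha> * npow (enorm \<alpha>) s = 1" if "\<alpha> \<in> U" for \<alpha>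
    using that hecke_char_unit[of \<alpha> k] enorm_1_iff[of \<alpha>] by (auto simp: U_def Eis_nonzero_def)
  have "hecke_zeta k s = infsum (\<lambda>\<alpha>. hecke_char k \<alpha> * npow (enorm \<alpha>) s) (U \<union> (Eis_nonzero - U))"
    unfolding hecke_zeta_def by (rule arg_cong[of _ _ "infsum _"]) (auto simp: U_def)
  also have "\<dots> = infsum (\<lambda>\<alpha>. hecke_char k \<alpha> * npow (enorm \<alpha>) s) U + infsum (\<lambda>\<alpha>. hecke_char k \<alpha> * npow (enorm \<alpha>) s) (Eis_nonzero - U)"
    by (rule infsum_Un_disjoint) (auto intro!: summable_on_subset_banach[OF hecke_zeta_summable[OF s, of k]] simp: U_def)
  also have "infsum (\<lambda>\<alpha>. hecke_char k \<alpha> * npow (enorm \<alpha>) s) U = of_nat (card U)"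
    using fU term_U by simp
  finally have Zs: "hecke_zeta k s = of_nat (card U) + infsum (\<lambda>\<alpha>. hecke_char k \<alpha> * npow (enorm \<alpha>) s) (Eis_nonzero - U)" .
  have le: "norm (hecke_char k \<alpha> * npow (enorm \<alpha>) s) \<le> real (enorm \<alpha>) powr (- 2) * (1 / 2 ^ m)" if a: "\<alpha> \<in> Eis_nonzero - U" for \<alpha>
  proof -
    have e: "enorm \<alpha> \<ge> 2" using a Eis_nonzero_D(3)[of \<alpha>] by (cases "enorm \<alpha> = 1") (auto simp: U_def)
    have "norm (hecke_char k \<alpha> * npow (enorm \<alpha>) s) = real (enorm \<alpha>) powr (- 2 + (- real m))"
      using a e by (simp add: norm_mult norm_hecke_char Eis_nonzero_D norm_npow s_def)
    also have "\<dots> = real (enorm \<alpha>) powr (- 2) * real (enorm \<alpha>) powr (- real m)" by (rule powr_add)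
    also have "\<dots> \<le> real (enorm \<alpha>) powr (- 2) * 2 powr (- real m)"
      using e by (intro mult_left_mono powr_mono2') auto
    also have "(2::real) powr (- real m) = 1 / 2 ^ m" by (simp add: powr_minus powr_realpow divide_inverse)
    finally show ?thesis .
  qed
  have S2': "(\<lambda>\<alpha>. real (enorm \<alpha>) powr (- 2) * (1 / 2 ^ m)) summable_on Eis_nonzero - U"
    by (rule summable_on_cmult_left[OF S2])
  have "norm (infsum (\<lambda>\<alpha>. hecke_char k \<alpha> * npow (enorm \<alpha>) s) (Eis_nonzero - U)) \<le> infsum (\<lambda>\<alpha>. real (enorm \<alpha>) powr (- 2) * (1 / 2 ^ m)) (Eis_nonzero - U)"
    by (rule norm_infsum_le[OF has_sum_infsum has_sum_infsum[OF S2'] le])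
       (auto intro!: summable_on_subset_banach[OF hecke_zeta_summable[OF s, of k]])
  also have "\<dots> = B * (1 / 2 ^ m)" unfolding B_def by (rule infsum_cmult_left')
  also have "\<dots> < 1" using m by simp
  finally have small: "norm (infsum (\<lambda>\<alpha>. hecke_char k \<alpha> * npow (enorm \<alpha>) s) (Eis_nonzero - U)) < 1" .
  have "1 \<in> U" by (auto simp: U_def Eis_nonzero_def enorm_def)
  hence "card U \<ge> 1" using fU by (metis One_nat_def Suc_leI card_gt_0_iff empty_iff)
  hence "norm (of_nat (card U) :: complex) \<ge> 1" by simp
  hence "hecke_zeta k s \<noteq> 0" using small unfolding Zs by (metis add_eq_0_iff norm_minus_cancel not_le)
  thus ?thesis using s by blast
qed

text \<open>The equation $Z' = - Z P$, with $P$ the von Mangoldt series, has an integrating factor, so one zero would force $Z = 0$ everywhere.\<close>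
lemma hecke_zeta_nonzero:
  assumes s: "Re s > 1" shows "hecke_zeta k s \<noteq> 0"
proof
  assume Z0: "hecke_zeta k s = 0"
  have cv: "convex {s. Re s > 1}" by (rule convex_halfspace_Re_gt)
  obtain Q where Q: "\<And>x. x \<in> {s. Re s > 1} \<Longrightarrow> (Q has_field_derivative mangoldt_series k {1..} x) (at x within {s. Re s > 1})"
    using holomorphic_convex_primitive'[OF cv open_halfspace_Re_gt mangoldt_series_1_holomorphic] by metis
  have "\<exists>c. \<forall>x\<in>{s. Re s > 1}. hecke_zeta k x * exp (Q x) = c"
  proof (rule has_field_derivative_zero_constant[OF cv])
    fix x assume x: "x \<in> {s. Re s > 1}"
    have "((\<lambda>x. hecke_zeta k x * exp (Q x)) has_field_derivative
       (- (hecke_zeta k x * mangoldt_series k {1..} x) * exp (Q x) + exp (Q x) * mangoldt_series k {1..} x * hecke_zeta k x)) (at x within {s. Re s > 1})"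
      using x by (intro DERIV_mult has_field_derivative_at_within[OF hecke_zeta_deriv] DERIV_chain2[OF DERIV_exp] Q) auto
    thus "((\<lambda>x. hecke_zeta k x * exp (Q x)) has_field_derivative 0) (at x within {s. Re s > 1})" by (simp add: mult_ac)
  qed
  then obtain c where c: "\<And>x. Re x > 1 \<Longrightarrow> hecke_zeta k x * exp (Q x) = c" by auto
  have "c = 0" using c[OF s] Z0 by simp
  hence "hecke_zeta k x = 0" if "Re x > 1" for x using c[OF that] by simp
  thus False using hecke_zeta_not_identically_0 by blast
qed

lemma power_powr:
  fixes x :: real assumes "x > 0" shows "(x ^ n) powr a = x powr (real n * a)"
  using assms by (simp add: powr_powr flip: powr_realpow)

text \<open>Writing the exponent as i + 2, the term splits into ln N(\<pi>) N(\<pi>)^(-2p), summable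
  since 2 p > 1, and a power N(\<pi>)^(-p i), at most a geometric term with ratio 2^(-p) because
  norms of primes are at least 2.\<close>

lemma mangoldt_series_2_conv:
  assumes p: "p > 1 / 2"
  shows "(\<lambda>x. norm (of_real (log_prime_norm x) * hecke_char k (prime_power_value x)) * real (enorm (prime_power_value x)) powr (- p)) summable_on prime_power_index {2..}"
proof -
  define f where "f = (\<lambda>\<pi>. ln (real (enorm \<pi>)) * real (enorm \<pi>) powr (- (2 * p)))"
  define g where "g = (\<lambda>i::nat. (2 powr (- p)) ^ i)"
  have fs: "f summable_on sector_primes" unfolding f_def
    by (rule summable_on_subset_banach[OF ln_summable]) (use p in \<open>auto simp: Eis_nonzero_def dest: sector_primesD(1,2)\<close>)
  have q: "(2::real) powr (- p) < 1" using p powr_less_mono[of "- p" 0 "2::real"] by simp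
  have "summable g" unfolding g_def using q by (intro summable_geometric) simp
  hence gs: "g summable_on UNIV" by (subst summable_on_UNIV_nonneg_real_iff) (auto simp: g_def)
  have S: "(\<lambda>(\<pi>, i). f \<pi> * g i) summable_on sector_primes \<times> UNIV"
    using fs gs sector_primes_enorm_ge by (intro summable_on_Times_mult) (force simp: f_def g_def)+
  have le: "norm (of_real (log_prime_norm (\<pi>, i + 2)) * hecke_char k (prime_power_value (\<pi>, i + 2))) * real (enorm (prime_power_value (\<pi>, i + 2))) powr (- p) \<le> f \<pi> * g i"
    if pi: "\<pi> \<in> sector_primes" for \<pi> i
  proof -
    have e: "enorm \<pi> \<ge> 2" by (rule sector_primes_enorm_ge[OF pi])
    have en: "enorm (\<pi> ^ n) = enorm \<pi> ^ n" for n
      by (induction n) (use sector_primesD(1)[OF pi] in \<open>auto simp: enorm_mult\<close>, simp add: enorm_def)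
    have "norm (of_real (log_prime_norm (\<pi>, i + 2)) * hecke_char k (prime_power_value (\<pi>, i + 2))) = ln (real (enorm \<pi>))"
      using e sector_primesD(2)[OF pi] by (simp add: norm_mult norm_hecke_char log_prime_norm_def prime_power_value_def)
    moreover have "real (enorm (prime_power_value (\<pi>, i + 2))) powr (- p) = real (enorm \<pi>) powr (- (2 * p)) * (real (enorm \<pi>) powr (- p)) ^ i"
    proof -
      have x: "real (enorm \<pi>) > 0" using e by simp
      have "real (enorm (prime_power_value (\<pi>, i + 2))) = real (enorm \<pi>) ^ (i + 2)"
        by (simp only: prime_power_value_def fst_conv snd_conv en of_nat_power)
      hence "real (enorm (prime_power_value (\<pi>, i + 2))) powr (- p) = real (enorm \<pi>) powr (real (i + 2) * (- p))"
        by (simp only: power_powr[OF x])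
      also have "real (i + 2) * (- p) = - (2 * p) + real i * (- p)" by (simp add: algebra_simps)
      also have "real (enorm \<pi>) powr (- (2 * p) + real i * (- p)) = real (enorm \<pi>) powr (- (2 * p)) * real (enorm \<pi>) powr (real i * (- p))"
        by (rule powr_add)
      also have "real (enorm \<pi>) powr (real i * (- p)) = (real (enorm \<pi>) powr (- p)) ^ i"
        using x by (simp add: powr_powr mult.commute flip: powr_realpow)
      finally show ?thesis .
    qed
    moreover have "(real (enorm \<pi>) powr (- p)) ^ i \<le> g i"
      unfolding g_def using e p by (intro power_mono powr_mono2') auto
    ultimately show ?thesis unfolding f_def using e by (simp add: mult_left_mono mult.assoc)
  qed
  have "(\<lambda>y. case y of (\<pi>, i) \<Rightarrow> norm (of_real (log_prime_norm (\<pi>, i + 2)) * hecke_char k (prime_power_value (\<pi>, i + 2))) * real (enorm (prime_power_value (\<pi>, i + 2))) powr (- p)) summable_on sector_primes \<times> UNIV"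
  proof (rule summable_on_comparison_test[OF S])
    fix y :: "complex \<times> nat" assume y: "y \<in> sector_primes \<times> UNIV"
    obtain \<pi> i where yi: "y = (\<pi>, i)" by (cases y)
    show "(case y of (\<pi>, i) \<Rightarrow> norm (of_real (log_prime_norm (\<pi>, i + 2)) * hecke_char k (prime_power_value (\<pi>, i + 2))) * real (enorm (prime_power_value (\<pi>, i + 2))) powr (- p)) \<le> (case y of (\<pi>, i) \<Rightarrow> f \<pi> * g i)"
      unfolding yi prod.case by (rule le) (use y yi in simp)
    show "0 \<le> (case y of (\<pi>, i) \<Rightarrow> norm (of_real (log_prime_norm (\<pi>, i + 2)) * hecke_char k (prime_power_value (\<pi>, i + 2))) * real (enorm (prime_power_value (\<pi>, i + 2))) powr (- p))"
      unfolding yi prod.case by simp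
  qed
  moreover have "bij_betw (\<lambda>(\<pi>, i). (\<pi>, i + 2)) (sector_primes \<times> UNIV) (prime_power_index {2..})"
    unfolding prime_power_index_def by (rule bij_betw_byWitness[of _ "\<lambda>(\<pi>, i). (\<pi>, i - 2)"]) auto
  ultimately show ?thesis
    using summable_on_reindex_bij_betw[of "\<lambda>(\<pi>, i). (\<pi>, i + 2)" "sector_primes \<times> UNIV" "prime_power_index {2..}"
        "\<lambda>x. norm (of_real (log_prime_norm x) * hecke_char k (prime_power_value x)) * real (enorm (prime_power_value x)) powr (- p)"]
    by (simp add: case_prod_unfold)
qed

lemma mangoldt_series_2_holomorphic: "mangoldt_series k {2..} holomorphic_on {s. Re s > 1 / 2}"
  unfolding mangoldt_series_def[abs_def] by (rule dirichlet_holomorphic[OF prime_power_index_enorm mangoldt_series_2_conv])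

lemma mangoldt_series_split:
  assumes s: "Re s > 1"
  shows "mangoldt_series k {1..} s = mangoldt_series k {1} s + mangoldt_series k {2..} s"
proof -
  have "prime_power_index {1..} = prime_power_index {1} \<union> prime_power_index {2..}" by (auto simp: prime_power_index_def)
  moreover have "infsum (\<lambda>x. of_real (log_prime_norm x) * hecke_char k (prime_power_value x) * npow (enorm (prime_power_value x)) s) (prime_power_index {1} \<union> prime_power_index {2..}) = mangoldt_series k {1} s + mangoldt_series k {2..} s"
    unfolding mangoldt_series_def
    by (rule infsum_Un_disjoint) (auto intro!: summable_on_subset_banach[OF mangoldt_series_1_summable[OF s, of k]] simp: prime_power_index_def)
  ultimately show ?thesis by (simp add: mangoldt_series_def)
qed

subsection \<open>Non-vanishing on the line $\mathrm{Re}\,s = 1$\<close>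

text \<open>The number n is the order of the zero at s0, read off from the logarithmic derivative
  along a horizontal approach from the right.\<close>

lemma log_deriv_limit:
  assumes S: "open S" "s0 \<in> S" and f: "f holomorphic_on S"
    and nz: "\<And>e::real. e > 0 \<Longrightarrow> f (s0 + of_real e) \<noteq> 0"
  shows "\<exists>n::nat. ((\<lambda>e. of_real e * (deriv f (s0 + of_real e) / f (s0 + of_real e))) \<longlongrightarrow> of_nat n) (at_right 0)
     \<and> (f s0 = 0 \<longrightarrow> n \<ge> 1)"
proof -
  have e0: "((\<lambda>e::real. of_real e :: complex) \<longlongrightarrow> 0) (at_right 0)"
    by (rule tendsto_eq_intros refl tendsto_ident_at)+ simp
  have lim: "((\<lambda>e. of_real e * h (s0 + of_real e)) \<longlongrightarrow> 0) (at_right (0::real))" if "isCont h s0" for h :: "complex \<Rightarrow> complex"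
  proof -
    have "((\<lambda>e. s0 + of_real e) \<longlongrightarrow> s0) (at_right (0::real))" using tendsto_add[OF tendsto_const[of s0] e0] by simp
    hence "((\<lambda>e. h (s0 + of_real e)) \<longlongrightarrow> h s0) (at_right (0::real))" by (rule isCont_tendsto_compose[OF that])
    from tendsto_mult[OF e0 this] show ?thesis by simp
  qed
  have cont: "isCont h s0" if "h holomorphic_on T" "open T" "s0 \<in> T" for h T
    using that by (meson continuous_on_eq_continuous_at holomorphic_on_imp_continuous_on)
  show ?thesis
  proof (cases "f s0 = 0")
    case False
    have "isCont (\<lambda>s. deriv f s / f s) s0"
      using cont[OF f S] cont[OF holomorphic_deriv[OF f S(1)] S] False by (intro continuous_divide) auto
    from lim[OF this] show ?thesis using False by (intro exI[of _ 0]) simp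
  next
    case True
    obtain r0 where r0: "r0 > 0" "ball s0 r0 \<subseteq> S" using S open_contains_ball by blast
    \<comment> \<open>Excludes a zero of infinite order, because f does not vanish to the right of
      s0.\<close>
    have "\<not> f constant_on ball s0 r0"
    proof
      assume "f constant_on ball s0 r0"
      moreover have "s0 \<in> ball s0 r0" "s0 + of_real (r0 / 2) \<in> ball s0 r0" using r0(1) by (auto simp: dist_norm norm_divide)
      ultimately have "f (s0 + of_real (r0 / 2)) = f s0" unfolding constant_on_def by metis
      thus False using nz[of "r0 / 2"] r0(1) True by simp
    qed
    then obtain g r n where g: "0 < n" "0 < r" "ball s0 r \<subseteq> ball s0 r0" "g holomorphic_on ball s0 r"
      "\<And>w. w \<in> ball s0 r \<Longrightarrow> f w = (w - s0)^n * g w" "\<And>w. w \<in> ball s0 r \<Longrightarrow> g w \<noteq> 0"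
      using holomorphic_factor_zero_nonconstant[OF holomorphic_on_subset[OF f r0(2)] open_ball connected_ball _ True] r0(1)
      by (metis centre_in_ball)
    have eq: "of_real e * (deriv f (s0 + of_real e) / f (s0 + of_real e)) = of_nat n + of_real e * (deriv g (s0 + of_real e) / g (s0 + of_real e))"
      if e: "0 < e" "e < r" for e :: real
    proof -
      define w where "w = s0 + of_real e"
      have w: "w \<in> ball s0 r" using e by (simp add: w_def dist_norm)
      have "((\<lambda>w. (w - s0)^n * g w) has_field_derivative (of_nat n * (w - s0)^(n - 1) * g w + (w - s0)^n * deriv g w)) (at w)"
        using holomorphic_derivI[OF g(4) open_ball w] by (auto intro!: derivative_eq_intros simp: mult_ac)
      hence "(f has_field_derivative (of_nat n * (w - s0)^(n - 1) * g w + (w - s0)^n * deriv g w)) (at w)"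
        by (rule has_field_derivative_transform_within_open[OF _ open_ball w]) (simp add: g(5))
      hence d: "deriv f w = of_nat n * (w - s0)^(n - 1) * g w + (w - s0)^n * deriv g w" by (rule DERIV_imp_deriv)
      have ws: "w - s0 = of_real e" by (simp add: w_def)
      obtain m where m: "n = Suc m" using g(1) by (cases n) auto
      have "of_real e * (deriv f w / f w) = of_nat n + of_real e * (deriv g w / g w)"
        unfolding d g(5)[OF w] ws m using e g(6)[OF w] by (simp add: field_simps)
      thus ?thesis by (simp add: w_def)
    qed
    have "isCont (\<lambda>s. deriv g s / g s) s0"
      using cont[OF g(4) open_ball] cont[OF holomorphic_deriv[OF g(4) open_ball] open_ball] g(2) g(6)[of s0]
      by (intro continuous_divide) auto
    from tendsto_add[OF tendsto_const[of "of_nat n"] lim[OF this]]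
    have "((\<lambda>e. of_nat n + of_real e * (deriv g (s0 + of_real e) / g (s0 + of_real e))) \<longlongrightarrow> of_nat n) (at_right (0::real))"
      by simp
    hence "((\<lambda>e. of_real e * (deriv f (s0 + of_real e) / f (s0 + of_real e))) \<longlongrightarrow> of_nat n) (at_right (0::real))"
    proof (rule Lim_transform_eventually)
      show "eventually (\<lambda>e. of_nat n + of_real e * (deriv g (s0 + of_real e) / g (s0 + of_real e)) =
          of_real e * (deriv f (s0 + of_real e) / f (s0 + of_real e))) (at_right (0::real))"
        using eventually_at_right_less[of 0] eventually_at_right[of 0 r "\<lambda>e. e < r"] g(2) eq
        by (auto simp: eventually_at_right[OF g(2)])
    qed
    thus ?thesis using g(1) by (intro exI[of _ n]) simp
  qed
qed

lemma pole_factor_nonzero: "Re s > 1 \<Longrightarrow> pole_factor k s \<noteq> 0"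
  by (auto simp: pole_factor_def)

lemma hecke_continued_nonzero: "Re s > 1 \<Longrightarrow> hecke_continued k s \<noteq> 0"
  using hecke_continued_Z hecke_zeta_nonzero pole_factor_nonzero by simp

lemma mangoldt_series_W:
  assumes s: "Re s > 1"
  shows "mangoldt_series k {1..} s = (if k = 0 then 1 / (s - 1) else 0) - deriv (hecke_continued k) s / hecke_continued k s"
proof -
  have "((\<lambda>s. pole_factor k s * hecke_zeta k s) has_field_derivative ((if k = 0 then 1 else 0) * hecke_zeta k s + - (hecke_zeta k s * mangoldt_series k {1..} s) * pole_factor k s)) (at s)"
  proof (rule DERIV_mult[OF _ hecke_zeta_deriv[OF s]])
    show "(pole_factor k has_field_derivative (if k = 0 then 1 else 0)) (at s)"
      unfolding pole_factor_def[abs_def] by (cases "k = 0") (auto intro!: derivative_eq_intros)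
  qed
  hence "(hecke_continued k has_field_derivative ((if k = 0 then 1 else 0) * hecke_zeta k s + - (hecke_zeta k s * mangoldt_series k {1..} s) * pole_factor k s)) (at s)"
    by (rule has_field_derivative_transform_within_open[OF _ open_halfspace_Re_gt[of 1]]) (use s hecke_continued_Z in auto)
  hence d: "deriv (hecke_continued k) s = (if k = 0 then 1 else 0) * hecke_zeta k s + - (hecke_zeta k s * mangoldt_series k {1..} s) * pole_factor k s" by (rule DERIV_imp_deriv)
  have alg: "(a * z + - (z * P) * p) / (p * z) = a / p - P" if "z \<noteq> 0" "p \<noteq> 0" for a z P p :: complex
    using that by (simp add: field_simps)
  have "deriv (hecke_continued k) s / hecke_continued k s = (if k = 0 then 1 else 0) / pole_factor k s - mangoldt_series k {1..} s"
    unfolding d hecke_continued_Z[OF s] by (rule alg[OF hecke_zeta_nonzero[OF s] pole_factor_nonzero[OF s]])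
  thus ?thesis by (simp add: pole_factor_def)
qed

text \<open>The von Mangoldt series behaves near 1 + \<i> t like the pole order of Z minus its order
  of vanishing, divided by e. The two contributions are kept apart since
  \<open>hecke_continued\<close> has the pole already removed.\<close>

lemma mangoldt_series_limit:
  "\<exists>n::nat. ((\<lambda>e. of_real e * mangoldt_series k {1..} (1 + \<i> * of_real t + of_real e)) \<longlongrightarrow> (if k = 0 \<and> t = 0 then 1 else 0) - of_nat n) (at_right 0)
     \<and> (hecke_continued k (1 + \<i> * of_real t) = 0 \<longrightarrow> n \<ge> 1)"
proof -
  define s0 where "s0 = 1 + \<i> * of_real t"
  have s0: "s0 \<in> continuation_domain k" using continuation_domain_closed_halfplane[of k] by (auto simp: s0_def)
  obtain n :: nat where n: "((\<lambda>e. of_real e * (deriv (hecke_continued k) (s0 + of_real e) / hecke_continued k (s0 + of_real e))) \<longlongrightarrow> of_nat n) (at_right 0)"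
     "hecke_continued k s0 = 0 \<longrightarrow> n \<ge> 1"
    using log_deriv_limit[OF continuation_domain_open s0 hecke_continued_holomorphic] hecke_continued_nonzero[of "s0 + of_real e" k for e] by (auto simp: s0_def)
  have p: "((\<lambda>e. of_real e * (if k = 0 then 1 / (s0 + of_real e - 1) else 0)) \<longlongrightarrow> (if k = 0 \<and> t = 0 then 1 else 0)) (at_right (0::real))"
  proof (cases "k = 0 \<and> t = 0")
    case True
    have "eventually (\<lambda>e. 1 = of_real e * (if k = 0 then 1 / (s0 + of_real e - 1) else 0)) (at_right (0::real))"
      using eventually_at_right_less[of "0::real"] by eventually_elim (use True in \<open>auto simp: s0_def\<close>)
    from Lim_transform_eventually[OF tendsto_const this] show ?thesis using True by simp
  next
    case False
    have "((\<lambda>e. of_real e * (1 / (s0 + of_real e - 1))) \<longlongrightarrow> of_real 0 * (1 / (s0 + of_real 0 - 1))) (at_right (0::real))" if "t \<noteq> 0"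
      by (intro tendsto_intros tendsto_ident_at) (use that in \<open>auto simp: s0_def\<close>)
    thus ?thesis using False by (cases "k = 0") auto
  qed
  have "((\<lambda>e. of_real e * mangoldt_series k {1..} (s0 + of_real e)) \<longlongrightarrow> (if k = 0 \<and> t = 0 then 1 else 0) - of_nat n) (at_right 0)"
  proof (rule Lim_transform_eventually[OF tendsto_diff[OF p n(1)]])
    show "eventually (\<lambda>e. of_real e * (if k = 0 then 1 / (s0 + of_real e - 1) else 0) - of_real e * (deriv (hecke_continued k) (s0 + of_real e) / hecke_continued k (s0 + of_real e))
       = of_real e * mangoldt_series k {1..} (s0 + of_real e)) (at_right (0::real))"
      using eventually_at_right_less[of "0::real"]
    proof eventually_elim
      case (elim e)
      have "Re (s0 + of_real e) > 1" using elim by (simp add: s0_def)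
      from mangoldt_series_W[OF this, of k] show ?case by (simp only: right_diff_distrib)
    qed
  qed
  thus ?thesis using n(2) unfolding s0_def by blast
qed

text \<open>Termwise, with z the unit complex number formed from the character and N^(- \<i> t),
  this is 3 + 4 cos x + cos 2x = 2 (1 + cos x)^2. Squaring z doubles both k and t.\<close>

lemma three_four_one:
  assumes e: "e > 0"
  shows "0 \<le> 3 * Re (mangoldt_series 0 {1..} (1 + of_real e)) + 4 * Re (mangoldt_series k {1..} (1 + \<i> * of_real t + of_real e))
     + Re (mangoldt_series (2 * k) {1..} (1 + \<i> * of_real (2 * t) + of_real e))"
proof -
  define T where "T = (\<lambda>k s x. of_real (log_prime_norm x) * hecke_char k (prime_power_value x) * npow (enorm (prime_power_value x)) s)"
  have hs: "((\<lambda>x. Re (T k s x)) has_sum Re (mangoldt_series k {1..} s)) (prime_power_index {1..})" if "Re s > 1" for k s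
    unfolding T_def mangoldt_series_def by (intro has_sum_Re has_sum_infsum mangoldt_series_1_summable that)
  have "((\<lambda>x. 3 * Re (T 0 (1 + of_real e) x) + 4 * Re (T k (1 + \<i> * of_real t + of_real e) x) + Re (T (2 * k) (1 + \<i> * of_real (2 * t) + of_real e) x))
     has_sum (3 * Re (mangoldt_series 0 {1..} (1 + of_real e)) + 4 * Re (mangoldt_series k {1..} (1 + \<i> * of_real t + of_real e))
     + Re (mangoldt_series (2 * k) {1..} (1 + \<i> * of_real (2 * t) + of_real e)))) (prime_power_index {1..})"
    by (intro has_sum_add has_sum_cmult_right hs) (use e in auto)
  moreover have "0 \<le> 3 * Re (T 0 (1 + of_real e) x) + 4 * Re (T k (1 + \<i> * of_real t + of_real e) x) + Re (T (2 * k) (1 + \<i> * of_real (2 * t) + of_real e) x)"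
    if x: "x \<in> prime_power_index {1..}" for x
  proof -
    define N where "N = enorm (prime_power_value x)"
    have N: "N > 0" using prime_power_index_enorm[OF x] by (simp add: N_def)
    define z where "z = hecke_char k (prime_power_value x) * npow N (\<i> * of_real t)"
    define c where "c = log_prime_norm x * real N powr (- (1 + e))"
    have c0: "c \<ge> 0" using log_prime_norm_nonneg[OF x] by (simp add: c_def)
    have pe: "npow N (1 + of_real e) = of_real (real N powr (- (1 + e)))"
      using N by (simp add: npow_def powr_def exp_of_real[symmetric] algebra_simps)
    have np: "npow N (1 + u + of_real e) = of_real (real N powr (- (1 + e))) * npow N u" for u
    proof -
      have "1 + u + of_real e = (1 + of_real e) + u" by simp
      thus ?thesis by (simp only: npow_add[of N "1 + of_real e" u] pe)
    qed
    have x0: "prime_power_value x \<noteq> 0" using Eis_nonzero_D(2) prime_power_value_nonzero x by blast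
    have n1: "norm z = 1" using N x0 by (simp add: z_def norm_mult norm_hecke_char norm_npow)
    have z2: "z\<^sup>2 = hecke_char (2 * k) (prime_power_value x) * npow N (\<i> * of_real (2 * t))"
      using hecke_char_add[OF x0, of k k] npow_add[of N "\<i> * of_real t" "\<i> * of_real t"]
      by (simp add: z_def power2_eq_square mult_2[symmetric] mult_ac)
    have T0: "T 0 (1 + of_real e) x = of_real c" unfolding T_def N_def[symmetric] pe by (simp add: c_def)
    have T1: "T k (1 + \<i> * of_real t + of_real e) x = of_real c * z" unfolding T_def N_def[symmetric] np by (simp add: c_def z_def)
    have T2: "T (2 * k) (1 + \<i> * of_real (2 * t) + of_real e) x = of_real c * z\<^sup>2" unfolding T_def N_def[symmetric] np z2 by (simp add: c_def)
    have "(Re z)\<^sup>2 + (Im z)\<^sup>2 = 1" using n1 cmod_power2[of z] by simp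
    hence "Re (z\<^sup>2) = 2 * (Re z)\<^sup>2 - 1" by (simp add: power2_eq_square)
    hence "3 * Re (T 0 (1 + of_real e) x) + 4 * Re (T k (1 + \<i> * of_real t + of_real e) x) + Re (T (2 * k) (1 + \<i> * of_real (2 * t) + of_real e) x)
       = c * (2 * (1 + Re z)\<^sup>2)"
    proof -
      have rc: "Re (of_real c * w) = c * Re w" for w by simp
      show ?thesis unfolding T0 T1 T2 rc Re_complex_of_real \<open>Re (z\<^sup>2) = 2 * (Re z)\<^sup>2 - 1\<close>
        by (simp add: power2_eq_square algebra_simps)
    qed
    thus ?thesis using c0 by simp
  qed
  ultimately show ?thesis by (rule has_sum_nonneg)
qed

text \<open>A zero of order n \<ge> 1 would give 3 (1 - n0) - 4 n - n2 \<ge> 0 in the limit, which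
  is impossible. The last term contributes no pole because (2k, 2t) is again different from (0,
  0).\<close>

lemma hecke_continued_1_nontrivial:
  assumes "\<not> (k = 0 \<and> t = 0)" shows "hecke_continued k (1 + \<i> * of_real t) \<noteq> 0"
proof
  assume W0: "hecke_continued k (1 + \<i> * of_real t) = 0"
  obtain n :: nat where n: "((\<lambda>e. of_real e * mangoldt_series k {1..} (1 + \<i> * of_real t + of_real e)) \<longlongrightarrow> 0 - of_nat n) (at_right 0)" "n \<ge> 1"
    using mangoldt_series_limit[of k t] W0 assms by auto
  obtain n0 :: nat where n0: "((\<lambda>e. of_real e * mangoldt_series 0 {1..} (1 + of_real e)) \<longlongrightarrow> 1 - of_nat n0) (at_right 0)"
    using mangoldt_series_limit[of 0 0] by auto
  obtain n2 :: nat where n2: "((\<lambda>e. of_real e * mangoldt_series (2 * k) {1..} (1 + \<i> * of_real (2 * t) + of_real e)) \<longlongrightarrow> 0 - of_nat n2) (at_right 0)"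
    using mangoldt_series_limit[of "2 * k" "2 * t"] assms by auto
  have "((\<lambda>e. 3 * Re (of_real e * mangoldt_series 0 {1..} (1 + of_real e)) + 4 * Re (of_real e * mangoldt_series k {1..} (1 + \<i> * of_real t + of_real e))
     + Re (of_real e * mangoldt_series (2 * k) {1..} (1 + \<i> * of_real (2 * t) + of_real e))) \<longlongrightarrow> 3 * Re (1 - of_nat n0) + 4 * Re (0 - of_nat n) + Re (0 - of_nat n2)) (at_right 0)"
    by (intro tendsto_intros n n0 n2)
  moreover have "eventually (\<lambda>e. 0 \<le> 3 * Re (of_real e * mangoldt_series 0 {1..} (1 + of_real e)) + 4 * Re (of_real e * mangoldt_series k {1..} (1 + \<i> * of_real t + of_real e))
     + Re (of_real e * mangoldt_series (2 * k) {1..} (1 + \<i> * of_real (2 * t) + of_real e))) (at_right 0)"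
    using eventually_at_right_less[of "0::real"]
  proof eventually_elim
    case (elim e)
    have "0 \<le> e * (3 * Re (mangoldt_series 0 {1..} (1 + of_real e)) + 4 * Re (mangoldt_series k {1..} (1 + \<i> * of_real t + of_real e))
     + Re (mangoldt_series (2 * k) {1..} (1 + \<i> * of_real (2 * t) + of_real e)))"
      by (rule mult_nonneg_nonneg[OF _ three_four_one[OF elim]]) (use elim in simp)
    thus ?case by (simp add: algebra_simps)
  qed
  ultimately have "0 \<le> 3 * Re (1 - of_nat n0) + 4 * Re (0 - of_nat n) + Re (0 - of_nat n2)"
    by (intro tendsto_lowerbound) auto
  thus False using n(2) by simp
qed

text \<open>A triangle of lattice points suffices: its row with first coordinate m has m points of
  norm at most 3 m^2, so the rows dominate a harmonic series.\<close>

lemma enorm_inverse_not_summable: "\<not> (\<lambda>\<alpha>. real (enorm \<alpha>) powr (- 1)) summable_on Eis_nonzero"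
proof
  assume S: "(\<lambda>\<alpha>. real (enorm \<alpha>) powr (- 1)) summable_on Eis_nonzero"
  \<comment> \<open>The shift by \<open>Suc\<close> in \<open>h\<close> makes the first coordinate
    positive and gives row a exactly a + 1 points.\<close>
  define I where "I = Sigma UNIV (\<lambda>a::nat. {..a})"
  define h where "h = (\<lambda>(a::nat, b::nat). of_nat (Suc a) + of_nat b * omega)"
  have inj: "inj_on h I" by (auto simp: inj_on_def h_def complex_eq_iff)
  have hE: "h x \<in> Eis_nonzero" for x
  proof -
    obtain a b where x: "x = (a, b)" by (cases x)
    have "h x \<in> Eis" using EisI[of "int (Suc a)" "int b"] by (simp add: h_def x)
    moreover have "h x \<noteq> 0"
    proof
      assume "h x = 0"
      hence "Re (h x) = 0" by simp
      thus False by (simp add: h_def x)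
    qed
    ultimately show ?thesis by (simp add: Eis_nonzero_def)
  qed
  have "(\<lambda>\<alpha>. real (enorm \<alpha>) powr (- 1)) summable_on h ` I" by (rule summable_on_subset_banach[OF S]) (use hE in auto)
  hence S1: "(\<lambda>x. real (enorm (h x)) powr (- 1)) summable_on I" unfolding summable_on_reindex[OF inj] by (simp add: o_def)
  have "(\<lambda>(a, b). 1 / (3 * (real (Suc a))\<^sup>2)) summable_on I"
  proof (rule summable_on_comparison_test[OF S1])
    fix x assume x: "x \<in> I"
    obtain a b where ab: "x = (a, b)" "b \<le> a" using x by (auto simp: I_def)
    define A B where "A = real (Suc a)" and "B = real b"
    have AB: "0 \<le> B" "B \<le> A" "A > 0" using ab(2) by (auto simp: A_def B_def)
    have "real (enorm (h x)) = A\<^sup>2 + A * B + B\<^sup>2"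
      using real_enorm[OF Eis_nonzero_D(1)[OF hE[of x]]] cmod_sq_lin[of A B] by (simp add: h_def ab A_def B_def)
    also have "\<dots> \<le> A\<^sup>2 + A\<^sup>2 + A\<^sup>2" using AB by (intro add_mono) (auto simp: power2_eq_square intro: mult_mono)
    finally have "real (enorm (h x)) \<le> 3 * A\<^sup>2" by simp
    moreover have "real (enorm (h x)) > 0" using Eis_nonzero_D(3)[OF hE[of x]] by simp
    ultimately have "1 / (3 * A\<^sup>2) \<le> 1 / real (enorm (h x))" using AB(3) by (intro divide_left_mono) auto
    moreover have "(case x of (a, b) \<Rightarrow> 1 / (3 * (real (Suc a))\<^sup>2)) = 1 / (3 * A\<^sup>2)"
      by (simp only: ab(1) prod.case A_def)
    moreover have "real (enorm (h x)) powr (- 1) = 1 / real (enorm (h x))"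
      using \<open>real (enorm (h x)) > 0\<close> by (simp add: powr_minus_divide)
    ultimately show "(case x of (a, b) \<Rightarrow> 1 / (3 * (real (Suc a))\<^sup>2)) \<le> real (enorm (h x)) powr (- 1)"
      by (simp only:)
  qed auto
  hence "(\<lambda>a. infsum (\<lambda>b. 1 / (3 * (real (Suc a))\<^sup>2)) {..a}) summable_on UNIV"
    unfolding I_def by (rule summable_on_Sigma_banach)
  moreover have "infsum (\<lambda>b. 1 / (3 * (real (Suc a))\<^sup>2)) {..a} = 1 / 3 * real (Suc a) powr (- 1)" for a
  proof -
    have "infsum (\<lambda>b. 1 / (3 * (real (Suc a))\<^sup>2)) {..a} = real (Suc a) * (1 / (3 * (real (Suc a))\<^sup>2))" by simp
    also have "\<dots> = 1 / 3 * real (Suc a) powr (- 1)"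
      by (simp add: powr_minus_divide power2_eq_square del: of_nat_Suc)
    finally show ?thesis .
  qed
  ultimately have "(\<lambda>a. 1 / 3 * real (Suc a) powr (- 1)) summable_on UNIV" by simp
  hence "summable (\<lambda>a. 1 / 3 * real (Suc a) powr (- 1))" by (rule summable_on_imp_summable)
  hence "(1 / 3 :: real) = 0 \<or> summable (\<lambda>a. real (Suc a) powr (- 1))" by (simp only: summable_cmult_iff)
  hence "summable (\<lambda>a. real (Suc a) powr (- 1))" by (elim disjE) (simp, assumption)
  hence "summable (\<lambda>a. real a powr (- 1))" by (subst (asm) summable_Suc_iff)
  thus False using summable_real_powr_iff[of "- 1"] by simp
qed

text \<open>The 3-4-1 inequality says nothing here. If the regularised function vanished at 1, Z
  itself would stay bounded as s tends to 1 from the right, and so would all finite sums of 1 /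
  N(\<alpha>).\<close>

lemma hecke_continued_1_trivial: "hecke_continued 0 1 \<noteq> 0"
proof
  assume W0: "hecke_continued 0 1 = 0"
  have D1: "1 \<in> continuation_domain 0" using continuation_domain_closed_halfplane[of 0] by auto
  have "(hecke_continued 0 has_field_derivative deriv (hecke_continued 0) 1) (at 1)" by (rule holomorphic_derivI[OF hecke_continued_holomorphic continuation_domain_open D1])
  hence "((\<lambda>h. (hecke_continued 0 (1 + h) - hecke_continued 0 1) / h) \<longlongrightarrow> deriv (hecke_continued 0) 1) (at 0)" unfolding DERIV_def .
  hence q: "((\<lambda>h. hecke_continued 0 (1 + h) / h) \<longlongrightarrow> deriv (hecke_continued 0) 1) (at 0)" using W0 by simp
  have fl: "filterlim (\<lambda>e::real. of_real e :: complex) (at 0) (at_right 0)"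
    unfolding filterlim_at
  proof
    show "eventually (\<lambda>e::real. (of_real e :: complex) \<in> UNIV \<and> of_real e \<noteq> 0) (at_right 0)"
      using eventually_at_right_less[of "0::real"] by eventually_elim simp
    show "((\<lambda>e::real. of_real e :: complex) \<longlongrightarrow> 0) (at_right 0)"
      by (rule tendsto_eq_intros refl tendsto_ident_at)+ simp
  qed
  have "((\<lambda>e. hecke_continued 0 (1 + of_real e) / of_real e) \<longlongrightarrow> deriv (hecke_continued 0) 1) (at_right (0::real))"
    by (rule filterlim_compose[OF q fl])
  hence "((\<lambda>e. hecke_zeta 0 (1 + of_real e)) \<longlongrightarrow> deriv (hecke_continued 0) 1) (at_right (0::real))"
  proof (rule Lim_transform_eventually)
    show "eventually (\<lambda>e. hecke_continued 0 (1 + of_real e) / of_real e = hecke_zeta 0 (1 + of_real e)) (at_right (0::real))"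
      using eventually_at_right_less[of "0::real"] by eventually_elim (simp add: hecke_continued_Z pole_factor_def)
  qed
  hence ReZ: "((\<lambda>e. Re (hecke_zeta 0 (1 + of_real e))) \<longlongrightarrow> Re (deriv (hecke_continued 0) 1)) (at_right (0::real))" by (rule tendsto_Re)
  have fin: "(\<Sum>\<alpha>\<in>F. real (enorm \<alpha>) powr (- 1)) \<le> Re (deriv (hecke_continued 0) 1)" if F: "finite F" "F \<subseteq> Eis_nonzero" for F
  proof (rule tendsto_le[OF _ ReZ])
    have "((\<lambda>e. \<Sum>\<alpha>\<in>F. real (enorm \<alpha>) powr (- (1 + e))) \<longlongrightarrow> (\<Sum>\<alpha>\<in>F. real (enorm \<alpha>) powr (- (1 + 0)))) (at_right (0::real))"
      by (intro tendsto_intros tendsto_ident_at) (use F Eis_nonzero_D(3) in fastforce)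
    thus "((\<lambda>e. \<Sum>\<alpha>\<in>F. real (enorm \<alpha>) powr (- (1 + e))) \<longlongrightarrow> (\<Sum>\<alpha>\<in>F. real (enorm \<alpha>) powr (- 1))) (at_right (0::real))" by simp
    show "eventually (\<lambda>e. (\<Sum>\<alpha>\<in>F. real (enorm \<alpha>) powr (- (1 + e))) \<le> Re (hecke_zeta 0 (1 + of_real e))) (at_right (0::real))"
      using eventually_at_right_less[of "0::real"]
    proof eventually_elim
      case (elim e)
      have s: "Re (1 + of_real e) > 1" using elim by simp
      have re: "Re (hecke_char 0 \<alpha> * npow (enorm \<alpha>) (1 + of_real e)) = real (enorm \<alpha>) powr (- (1 + e))" if "\<alpha> \<in> Eis_nonzero" for \<alpha>
        using Eis_nonzero_D(3)[OF that] by (simp add: npow_def powr_def Re_exp)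
      have "((\<lambda>\<alpha>. Re (hecke_char 0 \<alpha> * npow (enorm \<alpha>) (1 + of_real e))) has_sum Re (hecke_zeta 0 (1 + of_real e))) Eis_nonzero"
        unfolding hecke_zeta_def by (intro has_sum_Re has_sum_infsum hecke_zeta_summable s)
      hence "((\<lambda>\<alpha>. real (enorm \<alpha>) powr (- (1 + e))) has_sum Re (hecke_zeta 0 (1 + of_real e))) Eis_nonzero"
        by (rule has_sum_cong[THEN iffD1, rotated]) (rule re)
      thus ?case by (rule finite_sum_le_has_sum) (use F in auto)
    qed
  qed simp
  have "(\<lambda>\<alpha>. real (enorm \<alpha>) powr (- 1)) summable_on Eis_nonzero"
  proof (rule nonneg_bdd_above_summable_on)
    show "bdd_above (sum (\<lambda>\<alpha>. real (enorm \<alpha>) powr (- 1)) ` {F. F \<subseteq> Eis_nonzero \<and> finite F})"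
      by (rule bdd_aboveI2) (use fin in auto)
  qed simp
  thus False using enorm_inverse_not_summable by simp
qed

lemma hecke_continued_nonzero_closed:
  assumes "Re s \<ge> 1" shows "hecke_continued k s \<noteq> 0"
proof (cases "Re s > 1")
  case False
  hence s: "s = 1 + \<i> * of_real (Im s)" using assms by (simp add: complex_eq_iff)
  show ?thesis
  proof (cases "k = 0 \<and> Im s = 0")
    case True
    hence "s = 1" using s by simp
    thus ?thesis using hecke_continued_1_trivial True by simp
  next
    case False
    thus ?thesis using hecke_continued_1_nontrivial[of k "Im s"] s by metis
  qed
qed (rule hecke_continued_nonzero)

section \<open>Equidistribution\<close>

text \<open>What remains of the prime series after its possible pole at 1 is split off. Discarding
  higher prime powers costs only a function holomorphic for Re s > 1/2.\<close>

definition log_deriv_regular :: "int \<Rightarrow> complex \<Rightarrow> complex" where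
  "log_deriv_regular k s = - (deriv (hecke_continued k) s / hecke_continued k s) - mangoldt_series k {2..} s"

definition nonvanishing_domain :: "int \<Rightarrow> complex set" where
  "nonvanishing_domain k = {s \<in> continuation_domain k. hecke_continued k s \<noteq> 0}"

lemma nonvanishing_domain_open: "open (nonvanishing_domain k)"
proof -
  have "continuous_on (continuation_domain k) (hecke_continued k)" by (rule holomorphic_on_imp_continuous_on[OF hecke_continued_holomorphic])
  hence "open (continuation_domain k \<inter> hecke_continued k -` (- {0}))" using continuation_domain_open by (simp add: continuous_on_open_vimage[OF continuation_domain_open] Int_commute open_Compl)
  moreover have "nonvanishing_domain k = continuation_domain k \<inter> hecke_continued k -` (- {0})" by (auto simp: nonvanishing_domain_def)
  ultimately show ?thesis by simp
qed

lemma nonvanishing_domain_closed_halfplane: "{s. Re s \<ge> 1} \<subseteq> nonvanishing_domain k"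
  using continuation_domain_closed_halfplane[of k] hecke_continued_nonzero_closed by (auto simp: nonvanishing_domain_def)

lemma log_deriv_regular_holomorphic: "log_deriv_regular k holomorphic_on nonvanishing_domain k"
proof -
  have hecke_continued: "hecke_continued k holomorphic_on nonvanishing_domain k" by (rule holomorphic_on_subset[OF hecke_continued_holomorphic]) (auto simp: nonvanishing_domain_def)
  have P: "mangoldt_series k {2..} holomorphic_on nonvanishing_domain k" by (rule holomorphic_on_subset[OF mangoldt_series_2_holomorphic]) (auto simp: nonvanishing_domain_def continuation_domain_def)
  show ?thesis unfolding log_deriv_regular_def[abs_def]
    by (intro holomorphic_on_diff holomorphic_on_minus holomorphic_on_divide holomorphic_deriv hecke_continued P nonvanishing_domain_open) (auto simp: nonvanishing_domain_def)
qed

lemma mangoldt_series_prime: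
  assumes s: "Re s > 1"
  shows "mangoldt_series k {1} s = (if k = 0 then 1 / (s - 1) else 0) + log_deriv_regular k s"
  using mangoldt_series_W[OF s, of k] mangoldt_series_split[OF s, of k] by (simp add: log_deriv_regular_def algebra_simps)

definition prime_weight :: "complex \<Rightarrow> int \<Rightarrow> complex \<Rightarrow> real" where
  "prime_weight c k \<pi> = 1 + Re (c * hecke_char k \<pi>)"

lemma prime_weight_bounds:
  assumes "norm c \<le> 1" "\<pi> \<in> sector_primes" shows "prime_weight c k \<pi> \<ge> 0" "prime_weight c k \<pi> \<le> 2"
proof -
  have "\<bar>Re (c * hecke_char k \<pi>)\<bar> \<le> norm (c * hecke_char k \<pi>)" by (rule abs_Re_le_cmod)
  also have "\<dots> \<le> 1" using assms sector_primesD(2) by (simp add: norm_mult norm_hecke_char)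
  finally show "prime_weight c k \<pi> \<ge> 0" "prime_weight c k \<pi> \<le> 2" unfolding prime_weight_def by linarith+
qed

lemma mangoldt_series_prime_has_sum:
  assumes s: "Re s > 1"
  shows "((\<lambda>\<pi>. of_real (ln (real (enorm \<pi>))) * hecke_char k \<pi> * npow (enorm \<pi>) s) has_sum mangoldt_series k {1} s) sector_primes"
proof -
  have h: "((\<lambda>x. of_real (log_prime_norm x) * hecke_char k (prime_power_value x) * npow (enorm (prime_power_value x)) s) has_sum mangoldt_series k {1} s) (prime_power_index {1})"
    unfolding mangoldt_series_def
    by (intro has_sum_infsum summable_on_subset_banach[OF mangoldt_series_1_summable[OF s, of k]]) (auto simp: prime_power_index_def)
  have bij: "bij_betw (\<lambda>\<pi>. (\<pi>, 1)) sector_primes (prime_power_index {1})"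
    unfolding prime_power_index_def by (rule bij_betw_byWitness[of _ fst]) auto
  have "((\<lambda>\<pi>. of_real (log_prime_norm (\<pi>, 1)) * hecke_char k (prime_power_value (\<pi>, 1)) * npow (enorm (prime_power_value (\<pi>, 1))) s) has_sum mangoldt_series k {1} s) sector_primes"
    by (rule has_sum_reindex_bij_betw[OF bij, THEN iffD2, OF h])
  thus ?thesis by (simp add: log_prime_norm_def prime_power_value_def)
qed

lemma sector_primes_norm_finite: "finite {\<pi> \<in> sector_primes. enorm \<pi> = n}"
  by (rule finite_subset[OF _ sector_primes_bounded_finite[of n]]) auto

text \<open>Condition \<open>ck\<close> keeps the character part free of a pole, so the residue at 1
  is 1 whatever c is. The weights lie between 0 and 2, so that the coefficients are nonnegative and
  Chebyshev's estimate bounds their sums.\<close>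

theorem weighted_prime_sum_limit:
  assumes c: "norm c \<le> 1" and ck: "c = 0 \<or> k \<noteq> 0"
  shows "(\<lambda>n. (\<Sum>\<pi> | \<pi> \<in> sector_primes \<and> enorm \<pi> \<le> n. prime_weight c k \<pi> * ln (real (enorm \<pi>))) / real n) \<longlonglongrightarrow> 1"
proof -
  define u where "u = (\<lambda>\<pi>. prime_weight c k \<pi> * ln (real (enorm \<pi>)))"
  \<comment> \<open>Indexed by the norm minus one, to match the coefficient of (n+1)^(-s) in
    \<open>wiener_ikehara\<close>.\<close>
  define d where "d = (\<lambda>n. \<Sum>\<pi> | \<pi> \<in> sector_primes \<and> enorm \<pi> = Suc n. u \<pi>)"
  have u0: "u \<pi> \<ge> 0" if "\<pi> \<in> sector_primes" for \<pi>
    using prime_weight_bounds(1)[OF c that] sector_primes_enorm_ge[OF that] by (simp add: u_def)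
  have M: "(\<Sum>m<n. d m) = (\<Sum>\<pi> | \<pi> \<in> sector_primes \<and> enorm \<pi> \<le> n. u \<pi>)" for n
  proof (induction n)
    case 0
    have e: "{\<pi>. \<pi> \<in> sector_primes \<and> enorm \<pi> \<le> 0} = {}" using sector_primes_enorm_ge by fastforce
    show ?case unfolding e by simp
  next
    case (Suc n)
    have "{\<pi>. \<pi> \<in> sector_primes \<and> enorm \<pi> \<le> Suc n} = {\<pi>. \<pi> \<in> sector_primes \<and> enorm \<pi> \<le> n} \<union> {\<pi>. \<pi> \<in> sector_primes \<and> enorm \<pi> = Suc n}" by auto
    hence "(\<Sum>\<pi> | \<pi> \<in> sector_primes \<and> enorm \<pi> \<le> Suc n. u \<pi>) = (\<Sum>\<pi> | \<pi> \<in> sector_primes \<and> enorm \<pi> \<le> n. u \<pi>) + d n"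
      unfolding d_def using sector_primes_bounded_finite[of n] sector_primes_norm_finite[of "Suc n"]
      by (simp only:) (subst sum.union_disjoint, auto)
    thus ?case using Suc by simp
  qed
  have "(\<lambda>n. (\<Sum>m<n. d m) / real n) \<longlonglongrightarrow> 1"
  proof (rule wiener_ikehara)
    show "d n \<ge> 0" for n unfolding d_def by (intro sum_nonneg) (use u0 in auto)
    show "(\<Sum>m<n. d m) \<le> 4 * ln 4 * real n" for n
    proof -
      have "(\<Sum>m<n. d m) \<le> (\<Sum>\<pi> | \<pi> \<in> sector_primes \<and> enorm \<pi> \<le> n. 2 * ln (real (enorm \<pi>)))"
        unfolding M u_def using prime_weight_bounds(2)[OF c] sector_primes_enorm_ge
        by (intro sum_mono mult_right_mono) (auto intro!: ln_ge_zero dest!: sector_primes_enorm_ge)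
      also have "\<dots> = 2 * (\<Sum>\<pi> | \<pi> \<in> sector_primes \<and> enorm \<pi> \<le> n. ln (real (enorm \<pi>)))" by (simp add: sum_distrib_left)
      also have "\<dots> \<le> 2 * (2 * ln 4 * real n)" by (intro mult_left_mono chebyshev_sector_primes) simp
      finally show ?thesis by simp
    qed
    show "open (nonvanishing_domain 0 \<inter> nonvanishing_domain k \<inter> nonvanishing_domain (- k))" by (intro open_Int nonvanishing_domain_open)
    show "{s. Re s \<ge> 1} \<subseteq> nonvanishing_domain 0 \<inter> nonvanishing_domain k \<inter> nonvanishing_domain (- k)" using nonvanishing_domain_closed_halfplane by simp
    show "(\<lambda>s. log_deriv_regular 0 s + (c * log_deriv_regular k s + cnj c * log_deriv_regular (- k) s) / 2) holomorphic_on nonvanishing_domain 0 \<inter> nonvanishing_domain k \<inter> nonvanishing_domain (- k)"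
      by (intro holomorphic_intros holomorphic_on_subset[OF log_deriv_regular_holomorphic]) auto
    show "(\<lambda>n. of_real (d n) * npow (Suc n) s) sums (of_real 1 / (s - 1) + (log_deriv_regular 0 s + (c * log_deriv_regular k s + cnj c * log_deriv_regular (- k) s) / 2))"
      if s: "Re s > 1" for s
    proof -
      \<comment> \<open>The real part is written as half the sum with the conjugate, and conjugating
        the character replaces k by - k; this is why the series for - k enters.\<close>
      define A where "A = mangoldt_series 0 {1} s + (c * mangoldt_series k {1} s + cnj c * mangoldt_series (- k) {1} s) * (1 / 2)"
      have Aeq: "A = of_real 1 / (s - 1) + (log_deriv_regular 0 s + (c * log_deriv_regular k s + cnj c * log_deriv_regular (- k) s) / 2)"
        unfolding A_def mangoldt_series_prime[OF s] using ck by auto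
      define L where "L = (\<lambda>\<pi>. of_real (ln (real (enorm \<pi>))) :: complex)"
      have "((\<lambda>\<pi>. L \<pi> * hecke_char 0 \<pi> * npow (enorm \<pi>) s + (c * (L \<pi> * hecke_char k \<pi> * npow (enorm \<pi>) s) + cnj c * (L \<pi> * hecke_char (- k) \<pi> * npow (enorm \<pi>) s)) * (1 / 2)) has_sum A) sector_primes"
        unfolding A_def L_def by (intro has_sum_add has_sum_cmult_right has_sum_cmult_left mangoldt_series_prime_has_sum s)
      moreover have "L \<pi> * hecke_char 0 \<pi> * npow (enorm \<pi>) s + (c * (L \<pi> * hecke_char k \<pi> * npow (enorm \<pi>) s) + cnj c * (L \<pi> * hecke_char (- k) \<pi> * npow (enorm \<pi>) s)) * (1 / 2)
          = of_real (u \<pi>) * npow (enorm \<pi>) s" if p: "\<pi> \<in> sector_primes" for \<pi>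
      proof -
        have "c * hecke_char k \<pi> + cnj c * hecke_char (- k) \<pi> = of_real (2 * Re (c * hecke_char k \<pi>))"
          using complex_add_cnj[of "c * hecke_char k \<pi>"] hecke_char_uminus[OF sector_primesD(2)[OF p], of k] by simp
        hence w: "1 + (c * hecke_char k \<pi> + cnj c * hecke_char (- k) \<pi>) * (1 / 2) = of_real (prime_weight c k \<pi>)" by (simp add: prime_weight_def)
        have "L \<pi> * hecke_char 0 \<pi> * npow (enorm \<pi>) s + (c * (L \<pi> * hecke_char k \<pi> * npow (enorm \<pi>) s) + cnj c * (L \<pi> * hecke_char (- k) \<pi> * npow (enorm \<pi>) s)) * (1 / 2)
          = (1 + (c * hecke_char k \<pi> + cnj c * hecke_char (- k) \<pi>) * (1 / 2)) * L \<pi> * npow (enorm \<pi>) s"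
          by (simp add: algebra_simps)
        thus ?thesis unfolding w by (simp add: u_def L_def)
      qed
      ultimately have hs: "((\<lambda>\<pi>. of_real (u \<pi>) * npow (enorm \<pi>) s) has_sum A) sector_primes"
        using has_sum_cong[of sector_primes] by (metis (no_types, lifting))
      define B where "B = (\<lambda>n. {\<pi>. \<pi> \<in> sector_primes \<and> enorm \<pi> = Suc n})"
      have bij: "bij_betw snd (Sigma UNIV B) sector_primes"
      proof (rule bij_betw_byWitness[of _ "\<lambda>\<pi>. (enorm \<pi> - 1, \<pi>)"])
        show "(\<lambda>\<pi>. (enorm \<pi> - 1, \<pi>)) ` sector_primes \<subseteq> Sigma UNIV B" using sector_primes_enorm_ge by (force simp: B_def)
      qed (auto simp: B_def)
      have "((\<lambda>x. of_real (u (snd x)) * npow (enorm (snd x)) s) has_sum A) (Sigma UNIV B)"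
        by (rule has_sum_reindex_bij_betw[OF bij, THEN iffD2, OF hs])
      hence "((\<lambda>n. of_real (d n) * npow (Suc n) s) has_sum A) UNIV"
      proof (rule has_sum_SigmaD)
        fix n
        have "(\<Sum>\<pi>\<in>B n. of_real (u \<pi>) * npow (enorm \<pi>) s) = (\<Sum>\<pi>\<in>B n. of_real (u \<pi>) * npow (Suc n) s)"
          by (rule sum.cong) (auto simp: B_def)
        also have "\<dots> = of_real (d n) * npow (Suc n) s" by (simp add: d_def B_def sum_distrib_right)
        finally show "((\<lambda>\<pi>. of_real (u (snd (n, \<pi>))) * npow (enorm (snd (n, \<pi>))) s) has_sum of_real (d n) * npow (Suc n) s) (B n)"
          using sector_primes_norm_finite[of "Suc n"] by (intro has_sum_finite_iff[THEN iffD2]) (auto simp: B_def)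
      qed
      thus ?thesis unfolding Aeq by (rule has_sum_imp_sums)
    qed
  qed simp
  thus ?thesis unfolding M u_def .
qed

section \<open>Weyl's criterion on the circle\<close>

definition direction6 :: "complex \<Rightarrow> complex" where "direction6 \<pi> = sgn \<pi> ^ 6"

definition primes_upto :: "nat \<Rightarrow> complex set" where "primes_upto n = {\<pi> \<in> sector_primes. enorm \<pi> \<le> n}"

definition log_norm :: "complex \<Rightarrow> real" where "log_norm \<pi> = ln (real (enorm \<pi>))"

definition circle_mean :: "(complex \<Rightarrow> complex) \<Rightarrow> complex" where
  "circle_mean g = integral {-pi..pi} (\<lambda>t. g (cis t)) / of_real (2 * pi)"

lemma primes_upto_finite: "finite (primes_upto n)" unfolding primes_upto_def by (rule sector_primes_bounded_finite)

lemma log_norm_nonneg: "\<pi> \<in> primes_upto n \<Longrightarrow> log_norm \<pi> \<ge> 0"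
  using sector_primes_enorm_ge by (force simp: primes_upto_def log_norm_def)

lemma norm_direction6: "\<pi> \<in> primes_upto n \<Longrightarrow> norm (direction6 \<pi>) = 1"
  using sector_primesD(2) by (auto simp: primes_upto_def direction6_def norm_power norm_sgn)

lemma hecke_char_direction6: "hecke_char k \<pi> = direction6 \<pi> powi k"
  by (simp add: hecke_char_def direction6_def power_int_mult)

lemma theta_limit: "(\<lambda>n. (\<Sum>\<pi>\<in>primes_upto n. log_norm \<pi>) / real n) \<longlonglongrightarrow> 1"
  using weighted_prime_sum_limit[of 0 0] by (simp add: prime_weight_def primes_upto_def log_norm_def)

text \<open>Subtracting the limit for the unweighted sum isolates Re (c * character); the choices c
  = 1 and c = - \<i> recover the real and the imaginary part.\<close>

lemma char_limit:
  assumes k: "k \<noteq> 0"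
  shows "(\<lambda>n. (\<Sum>\<pi>\<in>primes_upto n. of_real (log_norm \<pi>) * direction6 \<pi> powi k) / of_nat n) \<longlonglongrightarrow> 0"
proof -
  have lim: "(\<lambda>n. (\<Sum>\<pi>\<in>primes_upto n. log_norm \<pi> * Re (c * direction6 \<pi> powi k)) / real n) \<longlonglongrightarrow> 0" if c: "norm c \<le> 1" for c
  proof -
    have "(\<lambda>n. (\<Sum>\<pi>\<in>primes_upto n. prime_weight c k \<pi> * log_norm \<pi>) / real n - (\<Sum>\<pi>\<in>primes_upto n. log_norm \<pi>) / real n) \<longlonglongrightarrow> 1 - 1"
      using weighted_prime_sum_limit[OF c, of k] k by (intro tendsto_diff theta_limit) (simp add: primes_upto_def log_norm_def)
    moreover have "(\<Sum>\<pi>\<in>primes_upto n. (1 + v \<pi>) * log_norm \<pi>) / real n - (\<Sum>\<pi>\<in>primes_upto n. log_norm \<pi>) / real n = (\<Sum>\<pi>\<in>primes_upto n. log_norm \<pi> * v \<pi>) / real n"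
      for v :: "complex \<Rightarrow> real" and n
    proof -
      have "(\<Sum>\<pi>\<in>primes_upto n. (1 + v \<pi>) * log_norm \<pi>) = (\<Sum>\<pi>\<in>primes_upto n. log_norm \<pi>) + (\<Sum>\<pi>\<in>primes_upto n. log_norm \<pi> * v \<pi>)"
        unfolding sum.distrib[symmetric] by (rule sum.cong) (auto simp: algebra_simps)
      thus ?thesis by (simp add: add_divide_distrib)
    qed
    ultimately show ?thesis unfolding prime_weight_def hecke_char_direction6 by (simp only: diff_self)
  qed
  have "(\<lambda>n. Complex ((\<Sum>\<pi>\<in>primes_upto n. log_norm \<pi> * Re (1 * direction6 \<pi> powi k)) / real n) ((\<Sum>\<pi>\<in>primes_upto n. log_norm \<pi> * Re (- \<i> * direction6 \<pi> powi k)) / real n)) \<longlonglongrightarrow> Complex 0 0"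
    by (intro tendsto_Complex lim) auto
  moreover have "Complex ((\<Sum>\<pi>\<in>primes_upto n. log_norm \<pi> * Re (1 * direction6 \<pi> powi k)) / real n) ((\<Sum>\<pi>\<in>primes_upto n. log_norm \<pi> * Re (- \<i> * direction6 \<pi> powi k)) / real n)
      = (\<Sum>\<pi>\<in>primes_upto n. of_real (log_norm \<pi>) * direction6 \<pi> powi k) / of_nat n" for n
    by (simp add: complex_eq_iff Re_divide_of_nat Im_divide_of_nat)
  moreover have "Complex 0 0 = 0" by (simp add: complex_eq_iff)
  ultimately show ?thesis by simp
qed

inductive trig_poly :: "(complex \<Rightarrow> complex) \<Rightarrow> bool" where
  trig_poly_mono: "trig_poly (\<lambda>z. c * z powi k)"
| trig_poly_add: "trig_poly f \<Longrightarrow> trig_poly g \<Longrightarrow> trig_poly (\<lambda>z. f z + g z)"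

lemma cis_integrable: "(\<lambda>t. c * cis t powi k) integrable_on {-pi..pi}"
  by (intro integrable_continuous_real continuous_intros) auto

lemma circle_mean_mono: "circle_mean (\<lambda>z. c * z powi k) = (if k = 0 then c else 0)"
proof (cases "k = 0")
  case True
  thus ?thesis by (simp add: circle_mean_def scaleR_conv_of_real)
next
  case False
  define F where "F = (\<lambda>z. c * exp (\<i> * of_int k * z) / (\<i> * of_int k))"
  have e: "cis (of_int k * t) = exp (\<i> * of_int k * of_real t)" for t
    by (simp add: cis_conv_exp mult_ac)
  have dF: "(F has_field_derivative c * exp (\<i> * of_int k * z)) (at z)" for z
    unfolding F_def using False by (auto intro!: derivative_eq_intros)
  have "((\<lambda>t. c * exp (\<i> * of_int k * of_real t)) has_integral (F (of_real pi) - F (of_real (- pi)))) {-pi..pi}"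
    by (rule fundamental_theorem_of_calculus) (auto intro: has_vector_derivative_real_field[OF dF])
  hence hi: "((\<lambda>t. c * cis (of_int k * t)) has_integral (F (of_real pi) - F (of_real (- pi)))) {-pi..pi}"
    unfolding e .
  have "cis (of_int k * pi) = cis (of_int k * (- pi))"
    by (simp add: complex_eq_iff sin_times_pi_eq_0)
  hence FF: "F (of_real pi) = F (of_real (- pi))" unfolding e F_def by simp
  have "integral {-pi..pi} (\<lambda>t. c * cis (of_int k * t)) = 0"
    unfolding integral_unique[OF hi] FF by (rule diff_self)
  thus ?thesis using False by (simp add: circle_mean_def cis_power_int)
qed

lemma trig_poly_integrable: "trig_poly f \<Longrightarrow> (\<lambda>t. f (cis t)) integrable_on {-pi..pi}"
  by (induction rule: trig_poly.induct) (auto intro: cis_integrable integrable_add)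

lemma trig_poly_limit:
  assumes "trig_poly f"
  shows "(\<lambda>n. (\<Sum>\<pi>\<in>primes_upto n. of_real (log_norm \<pi>) * f (direction6 \<pi>)) / of_nat n) \<longlonglongrightarrow> circle_mean f"
  using assms
proof (induction rule: trig_poly.induct)
  case (trig_poly_mono c k)
  show ?case
  proof (cases "k = 0")
    case True
    have "(\<lambda>n. c * of_real ((\<Sum>\<pi>\<in>primes_upto n. log_norm \<pi>) / real n)) \<longlonglongrightarrow> c * of_real 1"
      by (intro tendsto_intros theta_limit)
    thus ?thesis unfolding circle_mean_mono using True by (simp add: sum_distrib_left sum_distrib_right mult_ac)
  next
    case False
    have "(\<lambda>n. c * ((\<Sum>\<pi>\<in>primes_upto n. of_real (log_norm \<pi>) * direction6 \<pi> powi k) / of_nat n)) \<longlonglongrightarrow> c * 0"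
      by (intro tendsto_intros char_limit False)
    thus ?thesis unfolding circle_mean_mono using False by (simp add: sum_distrib_left mult_ac)
  qed
next
  case (trig_poly_add f g)
  have "circle_mean (\<lambda>z. f z + g z) = circle_mean f + circle_mean g"
    unfolding circle_mean_def using trig_poly_integrable trig_poly_add.hyps by (simp add: integral_add add_divide_distrib)
  moreover have "(\<lambda>n. (\<Sum>\<pi>\<in>primes_upto n. of_real (log_norm \<pi>) * f (direction6 \<pi>)) / of_nat n + (\<Sum>\<pi>\<in>primes_upto n. of_real (log_norm \<pi>) * g (direction6 \<pi>)) / of_nat n) \<longlonglongrightarrow> circle_mean f + circle_mean g"
    by (intro tendsto_add trig_poly_add.IH)
  ultimately show ?case by (simp add: distrib_left sum.distrib add_divide_distrib)
qed

text \<open>Agreement is only claimed on the unit circle, because adding exponents in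
  \<open>powi\<close> requires z \<noteq> 0.\<close>

lemma trig_poly_mult_mono: "trig_poly f \<Longrightarrow> \<exists>h. trig_poly h \<and> (\<forall>z. norm z = 1 \<longrightarrow> h z = f z * (c * z powi k))"
proof (induction rule: trig_poly.induct)
  case (trig_poly_mono d l)
  have "trig_poly (\<lambda>z. (d * c) * z powi (l + k))" by (rule trig_poly.trig_poly_mono)
  moreover have "(d * c) * z powi (l + k) = d * z powi l * (c * z powi k)" if "norm z = 1" for z :: complex
  proof -
    have "z \<noteq> 0" using that by auto
    thus ?thesis by (simp add: power_int_add)
  qed
  ultimately show ?case by blast
next
  case (trig_poly_add f g)
  then obtain h1 h2 where "trig_poly h1" "\<forall>z. norm z = 1 \<longrightarrow> h1 z = f z * (c * z powi k)" "trig_poly h2" "\<forall>z. norm z = 1 \<longrightarrow> h2 z = g z * (c * z powi k)" by blast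
  thus ?case by (intro exI[of _ "\<lambda>z. h1 z + h2 z"]) (auto intro: trig_poly.trig_poly_add simp: distrib_right)
qed

lemma trig_poly_mult:
  assumes f: "trig_poly f" and g: "trig_poly g"
  shows "\<exists>h. trig_poly h \<and> (\<forall>z. norm z = 1 \<longrightarrow> h z = f z * g z)"
  using g
proof (induction rule: trig_poly.induct)
  case (trig_poly_mono c k)
  show ?case by (rule trig_poly_mult_mono[OF f])
next
  case (trig_poly_add g1 g2)
  then obtain h1 h2 where "trig_poly h1" "\<forall>z. norm z = 1 \<longrightarrow> h1 z = f z * g1 z" "trig_poly h2" "\<forall>z. norm z = 1 \<longrightarrow> h2 z = f z * g2 z" by blast
  thus ?case by (intro exI[of _ "\<lambda>z. h1 z + h2 z"]) (auto intro: trig_poly.trig_poly_add simp: distrib_left)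
qed

text \<open>Brings the polynomials of the Stone-Weierstrass theorem within reach of
  \<open>trig_poly_limit\<close>: on the unit circle the two real coordinates are combinations of z
  and its inverse.\<close>

lemma real_polynomial_trig:
  fixes p :: "complex \<Rightarrow> real"
  assumes "real_polynomial_function p"
  shows "\<exists>h. trig_poly h \<and> (\<forall>z. norm z = 1 \<longrightarrow> h z = of_real (p z))"
  using assms
proof (induction rule: real_polynomial_function.induct)
  case (linear f)
  \<comment> \<open>From Re z = (z + 1/z) / 2 and Im z = (z - 1/z) / (2 \<i>) on the circle.\<close>
  define h where "h = (\<lambda>z::complex. (of_real (f 1) / 2 + of_real (f \<i>) / (2 * \<i>)) * z powi 1 + (of_real (f 1) / 2 - of_real (f \<i>) / (2 * \<i>)) * z powi (-1))"
  have "trig_poly h" unfolding h_def by (intro trig_poly.intros)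
  moreover have "h z = of_real (f z)" if z: "norm z = 1" for z
  proof -
    interpret bounded_linear f by fact
    have "z * cnj z = 1" using z complex_norm_square[of z] by simp
    hence inv: "z powi (-1) = cnj z" by (simp add: power_int_minus inverse_unique)
    have "z = Re z *\<^sub>R 1 + Im z *\<^sub>R \<i>" by (simp add: complex_eq_iff)
    hence "f z = Re z * f 1 + Im z * f \<i>" by (metis add real_scaleR_def scaleR)
    thus ?thesis unfolding h_def inv by (simp add: complex_eq_iff)
  qed
  ultimately show ?case by blast
next
  case (const c)
  have "trig_poly (\<lambda>z. of_real c * z powi 0)" by (rule trig_poly.intros)
  thus ?case by (intro exI[of _ "\<lambda>z. of_real c * z powi 0"]) simp
next
  case (add f g)
  then obtain h1 h2 where "trig_poly h1" "\<forall>z. norm z = 1 \<longrightarrow> h1 z = of_real (f z)" "trig_poly h2" "\<forall>z. norm z = 1 \<longrightarrow> h2 z = of_real (g z)" by blast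
  thus ?case by (intro exI[of _ "\<lambda>z. h1 z + h2 z"]) (auto intro: trig_poly.trig_poly_add)
next
  case (mult f g)
  then obtain h1 h2 where h: "trig_poly h1" "\<forall>z. norm z = 1 \<longrightarrow> h1 z = of_real (f z)" "trig_poly h2" "\<forall>z. norm z = 1 \<longrightarrow> h2 z = of_real (g z)" by blast
  obtain h where "trig_poly h" "\<forall>z. norm z = 1 \<longrightarrow> h z = h1 z * h2 z" using trig_poly_mult[OF h(1,3)] by blast
  thus ?case using h by auto
qed

text \<open>A uniform approximation of g by a polynomial transfers the limit, since the total weight
  is at most 2 n for large n. One inequality is enough for the treatment of arcs.\<close>

lemma weyl_lower:
  fixes g :: "complex \<Rightarrow> real"
  assumes g: "continuous_on (sphere 0 1) g" and I: "J \<le> integral {-pi..pi} (\<lambda>t. g (cis t))" and e: "e > 0"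
  shows "eventually (\<lambda>n. (\<Sum>\<pi>\<in>primes_upto n. log_norm \<pi> * g (direction6 \<pi>)) / real n \<ge> J / (2 * pi) - e) sequentially"
proof -
  \<comment> \<open>One \<epsilon> is lost in the integral, one in passing to the limit, and two in
    the sum, where the total weight divided by n is below 2.\<close>
  define \<epsilon> where "\<epsilon> = e / 4"
  have \<epsilon>: "\<epsilon> > 0" using e by (simp add: \<epsilon>_def)
  obtain p where p: "real_polynomial_function p" "\<And>z. z \<in> sphere 0 1 \<Longrightarrow> \<bar>g z - p z\<bar> < \<epsilon>"
    using Stone_Weierstrass_real_polynomial_function[OF compact_sphere g \<epsilon>] by metis
  obtain h where h: "trig_poly h" "\<And>z. norm z = 1 \<Longrightarrow> h z = of_real (p z)" using real_polynomial_trig[OF p(1)] by blast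
  have pc: "(\<lambda>t. p (cis t)) integrable_on {-pi..pi}"
  proof -
    have "continuous_on {-pi..pi} (\<lambda>t. p (cis t))"
      by (rule continuous_on_compose2[OF continuous_on_polymonial_function[of p UNIV]])
         (use p(1) in \<open>auto simp: real_polynomial_function_eq intro!: continuous_intros\<close>)
    thus ?thesis by (rule integrable_continuous_real)
  qed
  have gc: "(\<lambda>t. g (cis t)) integrable_on {-pi..pi}"
  proof -
    have "continuous_on {-pi..pi} (\<lambda>t. g (cis t))"
      by (rule continuous_on_compose2[OF g]) (auto intro!: continuous_intros)
    thus ?thesis by (rule integrable_continuous_real)
  qed
  have "integral {-pi..pi} (\<lambda>t. g (cis t)) \<le> integral {-pi..pi} (\<lambda>t. p (cis t) + \<epsilon>)"
  proof (rule integral_le[OF gc])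
    show "(\<lambda>t. p (cis t) + \<epsilon>) integrable_on {-pi..pi}" by (intro integrable_add pc integrable_const_ivl)
    show "g (cis t) \<le> p (cis t) + \<epsilon>" for t using p(2)[of "cis t"] by (simp add: abs_less_iff)
  qed
  also have "\<dots> = integral {-pi..pi} (\<lambda>t. p (cis t)) + 2 * pi * \<epsilon>"
    using pc by (subst integral_add) (auto simp: integrable_const_ivl)
  finally have "J \<le> integral {-pi..pi} (\<lambda>t. p (cis t)) + 2 * pi * \<epsilon>" using I by linarith
  hence "J / (2 * pi) \<le> (integral {-pi..pi} (\<lambda>t. p (cis t)) + 2 * pi * \<epsilon>) / (2 * pi)"
    by (rule divide_right_mono) simp
  hence Jp: "J / (2 * pi) - \<epsilon> \<le> integral {-pi..pi} (\<lambda>t. p (cis t)) / (2 * pi)"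
    by (simp add: add_divide_distrib)
  have hm: "circle_mean h = of_real (integral {-pi..pi} (\<lambda>t. p (cis t)) / (2 * pi))"
  proof -
    have "integral {-pi..pi} (\<lambda>t. h (cis t)) = integral {-pi..pi} (\<lambda>t. complex_of_real (p (cis t)))" by (simp add: h(2))
    also have "\<dots> = of_real (integral {-pi..pi} (\<lambda>t. p (cis t)))"
      using pc by (intro integral_unique has_integral_of_real integrable_integral)
    finally show ?thesis by (simp add: circle_mean_def)
  qed
  have lim: "(\<lambda>n. Re ((\<Sum>\<pi>\<in>primes_upto n. of_real (log_norm \<pi>) * h (direction6 \<pi>)) / of_nat n)) \<longlonglongrightarrow> Re (circle_mean h)"
    by (intro tendsto_Re trig_poly_limit h(1))
  have eq: "Re ((\<Sum>\<pi>\<in>primes_upto n. of_real (log_norm \<pi>) * h (direction6 \<pi>)) / of_nat n) = (\<Sum>\<pi>\<in>primes_upto n. log_norm \<pi> * p (direction6 \<pi>)) / real n" for n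
    by (simp add: Re_divide_of_nat h(2) norm_direction6)
  have "(\<lambda>n. (\<Sum>\<pi>\<in>primes_upto n. log_norm \<pi> * p (direction6 \<pi>)) / real n) \<longlonglongrightarrow> integral {-pi..pi} (\<lambda>t. p (cis t)) / (2 * pi)"
    using lim unfolding eq hm Re_complex_of_real .
  hence ev1: "eventually (\<lambda>n. (\<Sum>\<pi>\<in>primes_upto n. log_norm \<pi> * p (direction6 \<pi>)) / real n > integral {-pi..pi} (\<lambda>t. p (cis t)) / (2 * pi) - \<epsilon>) sequentially"
    using \<epsilon> by (intro order_tendstoD(1)) auto
  have ev2: "eventually (\<lambda>n. (\<Sum>\<pi>\<in>primes_upto n. log_norm \<pi>) / real n < 2) sequentially"
    by (rule order_tendstoD(2)[OF theta_limit]) simp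
  show ?thesis using ev1 ev2
  proof eventually_elim
    case (elim n)
    have "(\<Sum>\<pi>\<in>primes_upto n. log_norm \<pi> * p (direction6 \<pi>)) \<le> (\<Sum>\<pi>\<in>primes_upto n. log_norm \<pi> * g (direction6 \<pi>) + \<epsilon> * log_norm \<pi>)"
    proof (rule sum_mono)
      fix \<pi> assume \<pi>: "\<pi> \<in> primes_upto n"
      have "p (direction6 \<pi>) \<le> g (direction6 \<pi>) + \<epsilon>" using p(2)[of "direction6 \<pi>"] norm_direction6[OF \<pi>] by (simp add: abs_less_iff)
      from mult_left_mono[OF this log_norm_nonneg[OF \<pi>]] show "log_norm \<pi> * p (direction6 \<pi>) \<le> log_norm \<pi> * g (direction6 \<pi>) + \<epsilon> * log_norm \<pi>"
        by (simp add: algebra_simps)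
    qed
    also have "\<dots> = (\<Sum>\<pi>\<in>primes_upto n. log_norm \<pi> * g (direction6 \<pi>)) + \<epsilon> * (\<Sum>\<pi>\<in>primes_upto n. log_norm \<pi>)"
      by (simp add: sum.distrib sum_distrib_left)
    finally have "(\<Sum>\<pi>\<in>primes_upto n. log_norm \<pi> * p (direction6 \<pi>)) / real n \<le> ((\<Sum>\<pi>\<in>primes_upto n. log_norm \<pi> * g (direction6 \<pi>)) + \<epsilon> * (\<Sum>\<pi>\<in>primes_upto n. log_norm \<pi>)) / real n"
      by (intro divide_right_mono) auto
    also have "\<dots> = (\<Sum>\<pi>\<in>primes_upto n. log_norm \<pi> * g (direction6 \<pi>)) / real n + \<epsilon> * ((\<Sum>\<pi>\<in>primes_upto n. log_norm \<pi>) / real n)"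
      by (simp add: add_divide_distrib)
    also have "\<epsilon> * ((\<Sum>\<pi>\<in>primes_upto n. log_norm \<pi>) / real n) \<le> \<epsilon> * 2" using elim(2) \<epsilon> by (intro mult_left_mono) auto
    finally show ?case using elim(1) Jp unfolding \<epsilon>_def by linarith
  qed
qed

section \<open>Arcs and their logarithmic counts\<close>

definition log_count :: "(complex \<Rightarrow> bool) \<Rightarrow> nat \<Rightarrow> real" where
  "log_count Q n = (\<Sum>\<pi> | \<pi> \<in> primes_upto n \<and> Q \<pi>. log_norm \<pi>)"

lemma Arg_direction6: "\<pi> \<in> primes_upto n \<Longrightarrow> direction6 \<pi> = cis (6 * Arg \<pi>)"
proof -
  assume "\<pi> \<in> primes_upto n"
  hence "\<pi> \<noteq> 0" using sector_primesD(2) by (simp add: primes_upto_def)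
  hence "sgn \<pi> = cis (Arg \<pi>)" by (simp add: cis_Arg)
  thus ?thesis by (simp add: direction6_def Complex.DeMoivre)
qed

text \<open>
  Lower bounds for arcs avoiding the cut suffice: applied to the complement of an arc they yield
  the upper bound.
\<close>
lemma arc_lower:
  assumes ab: "- pi \<le> a" "a \<le> b" "b \<le> pi" and e: "e > 0"
  shows "eventually (\<lambda>n. log_count (\<lambda>\<pi>. a < 6 * Arg \<pi> \<and> 6 * Arg \<pi> < b) n / real n \<ge> (b - a) / (2 * pi) - e) sequentially"
\<comment> \<open>If the claimed bound is not positive, nonnegativity suffices; otherwise the arc is
  long enough for the shrunken half-width r' to be positive.\<close>
proof (cases "(b - a) / (2 * pi) \<le> e")
  case True
  have "log_count (\<lambda>\<pi>. a < 6 * Arg \<pi> \<and> 6 * Arg \<pi> < b) n / real n \<ge> 0" for n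
    unfolding log_count_def by (intro divide_nonneg_nonneg sum_nonneg) (auto intro: log_norm_nonneg)
  thus ?thesis using True by (intro always_eventually allI) (smt (verit))
next
  case False
  define c r \<eta> where "c = (a + b) / 2" and "r = (b - a) / 2" and "\<eta> = e / 2"
  have \<eta>: "\<eta> > 0" using e by (simp add: \<eta>_def)
  define r' where "r' = r - pi * \<eta>"
  have r: "0 < r'" "r' < r" "r \<le> pi"
    using False ab \<eta> by (auto simp: r'_def r_def \<eta>_def field_simps)
  have cc: "cos r < cos r'" using r by (intro cos_monotone_0_pi) auto
  define K where "K = 1 / (cos r' - cos r)"
  have K: "K > 0" using cc by (simp add: K_def)
  \<comment> \<open>A plateau in terms of cos (t - c): equal to 1 for |t - c| \<le> r' and to 0
    outside the arc. Using the cosine makes it a continuous function on the circle. Shrinking costs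
    \<eta> and \<open>weyl_lower\<close> another \<eta>, together e.\<close>
  define g where "g = (\<lambda>z. min 1 (max 0 (K * (Re (z * cis (- c)) - cos r))))"
  have gcis: "g (cis t) = min 1 (max 0 (K * (cos (t - c) - cos r)))" for t
    unfolding g_def cis_mult by simp
  have g01: "0 \<le> g z" "g z \<le> 1" for z by (auto simp: g_def)
  have gcont: "continuous_on A g" for A unfolding g_def by (intro continuous_intros)
  have "2 * r' \<le> integral {-pi..pi} (\<lambda>t. g (cis t))"
  proof -
    have "c - r = a" "c + r = b" by (simp_all add: c_def r_def field_simps)
    hence sub: "{c - r'..c + r'} \<subseteq> {-pi..pi}" using r ab by auto
    have int: "(\<lambda>t. g (cis t)) integrable_on {x..y}" for x y
      by (intro integrable_continuous_real continuous_on_compose2[OF gcont[of UNIV]]) (auto intro!: continuous_intros)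
    have one: "g (cis t) = 1" if t: "t \<in> {c - r'..c + r'}" for t
    proof -
      have "\<bar>t - c\<bar> \<le> r'" using t by auto
      hence "cos r' \<le> cos \<bar>t - c\<bar>" using r by (intro cos_monotone_0_pi_le) auto
      hence "K * (cos r' - cos r) \<le> K * (cos (t - c) - cos r)" using K by (intro mult_left_mono) auto
      moreover have "K * (cos r' - cos r) = 1" using cc by (simp add: K_def)
      ultimately show ?thesis unfolding gcis by simp
    qed
    have "integral {c - r'..c + r'} (\<lambda>t. g (cis t)) = integral {c - r'..c + r'} (\<lambda>t. 1)"
      by (rule integral_cong) (rule one)
    also have "\<dots> = 2 * r'" using r by simp
    finally have "2 * r' = integral {c - r'..c + r'} (\<lambda>t. g (cis t))" by simp
    also have "\<dots> \<le> integral {-pi..pi} (\<lambda>t. g (cis t))"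
      by (rule integral_subset_le[OF sub int int]) (use g01 in blast)
    finally show ?thesis .
  qed
  from weyl_lower[OF gcont this \<eta>]
  have "eventually (\<lambda>n. (\<Sum>\<pi>\<in>primes_upto n. log_norm \<pi> * g (direction6 \<pi>)) / real n \<ge> 2 * r' / (2 * pi) - \<eta>) sequentially" .
  moreover have "2 * r' / (2 * pi) - \<eta> = (b - a) / (2 * pi) - e"
    by (simp add: r'_def r_def \<eta>_def field_simps)
  ultimately have ev: "eventually (\<lambda>n. (\<Sum>\<pi>\<in>primes_upto n. log_norm \<pi> * g (direction6 \<pi>)) / real n \<ge> (b - a) / (2 * pi) - e) sequentially" by simp
  have le: "(\<Sum>\<pi>\<in>primes_upto n. log_norm \<pi> * g (direction6 \<pi>)) \<le> log_count (\<lambda>\<pi>. a < 6 * Arg \<pi> \<and> 6 * Arg \<pi> < b) n" for n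
  proof -
    have zero: "g (direction6 \<pi>) = 0" if \<pi>: "\<pi> \<in> primes_upto n" and out: "\<not> (a < 6 * Arg \<pi> \<and> 6 * Arg \<pi> < b)" for \<pi>
    proof -
      define t where "t = 6 * Arg \<pi>"
      have "sector \<pi>" using \<pi> by (simp add: primes_upto_def sector_primes_def)
      hence t: "- pi \<le> t" "t < pi" by (auto simp: sector_def t_def)
      have far: "r \<le> \<bar>t - c\<bar>" using out by (auto simp: t_def c_def r_def field_simps abs_if)
      \<comment> \<open>Distance has to be measured around the circle: an angle farther than pi from
        c is compared through 2 * pi - |t - c|, which is still at least r because the arc lies
        between - pi and pi.\<close>
      have far2: "\<bar>t - c\<bar> \<le> 2 * pi - r" using t ab by (auto simp: c_def r_def abs_if field_simps)
      have "cos \<bar>t - c\<bar> \<le> cos r"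
      proof (cases "\<bar>t - c\<bar> \<le> pi")
        case True
        thus ?thesis using far r by (intro cos_monotone_0_pi_le) auto
      next
        case False
        have "cos \<bar>t - c\<bar> = cos (2 * pi - \<bar>t - c\<bar>)" by (simp add: cos_diff)
        also have "\<dots> \<le> cos r" using far2 False r by (intro cos_monotone_0_pi_le) auto
        finally show ?thesis .
      qed
      hence "K * (cos (t - c) - cos r) \<le> 0" using K by (simp add: mult_nonneg_nonpos)
      thus ?thesis unfolding Arg_direction6[OF \<pi>] gcis t_def by simp
    qed
    have "(\<Sum>\<pi>\<in>primes_upto n. log_norm \<pi> * g (direction6 \<pi>)) = (\<Sum>\<pi> | \<pi> \<in> primes_upto n \<and> (a < 6 * Arg \<pi> \<and> 6 * Arg \<pi> < b). log_norm \<pi> * g (direction6 \<pi>))"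
      by (rule sum.mono_neutral_right) (use primes_upto_finite zero in auto)
    also have "\<dots> \<le> log_count (\<lambda>\<pi>. a < 6 * Arg \<pi> \<and> 6 * Arg \<pi> < b) n"
      unfolding log_count_def using g01 log_norm_nonneg by (intro sum_mono) (auto simp: mult_left_le)
    finally show ?thesis .
  qed
  show ?thesis using ev
  proof eventually_elim
    case (elim n)
    have "(\<Sum>\<pi>\<in>primes_upto n. log_norm \<pi> * g (direction6 \<pi>)) / real n \<le> log_count (\<lambda>\<pi>. a < 6 * Arg \<pi> \<and> 6 * Arg \<pi> < b) n / real n"
      by (rule divide_right_mono[OF le]) simp
    thus ?case using elim by linarith
  qed
qed

lemma log_count_mono:
  assumes "\<And>\<pi>. \<pi> \<in> primes_upto n \<Longrightarrow> Q \<pi> \<Longrightarrow> Q' \<pi>" shows "log_count Q n \<le> log_count Q' n"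
  unfolding log_count_def by (rule sum_mono2) (use assms primes_upto_finite in \<open>auto intro: log_norm_nonneg\<close>)

lemma log_count_compl: "log_count Q n + log_count (\<lambda>\<pi>. \<not> Q \<pi>) n = (\<Sum>\<pi>\<in>primes_upto n. log_norm \<pi>)"
proof -
  have "(\<Sum>\<pi>\<in>primes_upto n. log_norm \<pi>) = (\<Sum>\<pi>\<in>{\<pi>. \<pi> \<in> primes_upto n \<and> Q \<pi>} \<union> {\<pi>. \<pi> \<in> primes_upto n \<and> \<not> Q \<pi>}. log_norm \<pi>)" by (rule sum.cong) auto
  also have "\<dots> = log_count Q n + log_count (\<lambda>\<pi>. \<not> Q \<pi>) n"
    unfolding log_count_def by (rule sum.union_disjoint) (use primes_upto_finite in auto)
  finally show ?thesis by simp
qed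

lemma log_count_disj:
  assumes "\<And>\<pi>. \<not> (Q \<pi> \<and> Q' \<pi>)" shows "log_count (\<lambda>\<pi>. Q \<pi> \<or> Q' \<pi>) n = log_count Q n + log_count Q' n"
proof -
  have "{\<pi>. \<pi> \<in> primes_upto n \<and> (Q \<pi> \<or> Q' \<pi>)} = {\<pi>. \<pi> \<in> primes_upto n \<and> Q \<pi>} \<union> {\<pi>. \<pi> \<in> primes_upto n \<and> Q' \<pi>}" by auto
  thus ?thesis unfolding log_count_def by (simp only:) (rule sum.union_disjoint, use primes_upto_finite assms in auto)
qed

lemma arc_limit:
  assumes "- pi / 6 \<le> \<phi>1" "\<phi>1 < \<phi>2" "\<phi>2 < pi / 6"
  shows "(\<lambda>n. log_count (\<lambda>\<pi>. \<phi>1 \<le> Arg \<pi> \<and> Arg \<pi> \<le> \<phi>2) n / real n) \<longlonglongrightarrow> 3 / pi * (\<phi>2 - \<phi>1)"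
proof (rule tendstoI)
  fix e :: real assume e: "e > 0"
  define Q where "Q = (\<lambda>\<pi>. \<phi>1 \<le> Arg \<pi> \<and> Arg \<pi> \<le> \<phi>2)"
  \<comment> \<open>The upper bound loses one \<epsilon> for each of the two complementary arcs and
    one for the total, together less than e.\<close>
  define \<epsilon> where "\<epsilon> = e / 4"
  have \<epsilon>: "\<epsilon> > 0" using e by (simp add: \<epsilon>_def)
  define I where "I = (\<lambda>a b \<pi>. a < 6 * Arg \<pi> \<and> 6 * Arg \<pi> < b)"
  have ev1: "eventually (\<lambda>n. log_count (I (6 * \<phi>1) (6 * \<phi>2)) n / real n \<ge> (6 * \<phi>2 - 6 * \<phi>1) / (2 * pi) - \<epsilon>) sequentially"
    unfolding I_def by (rule arc_lower) (use assms \<epsilon> in auto)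
  have ev2: "eventually (\<lambda>n. log_count (I (- pi) (6 * \<phi>1)) n / real n \<ge> (6 * \<phi>1 - (- pi)) / (2 * pi) - \<epsilon>) sequentially"
    unfolding I_def by (rule arc_lower) (use assms \<epsilon> in auto)
  have ev3: "eventually (\<lambda>n. log_count (I (6 * \<phi>2) pi) n / real n \<ge> (pi - 6 * \<phi>2) / (2 * pi) - \<epsilon>) sequentially"
    unfolding I_def by (rule arc_lower) (use assms \<epsilon> in auto)
  have ev4: "eventually (\<lambda>n. (\<Sum>\<pi>\<in>primes_upto n. log_norm \<pi>) / real n < 1 + \<epsilon>) sequentially"
    by (rule order_tendstoD(2)[OF theta_limit]) (use \<epsilon> in simp)
  show "eventually (\<lambda>n. dist (log_count (\<lambda>\<pi>. \<phi>1 \<le> Arg \<pi> \<and> Arg \<pi> \<le> \<phi>2) n / real n) (3 / pi * (\<phi>2 - \<phi>1)) < e) sequentially"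
    using ev1 ev2 ev3 ev4
  proof eventually_elim
    case (elim n)
    have 1: "log_count (I (6 * \<phi>1) (6 * \<phi>2)) n / real n \<le> log_count Q n / real n"
      by (intro divide_right_mono log_count_mono) (auto simp: I_def Q_def)
    have "log_count (I (- pi) (6 * \<phi>1)) n + log_count (I (6 * \<phi>2) pi) n = log_count (\<lambda>\<pi>. I (- pi) (6 * \<phi>1) \<pi> \<or> I (6 * \<phi>2) pi \<pi>) n"
      by (rule log_count_disj[symmetric]) (use assms in \<open>auto simp: I_def\<close>)
    also have "\<dots> \<le> log_count (\<lambda>\<pi>. \<not> Q \<pi>) n" by (rule log_count_mono) (auto simp: I_def Q_def)
    finally have "log_count (I (- pi) (6 * \<phi>1)) n + log_count (I (6 * \<phi>2) pi) n + log_count Q n \<le> (\<Sum>\<pi>\<in>primes_upto n. log_norm \<pi>)"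
      using log_count_compl[of Q n] by linarith
    hence "(log_count (I (- pi) (6 * \<phi>1)) n + log_count (I (6 * \<phi>2) pi) n + log_count Q n) / real n \<le> (\<Sum>\<pi>\<in>primes_upto n. log_norm \<pi>) / real n"
      by (rule divide_right_mono) simp
    hence 2: "log_count (I (- pi) (6 * \<phi>1)) n / real n + log_count (I (6 * \<phi>2) pi) n / real n + log_count Q n / real n \<le> (\<Sum>\<pi>\<in>primes_upto n. log_norm \<pi>) / real n"
      by (simp add: add_divide_distrib)
    have "(6 * \<phi>2 - 6 * \<phi>1) / (2 * pi) = 3 / pi * (\<phi>2 - \<phi>1)" by (simp add: field_simps)
    moreover have "(6 * \<phi>1 - (- pi)) / (2 * pi) + (pi - 6 * \<phi>2) / (2 * pi) = 1 - 3 / pi * (\<phi>2 - \<phi>1)" by (simp add: field_simps)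
    ultimately have "\<bar>log_count Q n / real n - 3 / pi * (\<phi>2 - \<phi>1)\<bar> < e"
      using elim 1 2 \<epsilon> unfolding \<epsilon>_def by linarith
    thus ?case unfolding Q_def dist_real_def .
  qed
qed

section \<open>From logarithmic weights to counting primes\<close>

definition prime_count :: "(complex \<Rightarrow> bool) \<Rightarrow> nat \<Rightarrow> nat" where
  "prime_count Q n = card {\<pi>. \<pi> \<in> primes_upto n \<and> Q \<pi>}"

text \<open>From below, each weight is at most ln n. From above, primes of norm at most n^(1 -
  \<delta>) are negligible by Chebyshev's bound, and the remaining ones have weight at least (1 -
  \<delta>) ln n. This replaces partial summation.\<close>

lemma count_limit:
  assumes A: "A \<ge> 0" and lim: "(\<lambda>n. log_count Q n / real n) \<longlonglongrightarrow> A"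
  shows "(\<lambda>n. real (prime_count Q n) * ln (real n) / real n) \<longlonglongrightarrow> A"
proof (rule tendstoI)
  fix e :: real assume e: "e > 0"
  have lower: "log_count Q n / real n \<le> real (prime_count Q n) * ln (real n) / real n" for n
  proof (rule divide_right_mono)
    have "log_count Q n \<le> (\<Sum>\<pi> | \<pi> \<in> primes_upto n \<and> Q \<pi>. ln (real n))"
      unfolding log_count_def
    proof (rule sum_mono)
      fix \<pi> assume "\<pi> \<in> {\<pi> \<in> primes_upto n. Q \<pi>}"
      hence "enorm \<pi> \<ge> 2" "enorm \<pi> \<le> n" using sector_primes_enorm_ge by (auto simp: primes_upto_def)
      thus "log_norm \<pi> \<le> ln (real n)" unfolding log_norm_def by simp
    qed
    thus "log_count Q n \<le> real (prime_count Q n) * ln (real n)" by (simp add: prime_count_def)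
  qed simp
  \<comment> \<open>Small enough that A / (1 - \<delta>) stays below A + e: the loss \<delta> A is
    at most e / 4, while e (1 - \<delta>) is at least e / 2.\<close>
  define \<delta> where "\<delta> = min (1 / 2) (e / (4 * (A + 1)))"
  have \<delta>: "\<delta> > 0" "\<delta> \<le> 1 / 2" unfolding \<delta>_def using e A by (simp, intro min.cobounded1)
  have "\<delta> * (A + 1) \<le> e / (4 * (A + 1)) * (A + 1)" using A by (intro mult_right_mono) (auto simp: \<delta>_def)
  also have "\<dots> = e / 4" using A by (simp add: field_simps)
  finally have \<delta>A: "\<delta> * (A + 1) \<le> e / 4" .
  have upper: "real (prime_count Q n) * ln (real n) / real n \<le> 4 * (ln (real n) * real n powr (- \<delta>)) + (log_count Q n / real n) / (1 - \<delta>)"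
    if n: "n \<ge> 2" for n
  proof -
    \<comment> \<open>The cut between small and large norms; y ln n / n = n^(- \<delta>) ln n tends
      to 0.\<close>
    define y where "y = real n powr (1 - \<delta>)"
    have y: "y > 0" using n by (simp add: y_def)
    have L: "ln (real n) > 0" using n by simp
    define S1 where "S1 = {\<pi>. \<pi> \<in> primes_upto n \<and> real (enorm \<pi>) \<le> y}"
    define S2 where "S2 = {\<pi>. \<pi> \<in> primes_upto n \<and> Q \<pi> \<and> real (enorm \<pi>) > y}"
    have fin: "finite S1" "finite S2" using primes_upto_finite by (auto simp: S1_def S2_def)
    have "prime_count Q n \<le> card (S1 \<union> S2)" unfolding prime_count_def by (rule card_mono) (use fin in \<open>auto simp: S1_def S2_def\<close>)
    also have "\<dots> \<le> card S1 + card S2" by (rule card_Un_le)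
    finally have C: "real (prime_count Q n) \<le> real (card S1) + real (card S2)" by linarith
    have "real (card S1) * ln 2 = (\<Sum>\<pi>\<in>S1. ln 2)" by simp
    also have "\<dots> \<le> (\<Sum>\<pi>\<in>S1. log_norm \<pi>)"
    proof (rule sum_mono)
      fix \<pi> assume "\<pi> \<in> S1"
      hence "enorm \<pi> \<ge> 2" using sector_primes_enorm_ge by (auto simp: S1_def primes_upto_def)
      thus "ln 2 \<le> log_norm \<pi>" unfolding log_norm_def by simp
    qed
    also have "\<dots> \<le> (\<Sum>\<pi> | \<pi> \<in> sector_primes \<and> enorm \<pi> \<le> nat \<lfloor>y\<rfloor>. ln (real (enorm \<pi>)))"
    proof (unfold log_norm_def, rule sum_mono2)
      show "finite {\<pi> \<in> sector_primes. enorm \<pi> \<le> nat \<lfloor>y\<rfloor>}" by (rule sector_primes_bounded_finite)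
      show "S1 \<subseteq> {\<pi> \<in> sector_primes. enorm \<pi> \<le> nat \<lfloor>y\<rfloor>}" by (auto simp: S1_def primes_upto_def le_nat_floor)
      show "0 \<le> ln (real (enorm b))" if "b \<in> {\<pi> \<in> sector_primes. enorm \<pi> \<le> nat \<lfloor>y\<rfloor>} - S1" for b
        using that sector_primes_enorm_ge[of b] by auto
    qed
    also have "\<dots> \<le> 2 * ln 4 * real (nat \<lfloor>y\<rfloor>)" by (rule chebyshev_sector_primes)
    also have "\<dots> \<le> 2 * ln 4 * y" using y by (intro mult_left_mono) auto
    also have "ln (4::real) = 2 * ln 2" using ln_realpow[of 2 2] by simp
    finally have "real (card S1) * ln 2 \<le> (4 * y) * ln 2" by (simp add: algebra_simps)
    hence c1: "real (card S1) \<le> 4 * y" by (simp add: mult_le_cancel_right)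
    have "real (card S2) * ((1 - \<delta>) * ln (real n)) = (\<Sum>\<pi>\<in>S2. (1 - \<delta>) * ln (real n))" by simp
    also have "\<dots> \<le> (\<Sum>\<pi>\<in>S2. log_norm \<pi>)"
    proof (rule sum_mono)
      fix \<pi> assume "\<pi> \<in> S2"
      hence "y < real (enorm \<pi>)" by (simp add: S2_def)
      hence "ln y \<le> log_norm \<pi>" unfolding log_norm_def using y by simp
      thus "(1 - \<delta>) * ln (real n) \<le> log_norm \<pi>" using n by (simp add: y_def ln_powr)
    qed
    also have "\<dots> \<le> log_count Q n" unfolding log_count_def
      by (rule sum_mono2) (use primes_upto_finite in \<open>auto simp: S2_def intro: log_norm_nonneg\<close>)
    finally have c2: "real (card S2) * ln (real n) \<le> log_count Q n / (1 - \<delta>)" using \<delta> by (simp add: field_simps)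
    have "real (prime_count Q n) * ln (real n) \<le> (real (card S1) + real (card S2)) * ln (real n)"
      by (rule mult_right_mono[OF C]) (use L in simp)
    also have "\<dots> = real (card S1) * ln (real n) + real (card S2) * ln (real n)" by (rule distrib_right)
    also have "\<dots> \<le> 4 * y * ln (real n) + log_count Q n / (1 - \<delta>)"
      by (rule add_mono[OF mult_right_mono[OF c1] c2]) (use L in simp)
    finally have "real (prime_count Q n) * ln (real n) / real n \<le> (4 * y * ln (real n) + log_count Q n / (1 - \<delta>)) / real n"
      by (rule divide_right_mono) simp
    also have "\<dots> = 4 * (ln (real n) * (y / real n)) + (log_count Q n / real n) / (1 - \<delta>)"
      by (simp add: add_divide_distrib mult_ac)
    also have "y / real n = real n powr (- \<delta>)"
      using n powr_diff[of "real n" "1 - \<delta>" 1] by (simp add: y_def)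
    finally show ?thesis .
  qed
  have "(\<lambda>n. 4 * (ln (real n) * real n powr (- \<delta>)) + (log_count Q n / real n) / (1 - \<delta>)) \<longlonglongrightarrow> 4 * 0 + A / (1 - \<delta>)"
  proof (intro tendsto_add tendsto_mult tendsto_const tendsto_divide lim)
    show "(\<lambda>n. ln (real n) * real n powr (- \<delta>)) \<longlonglongrightarrow> 0" using \<delta>(1) by real_asymp
  qed (use \<delta> in auto)
  moreover have "A / (1 - \<delta>) < A + e"
  proof -
    have "A < (A + e) * (1 - \<delta>)"
    proof -
      have "\<delta> * A \<le> e / 4" using \<delta>A \<delta> by (simp add: algebra_simps)
      moreover have "e * (1 - \<delta>) \<ge> e * (1 / 2)" using \<delta> e by (intro mult_left_mono) auto
      ultimately show ?thesis using e by (simp add: algebra_simps)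
    qed
    thus ?thesis using \<delta> by (simp add: field_simps)
  qed
  ultimately have ev1: "eventually (\<lambda>n. 4 * (ln (real n) * real n powr (- \<delta>)) + (log_count Q n / real n) / (1 - \<delta>) < A + e) sequentially"
    by (intro order_tendstoD(2)) auto
  have ev2: "eventually (\<lambda>n. log_count Q n / real n > A - e) sequentially"
    by (rule order_tendstoD(1)[OF lim]) (use e in simp)
  show "eventually (\<lambda>n. dist (real (prime_count Q n) * ln (real n) / real n) A < e) sequentially"
    using ev1 ev2 eventually_ge_at_top[of 2]
  proof eventually_elim
    case (elim n)
    show ?case using upper[OF elim(3)] lower[of n] elim(1,2) unfolding dist_real_def by linarith
  qed
qed

text \<open>Each prime ideal has exactly one generator in the sector, with the norm and the angle of
  the ideal. A general condition Q lets one lemma serve numerator and denominator.\<close>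

lemma card_prime_ideals:
  assumes x: "x \<ge> 0"
  shows "card {P. eis_nonzero_prime_ideal P \<and> real (ideal_norm P) \<le> x \<and> Q (theta P)} = prime_count (\<lambda>\<pi>. Q (Arg \<pi>)) (nat \<lfloor>x\<rfloor>)"
proof -
  define T where "T = {\<pi>. \<pi> \<in> primes_upto (nat \<lfloor>x\<rfloor>) \<and> Q (Arg \<pi>)}"
  have n: "real (enorm \<pi>) \<le> x \<longleftrightarrow> enorm \<pi> \<le> nat \<lfloor>x\<rfloor>" for \<pi>
    using x by (simp add: le_nat_iff le_floor_iff)
  have "{P. eis_nonzero_prime_ideal P \<and> real (ideal_norm P) \<le> x \<and> Q (theta P)} = principal_ideal ` T"
  proof (intro equalityI subsetI)
    fix P assume P: "P \<in> {P. eis_nonzero_prime_ideal P \<and> real (ideal_norm P) \<le> x \<and> Q (theta P)}"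
    then obtain \<pi> where p: "\<pi> \<in> sector_primes" "P = principal_ideal \<pi>" using prime_ideals_eq by blast
    thus "P \<in> principal_ideal ` T"
      using P ideal_norm_principal[OF sector_primesD(1,2)[OF p(1)]] theta_principal[OF p(1)] n by (auto simp: T_def primes_upto_def)
  next
    fix P assume "P \<in> principal_ideal ` T"
    then obtain \<pi> where p: "\<pi> \<in> sector_primes" "P = principal_ideal \<pi>" "enorm \<pi> \<le> nat \<lfloor>x\<rfloor>" "Q (Arg \<pi>)" by (auto simp: T_def primes_upto_def)
    have "eis_nonzero_prime_ideal P" using p prime_ideals_eq by blast
    thus "P \<in> {P. eis_nonzero_prime_ideal P \<and> real (ideal_norm P) \<le> x \<and> Q (theta P)}"
      using p ideal_norm_principal[OF sector_primesD(1,2)[OF p(1)]] theta_principal[OF p(1)] n by auto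
  qed
  moreover have "inj_on principal_ideal T"
    by (rule inj_on_subset[OF principal_inj_sector_primes]) (auto simp: T_def primes_upto_def)
  ultimately show ?thesis by (simp add: card_image prime_count_def T_def)
qed

theorem theorem1p4:
  fixes \<phi>1 \<phi>2 :: real
  assumes "- pi / 6 \<le> \<phi>1" and "\<phi>1 < \<phi>2" and "\<phi>2 < pi / 6"
  shows "((\<lambda>x::real.
            real (card {P. eis_nonzero_prime_ideal P \<and> real (ideal_norm P) \<le> x
                           \<and> \<phi>1 \<le> theta P \<and> theta P \<le> \<phi>2})
          / real (card {P. eis_nonzero_prime_ideal P \<and> real (ideal_norm P) \<le> x}))
         \<longlongrightarrow> 3 / pi * (\<phi>2 - \<phi>1)) at_top"
proof -
  define Q where "Q = (\<lambda>t. \<phi>1 \<le> t \<and> t \<le> \<phi>2)"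
  \<comment> \<open>Numerator and denominator are normalised by the same factor ln n / n, which
    cancels in the quotient from n = 2 on.\<close>
  have "(\<lambda>n. real (prime_count (\<lambda>\<pi>. Q (Arg \<pi>)) n) * ln (real n) / real n) \<longlonglongrightarrow> 3 / pi * (\<phi>2 - \<phi>1)"
    unfolding Q_def by (rule count_limit[OF _ arc_limit[OF assms]]) (use assms in simp)
  moreover have "(\<lambda>n. real (prime_count (\<lambda>\<pi>. True) n) * ln (real n) / real n) \<longlonglongrightarrow> 1"
    by (rule count_limit) (use theta_limit in \<open>simp_all add: log_count_def\<close>)
  ultimately have "(\<lambda>n. (real (prime_count (\<lambda>\<pi>. Q (Arg \<pi>)) n) * ln (real n) / real n) / (real (prime_count (\<lambda>\<pi>. True) n) * ln (real n) / real n)) \<longlonglongrightarrow> 3 / pi * (\<phi>2 - \<phi>1) / 1"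
    by (rule tendsto_divide) simp
  hence r: "(\<lambda>n. real (prime_count (\<lambda>\<pi>. Q (Arg \<pi>)) n) / real (prime_count (\<lambda>\<pi>. True) n)) \<longlonglongrightarrow> 3 / pi * (\<phi>2 - \<phi>1) / 1"
  proof (rule Lim_transform_eventually)
    show "eventually (\<lambda>n. (real (prime_count (\<lambda>\<pi>. Q (Arg \<pi>)) n) * ln (real n) / real n) / (real (prime_count (\<lambda>\<pi>. True) n) * ln (real n) / real n)
        = real (prime_count (\<lambda>\<pi>. Q (Arg \<pi>)) n) / real (prime_count (\<lambda>\<pi>. True) n)) sequentially"
      using eventually_ge_at_top[of 2]
    proof eventually_elim
      case (elim n)
      have "ln (real n) \<noteq> 0" "real n \<noteq> 0" using elim by auto
      thus ?case by simp
    qed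
  qed
  have fl: "filterlim (\<lambda>x::real. nat \<lfloor>x\<rfloor>) sequentially at_top"
    by (rule filterlim_compose[OF filterlim_nat_sequentially filterlim_floor_sequentially])
  have "((\<lambda>x::real. real (prime_count (\<lambda>\<pi>. Q (Arg \<pi>)) (nat \<lfloor>x\<rfloor>)) / real (prime_count (\<lambda>\<pi>. True) (nat \<lfloor>x\<rfloor>))) \<longlongrightarrow> 3 / pi * (\<phi>2 - \<phi>1) / 1) at_top"
    by (rule filterlim_compose[OF r fl])
  \<comment> \<open>The trivial conjunct \<open>True\<close> gives the denominator the shape of
    \<open>card_prime_ideals\<close> with a constant condition.\<close>
  hence "((\<lambda>x::real.
            real (card {P. eis_nonzero_prime_ideal P \<and> real (ideal_norm P) \<le> x \<and> Q (theta P)})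
          / real (card {P. eis_nonzero_prime_ideal P \<and> real (ideal_norm P) \<le> x \<and> True}))
         \<longlongrightarrow> 3 / pi * (\<phi>2 - \<phi>1) / 1) at_top"
  proof (rule Lim_transform_eventually)
    show "eventually (\<lambda>x. real (prime_count (\<lambda>\<pi>. Q (Arg \<pi>)) (nat \<lfloor>x\<rfloor>)) / real (prime_count (\<lambda>\<pi>. True) (nat \<lfloor>x\<rfloor>)) =
       real (card {P. eis_nonzero_prime_ideal P \<and> real (ideal_norm P) \<le> x \<and> Q (theta P)})
          / real (card {P. eis_nonzero_prime_ideal P \<and> real (ideal_norm P) \<le> x \<and> True})) at_top"
      using eventually_ge_at_top[of 0]
    proof eventually_elim
      case (elim x)
      show ?case using card_prime_ideals[OF elim, of Q] card_prime_ideals[OF elim, of "\<lambda>_. True"] by simp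
    qed
  qed
  thus ?thesis unfolding Q_def by simp
qed

end
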